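(* Let $\Omega$ be a bounded open subset of $\mathbb{R}^N$ and let $\alpha,\beta>0$. Let $\{M_n\}$ be a sequence of measurable $N\times N$ matrix-valued functions on $\Omega$ such that, for every $n$, $$\alpha|\xi|^2\le M_n(x)\xi\cdot\xi,\qquad |M_n(x)|\le\beta,\qquad\text{for a.e. }x\in\Omega,\ \forall\,\xi\in\mathbb{R}^N,$$ and suppose that $\{M_n\}$ $G$-converges to a bounded elliptic matrix $M_0$. Let $\{a_n\}$ and $\{f_n\}$ be sequences of functions in $L^1(\Omega)$ for which there exists $Q>0$, independent of $n$, such that $|f_n(x)|\le Q\,a_n(x)$ for a.e. $x\in\Omega$ and every $n$, and suppose that $\{f_n\}$ and $\{a_n\}$ converge weakly in $L^1(\Omega)$ to $f_0$ and $a_0$, respectively. For each $n$ let $u_n\in W_0^{1,2}(\Omega)\cap L^\infty(\Omega)$ be the solution of $$\int_\Omega M_n(x)\nabla u_n\cdot\nabla\varphi+\int_\Omega a_n(x)\,u_n\varphi=\int_\Omega f_n(x)\varphi,\qquad\forall\,\varphi\in W_0^{1,2}(\Omega)\cap L^\infty(\Omega).$$ Then $\{u_n\}$ converges weakly in $W_0^{1,2}(\Omega)$ and weakly-$*$ in $L^\infty(\Omega)$ to the solution $u_0\in W_0^{1,2}(\Omega)\cap L^\infty(\Omega)$ of $$\int_\Omega M_0(x)\nabla u_0\cdot\nabla\varphi+\int_\Omega a_0(x)\,u_0\varphi=\int_\Omega f_0(x)\varphi,\qquad\forall\,\varphi\in W_0^{1,2}(\Omega)\cap L^\infty(\Omega).$$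 Furthermore, $$\lim_{n\to+\infty}\int_\Omega M_n(x)\nabla u_n\cdot\nabla u_n=\int_\Omega M_0(x)\nabla u_0\cdot\nabla u_0.$$
   Context: The matrices are not assumed symmetric. A matrix-valued function $M_0$ on $\Omega$ is called bounded and elliptic if it is measurable, essentially bounded, and satisfies $M_0(x)\xi\cdot\xi\ge c|\xi|^2$ for a.e. $x\in\Omega$ and all $\xi\in\mathbb{R}^N$, for some constant $c>0$. Definition ($G$-convergence). Let $\{M_n\}$ satisfy $\alpha|\xi|^2\le M_n(x)\xi\cdot\xi$ and $|M_n(x)|\le\beta$ for a.e. $x\in\Omega$ and all $\xi\in\mathbb{R}^N$, with $\alpha,\beta>0$ independent of $n$. The sequence $\{M_n\}$ $G$-converges to a bounded elliptic matrix $M_0$ if, for every $g\in W^{-1,2}(\Omega)$ (the dual of $W_0^{1,2}(\Omega)$), the unique solutions $w_n\in W_0^{1,2}(\Omega)$ of $-\mathrm{div}(M_n\nabla w_n)=g$ in $\Omega$ converge weakly in $W_0^{1,2}(\Omega)$ to the unique solution $w_0\in W_0^{1,2}(\Omega)$ of $-\mathrm{div}(M_0\nabla w_0)=g$ in $\Omega$. *)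

theory Defs
  imports "HOL-Analysis.Analysis"
begin

text \<open>
  Functions on an open set \<open>\<Omega>\<close> are represented by total functions of which only the values on
  \<open>\<Omega>\<close> matter (all integrals and almost-everywhere statements are relative to
  \<^term>\<open>lebesgue_on \<Omega>\<close>), and elements of Lebesgue and Sobolev spaces by representatives, not by
  equivalence classes.
\<close>

section \<open>Lebesgue spaces\<close>

definition space_L1 :: "'a::euclidean_space set \<Rightarrow> ('a \<Rightarrow> real) set" where
  "space_L1 \<Omega> = {f. integrable (lebesgue_on \<Omega>) f}"

definition space_L2 :: "'a::euclidean_space set \<Rightarrow> ('a \<Rightarrow> 'b::real_normed_vector) set" where
  "space_L2 \<Omega> = {f. f \<in> borel_measurable (lebesgue_on \<Omega>) \<and>
                    integrable (lebesgue_on \<Omega>) (\<lambda>x. (norm (f x))\<^sup>2)}"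

definition space_Linf :: "'a::euclidean_space set \<Rightarrow> ('a \<Rightarrow> 'b::real_normed_vector) set" where
  "space_Linf \<Omega> = {f. f \<in> borel_measurable (lebesgue_on \<Omega>) \<and>
                      (\<exists>C. AE x in lebesgue_on \<Omega>. norm (f x) \<le> C)}"

definition weakly_converges_L1 ::
    "'a::euclidean_space set \<Rightarrow> (nat \<Rightarrow> 'a \<Rightarrow> real) \<Rightarrow> ('a \<Rightarrow> real) \<Rightarrow> bool" where
  "weakly_converges_L1 \<Omega> f f0 \<longleftrightarrow>
     (\<forall>n. f n \<in> space_L1 \<Omega>) \<and> f0 \<in> space_L1 \<Omega> \<and>
     (\<forall>h\<in>space_Linf \<Omega>. (\<lambda>n. LINT x|lebesgue_on \<Omega>. f n x * h x)
                          \<longlonglongrightarrow> (LINT x|lebesgue_on \<Omega>. f0 x * h x))"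

definition weakly_star_converges_Linf ::
    "'a::euclidean_space set \<Rightarrow> (nat \<Rightarrow> 'a \<Rightarrow> real) \<Rightarrow> ('a \<Rightarrow> real) \<Rightarrow> bool" where
  "weakly_star_converges_Linf \<Omega> u u0 \<longleftrightarrow>
     (\<forall>n. u n \<in> space_Linf \<Omega>) \<and> u0 \<in> space_Linf \<Omega> \<and>
     (\<forall>h\<in>space_L1 \<Omega>. (\<lambda>n. LINT x|lebesgue_on \<Omega>. u n x * h x)
                        \<longlonglongrightarrow> (LINT x|lebesgue_on \<Omega>. u0 x * h x))"

section \<open>Test functions\<close>

definition partial_derivative :: "'n::finite \<Rightarrow> (real^'n \<Rightarrow> real) \<Rightarrow> real^'n \<Rightarrow> real" where
  "partial_derivative i f x = frechet_derivative f (at x) (axis i 1)"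

text \<open>
  Total differentiability of every iterated partial derivative implies that all of them are
  continuous, so the following is \<open>C\<^sup>\<infinity>\<close> smoothness.
\<close>

definition smooth :: "(real^'n::finite \<Rightarrow> real) \<Rightarrow> bool" where
  "smooth f \<longleftrightarrow> (\<forall>is. fold partial_derivative is f differentiable_on UNIV)"

definition test_functions :: "(real^'n::finite) set \<Rightarrow> (real^'n \<Rightarrow> real) set" where
  "test_functions \<Omega> = {\<phi>. smooth \<phi> \<and> compact (closure {x. \<phi> x \<noteq> 0}) \<and> closure {x. \<phi> x \<noteq> 0} \<subseteq> \<Omega>}"

section \<open>Sobolev spaces\<close>

definition is_weak_gradient ::
    "(real^'n::finite) set \<Rightarrow> (real^'n \<Rightarrow> real) \<Rightarrow> (real^'n \<Rightarrow> real^'n) \<Rightarrow> bool" where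
  "is_weak_gradient \<Omega> u G \<longleftrightarrow>
     (\<forall>\<phi>\<in>test_functions \<Omega>. \<forall>i.
        (LINT x|lebesgue_on \<Omega>. u x * partial_derivative i \<phi> x) =
        - (LINT x|lebesgue_on \<Omega>. G x $ i * \<phi> x))"

definition W12 :: "(real^'n::finite) set \<Rightarrow> (real^'n \<Rightarrow> real) set" where
  "W12 \<Omega> = {u \<in> space_L2 \<Omega>. \<exists>G\<in>space_L2 \<Omega>. is_weak_gradient \<Omega> u G}"

text \<open>
  The weak gradient of a function in \<^term>\<open>W12 \<Omega>\<close> is unique almost everywhere on \<open>\<Omega>\<close>; some
  representative is chosen.  It is meaningful only for arguments in \<^term>\<open>W12 \<Omega>\<close>.
\<close>

definition weak_gradient ::
    "(real^'n::finite) set \<Rightarrow> (real^'n \<Rightarrow> real) \<Rightarrow> real^'n \<Rightarrow> real^'n" where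
  "weak_gradient \<Omega> u = (SOME G. G \<in> space_L2 \<Omega> \<and> is_weak_gradient \<Omega> u G)"

definition norm_W12 :: "(real^'n::finite) set \<Rightarrow> (real^'n \<Rightarrow> real) \<Rightarrow> real" where
  "norm_W12 \<Omega> u = sqrt ((LINT x|lebesgue_on \<Omega>. (u x)\<^sup>2) +
                         (LINT x|lebesgue_on \<Omega>. (norm (weak_gradient \<Omega> u x))\<^sup>2))"

definition W012 :: "(real^'n::finite) set \<Rightarrow> (real^'n \<Rightarrow> real) set" where
  "W012 \<Omega> = {u \<in> W12 \<Omega>. \<exists>\<phi>::nat \<Rightarrow> real^'n \<Rightarrow> real. (\<forall>k. \<phi> k \<in> test_functions \<Omega>) \<and>
               (\<lambda>k. norm_W12 \<Omega> (\<lambda>x. \<phi> k x - u x)) \<longlonglongrightarrow> 0}"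

text \<open>
  The dual \<open>W\<^sup>-\<^sup>1\<^sup>,\<^sup>2\<close> of \<^term>\<open>W012 \<Omega>\<close>.  Linearity and boundedness are required on
  \<^term>\<open>W012 \<Omega>\<close> only; they force functions equal almost everywhere on \<open>\<Omega>\<close> to have the same image.
\<close>

definition W012_dual :: "(real^'n::finite) set \<Rightarrow> ((real^'n \<Rightarrow> real) \<Rightarrow> real) set" where
  "W012_dual \<Omega> = {g.
     (\<forall>u\<in>W012 \<Omega>. \<forall>v\<in>W012 \<Omega>. g (\<lambda>x. u x + v x) = g u + g v) \<and>
     (\<forall>c. \<forall>u\<in>W012 \<Omega>. g (\<lambda>x. c * u x) = c * g u) \<and>
     (\<exists>C. \<forall>u\<in>W012 \<Omega>. \<bar>g u\<bar> \<le> C * norm_W12 \<Omega> u)}"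

definition weakly_converges_W012 ::
    "(real^'n::finite) set \<Rightarrow> (nat \<Rightarrow> real^'n \<Rightarrow> real) \<Rightarrow> (real^'n \<Rightarrow> real) \<Rightarrow> bool" where
  "weakly_converges_W012 \<Omega> u u0 \<longleftrightarrow>
     (\<forall>n. u n \<in> W012 \<Omega>) \<and> u0 \<in> W012 \<Omega> \<and>
     (\<forall>g\<in>W012_dual \<Omega>. (\<lambda>n. g (u n)) \<longlonglongrightarrow> g u0)"

section \<open>Elliptic problems and \<open>G\<close>-convergence\<close>

definition bounded_elliptic ::
    "(real^'n::finite) set \<Rightarrow> (real^'n \<Rightarrow> real^'n^'n) \<Rightarrow> bool" where
  "bounded_elliptic \<Omega> M \<longleftrightarrow> M \<in> space_Linf \<Omega> \<and>
     (\<exists>c>0. AE x in lebesgue_on \<Omega>. \<forall>\<xi>. (M x *v \<xi>) \<bullet> \<xi> \<ge> c * (norm \<xi>)\<^sup>2)"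

definition energy_form ::
    "(real^'n::finite) set \<Rightarrow> (real^'n \<Rightarrow> real^'n^'n) \<Rightarrow>
     (real^'n \<Rightarrow> real) \<Rightarrow> (real^'n \<Rightarrow> real) \<Rightarrow> real" where
  "energy_form \<Omega> M u v =
     (LINT x|lebesgue_on \<Omega>. (M x *v weak_gradient \<Omega> u x) \<bullet> weak_gradient \<Omega> v x)"

text \<open>\<open>w\<close> is the solution in \<^term>\<open>W012 \<Omega>\<close> of \<open>-div (M \<nabla>w) = g\<close>, for \<open>g\<close> in the dual.\<close>

definition solves_divergence_problem ::
    "(real^'n::finite) set \<Rightarrow> (real^'n \<Rightarrow> real^'n^'n) \<Rightarrow>
     ((real^'n \<Rightarrow> real) \<Rightarrow> real) \<Rightarrow> (real^'n \<Rightarrow> real) \<Rightarrow> bool" where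
  "solves_divergence_problem \<Omega> M g w \<longleftrightarrow>
     w \<in> W012 \<Omega> \<and> (\<forall>\<phi>\<in>W012 \<Omega>. energy_form \<Omega> M w \<phi> = g \<phi>)"

text \<open>
  The uniform bounds on the sequence \<open>M\<close> that accompany this notion are not part of the definition.
  Under them the solutions \<open>w n\<close> and \<open>w0\<close> exist and are unique almost everywhere (Lax--Milgram), so
  that quantifying over all of them quantifies over the solution.
\<close>

definition G_converges ::
    "(real^'n::finite) set \<Rightarrow> (nat \<Rightarrow> real^'n \<Rightarrow> real^'n^'n) \<Rightarrow> (real^'n \<Rightarrow> real^'n^'n) \<Rightarrow> bool" where
  "G_converges \<Omega> M M0 \<longleftrightarrow> bounded_elliptic \<Omega> M0 \<and>
     (\<forall>g\<in>W012_dual \<Omega>. \<forall>w w0.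
        (\<forall>n. solves_divergence_problem \<Omega> (M n) g (w n)) \<longrightarrow>
        solves_divergence_problem \<Omega> M0 g w0 \<longrightarrow>
        weakly_converges_W012 \<Omega> w w0)"

definition solves_problem ::
    "(real^'n::finite) set \<Rightarrow> (real^'n \<Rightarrow> real^'n^'n) \<Rightarrow>
     (real^'n \<Rightarrow> real) \<Rightarrow> (real^'n \<Rightarrow> real) \<Rightarrow> (real^'n \<Rightarrow> real) \<Rightarrow> bool" where
  "solves_problem \<Omega> M a f u \<longleftrightarrow>
     u \<in> W012 \<Omega> \<inter> space_Linf \<Omega> \<and>
     (\<forall>\<phi>\<in>W012 \<Omega> \<inter> space_Linf \<Omega>.
        energy_form \<Omega> M u \<phi> + (LINT x|lebesgue_on \<Omega>. a x * u x * \<phi> x) =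
        (LINT x|lebesgue_on \<Omega>. f x * \<phi> x))"

end

theory Submission
  imports Defs "HOL-Library.Diagonal_Subsequence"
begin

text \<open>
  Testing with truncations gives \<open>|u\<^sub>n| \<le> Q\<close> and an energy bound, so along a subsequence \<open>u\<^sub>n\<close>
  converges weakly in the Sobolev space and strongly in \<open>L\<^sup>2\<close> to some \<open>u\<^sub>0\<close>.  By a Baire category
  argument weakly convergent sequences in \<open>L\<^sup>1\<close> are equi-integrable, hence
  \<open>\<integral> (f\<^sub>n - a\<^sub>n u\<^sub>n) \<zeta>\<^sub>n\<close> converges to \<open>\<integral> (f\<^sub>0 - a\<^sub>0 u\<^sub>0) \<zeta>\<close> whenever the \<open>\<zeta>\<^sub>n\<close> are uniformly bounded
  and converge to \<open>\<zeta>\<close> in \<open>L\<^sup>2\<close>.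

  For a bounded test function \<open>\<phi>\<close> and \<open>k > 0\<close> let \<open>\<zeta>\<^sub>n\<close> solve the adjoint problem
  \<open>A\<^sub>n\<^sup>* \<zeta>\<^sub>n + k \<zeta>\<^sub>n = k \<phi>\<close>; the maximum principle bounds \<open>\<zeta>\<^sub>n\<close> by the bound of \<open>\<phi>\<close>.
  \<open>G\<close>-convergence provides, for every \<open>v\<close>, functions \<open>v\<^sub>n \<rightharpoonup> v\<close> with \<open>A\<^sub>n v\<^sub>n = A\<^sub>0 v\<close>, and therefore
  \<open>\<langle>A\<^sub>0 v, \<zeta>\<^sub>n\<rangle> = \<langle>A\<^sub>n v\<^sub>n, \<zeta>\<^sub>n\<rangle> = k \<integral> (\<phi> - \<zeta>\<^sub>n) v\<^sub>n\<close>, so that the weak limit \<open>\<zeta>\<close> solves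
  \<open>A\<^sub>0\<^sup>* \<zeta> + k \<zeta> = k \<phi>\<close>.  Pairing with \<open>u\<^sub>n\<close> yields \<open>\<langle>A\<^sub>0 u\<^sub>0, \<zeta>\<rangle> = \<integral> (f\<^sub>0 - a\<^sub>0 u\<^sub>0) \<zeta>\<close>, and \<open>\<zeta>\<close> tends
  to \<open>\<phi>\<close> as \<open>k\<close> tends to infinity.  The limit problem has only one solution, so the whole sequence
  converges, and the energies converge by testing with \<open>u\<^sub>n\<close> itself.
\<close>

section \<open>Hilbert spaces\<close>

text \<open>The obstacle is the source \<open>f n - a n * u n\<close>: it varies with
  \<open>n\<close> and is controlled only weakly in L1, which by itself gives no convergence in the
  dual of \<open>W012\<close>, whereas G-convergence concerns one fixed functional and the solutions
  themselves, not the fluxes. So it cannot be applied to \<open>u n\<close> directly. The remedy is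
  to let the operator act on the test function. As the matrices need not be symmetric, the adapted
  test functions must solve the problem with the two arguments of the energy exchanged; then
  \<open>energy (M n)\<close> of \<open>u n\<close> against them is a zeroth order L2 pairing, and
  strong L2 convergence of both factors is enough. The convergence of these adjoint solutions is
  derived by duality from G-convergence applied to the fixed functional \<open>energy M0 v\<close>.
  The term with the factor \<open>k\<close> has two effects: it makes the bound of
  \<open>\<phi>\<close> a bound of the adjoint solution, and it forces that solution towards
  \<open>\<phi>\<close> in L2 at rate \<open>1 / sqrt k\<close>. Sobolev functions are treated as
  pairs of a function and its gradient in a product of L2 spaces, so that the functional analysis
  takes place in one closed subspace.\<close>

lemma subspace_closure:
  fixes S :: "'a::real_normed_vector set"
  assumes "subspace S" shows "subspace (closure S)"
proof (rule subspaceI)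
  show "0 \<in> closure S" using closure_subset subspace_0[OF assms] by blast
next
  fix x y assume "x \<in> closure S" "y \<in> closure S"
  then obtain X Y where "\<And>n::nat. X n \<in> S" "X \<longlonglongrightarrow> x" "\<And>n::nat. Y n \<in> S" "Y \<longlonglongrightarrow> y"
    unfolding closure_sequential by blast
  then show "x + y \<in> closure S"
    unfolding closure_sequential
    by (intro exI[of _ "\<lambda>n. X n + Y n"]) (auto intro: tendsto_add subspace_add[OF assms])
next
  fix c x assume "x \<in> closure S"
  then obtain X where "\<And>n::nat. X n \<in> S" "X \<longlonglongrightarrow> x"
    unfolding closure_sequential by blast
  then show "c *\<^sub>R x \<in> closure S"
    unfolding closure_sequential
    by (intro exI[of _ "\<lambda>n. c *\<^sub>R X n"]) (auto intro: tendsto_scaleR subspace_scale[OF assms])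
qed

text \<open>Linearity and boundedness are demanded on \<open>S\<close> only, because the functionals
  to be represented are often given by limits or by choices of representatives that are meaningful
  only there.\<close>

definition bounded_functional_on :: "'a::real_inner set \<Rightarrow> ('a \<Rightarrow> real) \<Rightarrow> bool" where
  "bounded_functional_on S F \<longleftrightarrow>
     (\<forall>x\<in>S. \<forall>y\<in>S. F (x + y) = F x + F y) \<and> (\<forall>c. \<forall>x\<in>S. F (c *\<^sub>R x) = c * F x) \<and>
     (\<exists>C. \<forall>x\<in>S. \<bar>F x\<bar> \<le> C * norm x)"

text \<open>The representing vector minimises \<open>J x = (norm x)^2 - 2 * F x\<close>. Minimising
  sequences are Cauchy by the parallelogram law, and the vanishing first variation of
  \<open>J\<close> at the minimiser is the claim.\<close>

lemma riesz_representation_on: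
  fixes S :: "'a::real_inner set"
  assumes S: "subspace S" "complete S" and F: "bounded_functional_on S F"
  shows "\<exists>p\<in>S. \<forall>x\<in>S. F x = inner p x"
proof -
  have add: "F (x + y) = F x + F y" if "x \<in> S" "y \<in> S" for x y
    using F that by (auto simp: bounded_functional_on_def)
  have scale: "F (c *\<^sub>R x) = c * F x" if "x \<in> S" for c x
    using F that by (auto simp: bounded_functional_on_def)
  obtain C where C: "\<And>x. x \<in> S \<Longrightarrow> \<bar>F x\<bar> \<le> C * norm x"
    using F unfolding bounded_functional_on_def by blast
  define J where "J x = (norm x)\<^sup>2 - 2 * F x" for x
  define m where "m = Inf (J ` S)"
  have Jlow: "- C\<^sup>2 \<le> J x" if "x \<in> S" for x
  proof -
    have "0 \<le> (norm x - C)\<^sup>2" by simp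
    then have "- C\<^sup>2 \<le> (norm x)\<^sup>2 - 2 * (C * norm x)"
      by (simp add: power2_diff algebra_simps)
    then show ?thesis using C[OF that] unfolding J_def by (smt (verit))
  qed
  have bdd: "bdd_below (J ` S)" using Jlow by (auto intro!: bdd_belowI)
  have S0: "0 \<in> S" using S(1) by (rule subspace_0)
  have mle: "m \<le> J x" if "x \<in> S" for x
    unfolding m_def using that bdd by (intro cInf_lower) auto
  have "\<exists>x\<in>S. J x < m + 1 / real (Suc n)" for n
  proof -
    have "m < m + 1 / real (Suc n)" by simp
    then show ?thesis unfolding m_def using cInf_lessD[of "J ` S"] S0 by blast
  qed
  then obtain X where X: "\<And>n. X n \<in> S" "\<And>n. J (X n) < m + 1 / real (Suc n)" by metis
  \<comment> \<open>The midpoint \<open>w\<close> has \<open>J w\<close> at least \<open>m\<close>,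
    so the parallelogram law forces two near-minimisers to be close to each other.\<close>
  have par: "(norm (x - y))\<^sup>2 \<le> 2 * J x + 2 * J y - 4 * m" if "x \<in> S" "y \<in> S" for x y
  proof -
    define w where "w = (1/2) *\<^sub>R (x + y)"
    have mid: "w \<in> S"
      using that S(1) by (simp add: subspace_add subspace_scale w_def del: scaleR_add_right)
    have Fmid: "F w = (F x + F y) / 2"
      using scale[of "x + y" "1/2"] add that S(1)
      by (simp add: subspace_add w_def del: scaleR_add_right)
    have "(norm (x - y))\<^sup>2 + (norm (x + y))\<^sup>2 = 2 * (norm x)\<^sup>2 + 2 * (norm y)\<^sup>2"
      by (simp add: power2_norm_eq_inner inner_simps)
    moreover have "(norm w)\<^sup>2 = (norm (x + y))\<^sup>2 / 4"
      by (simp add: power_divide w_def del: scaleR_add_right)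
    ultimately have "(norm (x - y))\<^sup>2 = 2 * J x + 2 * J y - 4 * J w"
      unfolding J_def Fmid by (simp add: field_simps)
    then show ?thesis using mle[OF mid] by linarith
  qed
  have "Cauchy X"
  proof (rule metric_CauchyI)
    fix e :: real assume e: "0 < e"
    obtain N where N: "4 / e\<^sup>2 < real N" using reals_Archimedean2 by blast
    have "dist (X i) (X j) < e" if "N \<le> i" "N \<le> j" for i j
    proof -
      have small: "1 / real (Suc k) < e\<^sup>2 / 4" if "N \<le> k" for k
      proof -
        have "4 / e\<^sup>2 < real (Suc k)" using N that by simp
        then show ?thesis using e by (simp add: field_simps)
      qed
      have "(norm (X i - X j))\<^sup>2 < e\<^sup>2"
        using par[OF X(1) X(1), of i j] X(2)[of i] X(2)[of j] small[OF that(1)] small[OF that(2)]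
        by argo
      then show ?thesis using e power2_less_imp_less[of "norm (X i - X j)" e] by (simp add: dist_norm)
    qed
    then show "\<exists>M. \<forall>m\<ge>M. \<forall>n\<ge>M. dist (X m) (X n) < e" by blast
  qed
  then obtain p where p: "p \<in> S" "X \<longlonglongrightarrow> p"
    using S(2) X(1) unfolding complete_def by blast
  have FX: "(\<lambda>n. F (X n)) \<longlonglongrightarrow> F p"
  proof -
    have "\<bar>F (X n) - F p\<bar> \<le> C * norm (X n - p)" for n
    proof -
      have "F (X n + (-1) *\<^sub>R p) = F (X n) + (-1) * F p"
        using add scale X(1) p(1) S(1) by (metis subspace_scale)
      then have "F (X n) - F p = F (X n - p)" by simp
      moreover have "X n - p \<in> S" using X(1) p(1) S(1) by (intro subspace_diff)
      ultimately show ?thesis using C by simp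
    qed
    moreover have "(\<lambda>n. C * norm (X n - p)) \<longlonglongrightarrow> 0"
      by (intro tendsto_mult_right_zero tendsto_norm_zero LIM_zero p(2))
    ultimately have "(\<lambda>n. F (X n) - F p) \<longlonglongrightarrow> 0"
      by (intro Lim_null_comparison[where g = "\<lambda>n. C * norm (X n - p)" and f = "\<lambda>n. F (X n) - F p"])
        simp_all
    then show ?thesis by (simp add: LIM_zero_iff)
  qed
  have "(\<lambda>n. J (X n)) \<longlonglongrightarrow> J p"
    unfolding J_def by (intro tendsto_intros FX p(2))
  moreover have "(\<lambda>n. m + 1 / real (Suc n)) \<longlonglongrightarrow> m + 0"
    by (intro tendsto_intros LIMSEQ_Suc lim_1_over_n)
  ultimately have "J p \<le> m + 0"
    using X(2) by (intro LIMSEQ_le) (auto intro: less_imp_le)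
  then have Jp: "J p \<le> J x" if "x \<in> S" for x using mle[OF that] by simp
  have "F x = inner p x" if x: "x \<in> S" for x
  proof -
    have key: "0 \<le> 2 * t * (inner p x - F x) + t\<^sup>2 * (norm x)\<^sup>2" for t
    proof -
      have "J p \<le> J (p + t *\<^sub>R x)" using Jp p(1) x S(1) by (simp add: subspace_add subspace_scale)
      also have "J (p + t *\<^sub>R x) = J p + 2 * t * (inner p x - F x) + t\<^sup>2 * (norm x)\<^sup>2"
      proof -
        have "F (p + t *\<^sub>R x) = F p + t * F x"
          using add scale p(1) x S(1) by (simp add: subspace_scale)
        moreover have "(norm (p + t *\<^sub>R x))\<^sup>2 = (norm p)\<^sup>2 + 2 * t * inner p x + t\<^sup>2 * (norm x)\<^sup>2"
          unfolding power2_norm_eq_inner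
          by (simp add: inner_add_left inner_add_right inner_commute[of x p] power2_eq_square algebra_simps)
        ultimately show ?thesis by (simp add: J_def algebra_simps)
      qed
      finally show ?thesis by simp
    qed
    define d where "d = inner p x - F x"
    \<comment> \<open>Adding 1 keeps \<open>N\<close> positive also for \<open>x = 0\<close>. The
      value \<open>t = - d / N\<close> minimises \<open>2 * t * d + t^2 * N\<close>, which dominates
      the quadratic in \<open>key\<close>.\<close>
    define N where "N = (norm x)\<^sup>2 + 1"
    have N: "N > 0" unfolding N_def by (simp add: add_nonneg_pos)
    have "0 \<le> 2 * (- d / N) * d + (- d / N)\<^sup>2 * (norm x)\<^sup>2"
      using key[of "- d / N"] by (simp add: d_def)
    also have "\<dots> \<le> 2 * (- d / N) * d + (- d / N)\<^sup>2 * N"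
      by (intro add_left_mono mult_left_mono) (auto simp: N_def)
    also have "\<dots> = - (d\<^sup>2 / N)" using N by (simp add: field_simps power2_eq_square)
    finally have "d\<^sup>2 / N \<le> 0" by simp
    then have "d = 0" using N by (simp add: divide_le_0_iff)
    then show ?thesis by (simp add: d_def)
  qed
  then show ?thesis using p(1) by blast
qed

lemma bounded_functional_on_inner: "bounded_functional_on S (inner p)"
  unfolding bounded_functional_on_def
  by (auto simp: inner_simps intro!: exI[of _ "norm p"] Cauchy_Schwarz_ineq2)

lemma bounded_linear_imp_bounded_functional_on:
  assumes "bounded_linear F" shows "bounded_functional_on S F"
proof -
  interpret bounded_linear F by fact
  obtain K where "\<And>x. norm (F x) \<le> norm x * K" using bounded by blast
  then show ?thesis unfolding bounded_functional_on_def
    by (auto simp: add scaleR intro!: exI[of _ K]) (simp add: mult.commute)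
qed

text \<open>Riesz representation turns the equation into \<open>A u = f\<close>, and the damped
  iteration \<open>T\<close> is a contraction of \<open>S\<close>. A fixed point argument is chosen
  because \<open>B\<close> is not symmetric, so that \<open>u\<close> does not minimise an
  energy.\<close>

lemma lax_milgram_on:
  fixes S :: "'a::real_inner set"
  assumes S: "subspace S" "complete S" and B: "bounded_bilinear B"
    and c: "c > 0" and coerc: "\<And>x. x \<in> S \<Longrightarrow> c * (norm x)\<^sup>2 \<le> (B x x :: real)"
    and F: "bounded_functional_on S F"
  shows "\<exists>u\<in>S. \<forall>v\<in>S. B u v = F v"
proof -
  interpret B: bounded_bilinear B by fact
  obtain K0 where K0: "K0 > 0" "\<And>x y. norm (B x y) \<le> norm x * norm y * K0"
    using B.pos_bounded by blast
  \<comment> \<open>Enlarging the bound by \<open>c\<close> gives \<open>c < K\<close>, so that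
    \<open>q\<close> below is the square root of a positive number.\<close>
  define K where "K = K0 + c"
  have K: "K > 0" "c < K" using K0(1) c by (auto simp: K_def)
  have KB: "\<bar>B x y\<bar> \<le> K * norm x * norm y" for x y
  proof -
    have "\<bar>B x y\<bar> \<le> norm x * norm y * K0" using K0(2)[of x y] by simp
    also have "\<dots> \<le> norm x * norm y * K" using c by (intro mult_left_mono) (auto simp: K_def)
    finally show ?thesis by (simp add: mult_ac)
  qed
  have "\<exists>A. \<forall>u. A u \<in> S \<and> (\<forall>v\<in>S. B u v = inner (A u) v)"
    by (intro choice allI)
       (use riesz_representation_on[OF S bounded_linear_imp_bounded_functional_on[OF B.bounded_linear_right]]
        in blast)
  then obtain A where A: "\<And>u. A u \<in> S" "\<And>u v. v \<in> S \<Longrightarrow> B u v = inner (A u) v" by blast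
  obtain f where f: "f \<in> S" "\<And>v. v \<in> S \<Longrightarrow> F v = inner f v"
    using riesz_representation_on[OF S F] by blast
  \<comment> \<open>This value minimises \<open>1 - 2 * \<rho> * c + \<rho>^2 * K^2\<close>, the
    bound for the square of the contraction factor.\<close>
  define \<rho> where "\<rho> = c / K\<^sup>2"
  define T where "T u = u - \<rho> *\<^sub>R (A u - f)" for u
  define q where "q = sqrt (1 - (c / K)\<^sup>2)"
  have cK: "0 < (c / K)\<^sup>2" "(c / K)\<^sup>2 < 1"
    using c K by (auto simp: power_divide divide_less_eq power_strict_mono)
  have q: "0 \<le> q" "q < 1" unfolding q_def using cK by auto
  have "dist (T u) (T w) \<le> q * dist u w" if "u \<in> S" "w \<in> S" for u w
  proof -
    define d where "d = u - w"
    define e where "e = A u - A w"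
    have dS: "d \<in> S" "e \<in> S" using that A(1) S(1) by (auto simp: d_def e_def subspace_diff)
    have Bd: "B d v = inner e v" if "v \<in> S" for v
      using A(2)[OF that, of u] A(2)[OF that, of w] by (simp add: d_def e_def B.diff_left inner_diff_left)
    have "(norm e)\<^sup>2 \<le> K * norm d * norm e"
      using KB[of d e] Bd[OF dS(2)] by (simp add: power2_norm_eq_inner)
    then have ed: "norm e \<le> K * norm d"
      using K by (cases "norm e = 0") (auto simp: power2_eq_square)
    have "(norm (T u - T w))\<^sup>2 = (norm (d - \<rho> *\<^sub>R e))\<^sup>2"
      by (simp add: T_def d_def e_def algebra_simps)
    also have "\<dots> = (norm d)\<^sup>2 - 2 * \<rho> * B d d + \<rho>\<^sup>2 * (norm e)\<^sup>2"
      using Bd[OF dS(1)]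
      unfolding power2_norm_eq_inner
      by (simp add: inner_diff_left inner_diff_right inner_commute[of e d] power2_eq_square)
        (simp add: algebra_simps)
    also have "\<dots> \<le> (norm d)\<^sup>2 - 2 * \<rho> * (c * (norm d)\<^sup>2) + \<rho>\<^sup>2 * (K * norm d)\<^sup>2"
      using coerc[OF dS(1)] ed c K
      by (intro add_mono diff_mono mult_left_mono power_mono) (auto simp: \<rho>_def)
    also have "\<dots> = (1 - (c / K)\<^sup>2) * (norm d)\<^sup>2"
      using K by (simp add: \<rho>_def field_simps power2_eq_square)
    also have "\<dots> = (q * norm d)\<^sup>2" using cK by (simp add: q_def power_mult_distrib)
    finally have "norm (T u - T w) \<le> q * norm d"
      by (rule power2_le_imp_le) (simp add: q)
    then show ?thesis by (simp add: dist_norm d_def)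
  qed
  moreover have "T ` S \<subseteq> S"
    using A(1) f(1) S(1) by (auto simp: T_def intro!: subspace_diff subspace_scale)
  moreover have "S \<noteq> {}" using S(1) subspace_0 by auto
  ultimately obtain u where u: "u \<in> S" "T u = u"
    using Banach_fix[OF S(2) _ q, of T] by blast
  have "\<rho> \<noteq> 0" using c K by (simp add: \<rho>_def)
  then have "A u = f" using u(2) by (simp add: T_def)
  then show ?thesis using u(1) A(2) f(2) by (intro bexI[of _ u]) auto
qed

text \<open>The members of the sequence serve as the countable set of test vectors for a diagonal
  argument; convergence extends to their closed span \<open>W\<close>, where Riesz represents the
  limit functional. The location of \<open>l\<close> is recorded so that weak limits stay in any
  closed subspace that contains the sequence.\<close>

lemma bounded_imp_weakly_convergent_subsequence:
  fixes x :: "nat \<Rightarrow> 'a::{real_inner,complete_space}"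
  assumes bnd: "\<And>n. norm (x n) \<le> C"
  obtains r l where "strict_mono r" "l \<in> closure (span (range x))"
    "\<And>y. (\<lambda>n. inner (x (r n)) y) \<longlonglongrightarrow> inner l y"
proof -
  define W where "W = closure (span (range x))"
  have W: "subspace W" "complete W"
    by (auto simp: W_def subspace_closure complete_eq_closed)
  have xW: "x n \<in> W" for n
    unfolding W_def by (meson closure_subset rangeI span_base subsetD)
  have C: "C \<ge> 0" using bnd[of 0] norm_ge_zero order_trans by blast
  interpret subseqs "\<lambda>n s. convergent (\<lambda>k. inner (x (s k)) (x n))"
  proof
    fix n and s :: "nat \<Rightarrow> nat" assume "strict_mono s"
    have "bounded (range (\<lambda>k. inner (x (s k)) (x n)))"
    proof (rule boundedI)
      fix z assume "z \<in> range (\<lambda>k. inner (x (s k)) (x n))"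
      then obtain k where z: "z = inner (x (s k)) (x n)" by blast
      show "norm z \<le> C * C" unfolding z real_norm_def
        by (rule order_trans[OF Cauchy_Schwarz_ineq2]) (intro mult_mono bnd C norm_ge_zero)
    qed
    then obtain l r where "strict_mono r" "((\<lambda>k. inner (x (s k)) (x n)) \<circ> r) \<longlonglongrightarrow> l"
      using bounded_imp_convergent_subsequence by blast
    then show "\<exists>r'. strict_mono r' \<and> convergent (\<lambda>k. inner (x ((s \<circ> r') k)) (x n))"
      by (auto simp: o_def convergent_def)
  qed
  have stable: "\<And>r s n. strict_mono r \<Longrightarrow> convergent (\<lambda>k. inner (x (s k)) (x n)) \<Longrightarrow>
      convergent (\<lambda>k. inner (x ((s \<circ> r) k)) (x n))"
    using convergent_subseq_convergent by (fastforce simp: o_def)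
  define r where "r = diagseq"
  have r: "strict_mono r" by (simp add: r_def subseq_diagseq)
  have conv: "convergent (\<lambda>k. inner (x (r k)) (x n))" for n
  proof -
    have "convergent (\<lambda>k. inner (x ((diagseq \<circ> (+) (Suc n)) k)) (x n))"
      by (rule diagseq_holds[OF stable])
    then have "convergent (\<lambda>k. inner (x (r (k + Suc n))) (x n))"
      by (simp add: o_def r_def add.commute)
    then show ?thesis by (subst (asm) convergent_ignore_initial_segment)
  qed
  have conv_span: "convergent (\<lambda>k. inner (x (r k)) y)" if "y \<in> span (range x)" for y
    using that
  proof (induction rule: span_induct_alt)
    case base then show ?case by (simp add: convergent_const)
  next
    case (step c y z)
    then obtain n where "y = x n" by blast
    then show ?case using step conv[of n]
      by (auto simp: inner_simps intro!: convergent_add convergent_mult convergent_const)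
  qed
  have convW: "convergent (\<lambda>k. inner (x (r k)) y)" if yW: "y \<in> W" for y
  proof (rule Cauchy_convergent, rule metric_CauchyI)
    fix e :: real assume e: "0 < e"
    \<comment> \<open>The error of replacing \<open>y\<close> by \<open>z\<close> occurs twice and
      the Cauchy estimate for \<open>z\<close> once, hence thirds; \<open>C + 1\<close> keeps the
      divisor positive.\<close>
    define \<delta> where "\<delta> = e / (3 * (C + 1))"
    have \<delta>: "\<delta> > 0" using e C by (simp add: \<delta>_def)
    obtain z where z: "z \<in> span (range x)" "dist z y < \<delta>"
      using yW \<delta> unfolding W_def closure_approachable by blast
    have close: "\<bar>inner (x k) y - inner (x k) z\<bar> < e / 3" for k
    proof -
      have "\<bar>inner (x k) y - inner (x k) z\<bar> \<le> norm (x k) * norm (y - z)"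
        using Cauchy_Schwarz_ineq2[of "x k" "y - z"] by (simp add: inner_simps)
      also have "\<dots> \<le> C * \<delta>"
        using z(2) bnd C by (intro mult_mono) (auto simp: dist_norm norm_minus_commute)
      also have "\<dots> < (C + 1) * \<delta>" using \<delta> by simp
      also have "\<dots> = e / 3" using C by (simp add: \<delta>_def field_simps)
      finally show ?thesis .
    qed
    obtain N where N: "\<And>i j. i \<ge> N \<Longrightarrow> j \<ge> N \<Longrightarrow> dist (inner (x (r i)) z) (inner (x (r j)) z) < e / 3"
      using convergent_Cauchy[OF conv_span[OF z(1)]] e unfolding Cauchy_def
      by (metis divide_pos_pos zero_less_numeral)
    have "dist (inner (x (r i)) y) (inner (x (r j)) y) < e" if "i \<ge> N" "j \<ge> N" for i j
      using N[OF that] close[of "r i"] close[of "r j"] unfolding dist_real_def by linarith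
    then show "\<exists>M. \<forall>m\<ge>M. \<forall>n\<ge>M. dist (inner (x (r m)) y) (inner (x (r n)) y) < e" by blast
  qed
  define F where "F y = lim (\<lambda>k. inner (x (r k)) y)" for y
  have F: "(\<lambda>k. inner (x (r k)) y) \<longlonglongrightarrow> F y" if "y \<in> W" for y
    using convW[OF that] by (simp add: F_def convergent_LIMSEQ_iff)
  have "bounded_functional_on W F"
    unfolding bounded_functional_on_def
  proof (intro conjI ballI allI exI)
    fix y z assume yz: "y \<in> W" "z \<in> W"
    have "(\<lambda>k. inner (x (r k)) (y + z)) \<longlonglongrightarrow> F y + F z"
      unfolding inner_add_right by (intro tendsto_add F yz)
    moreover have "y + z \<in> W" using yz W(1) by (simp add: subspace_add)
    ultimately show "F (y + z) = F y + F z" using F LIMSEQ_unique by blast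
  next
    fix c y assume y: "y \<in> W"
    have "(\<lambda>k. inner (x (r k)) (c *\<^sub>R y)) \<longlonglongrightarrow> c * F y"
      unfolding inner_scaleR_right by (intro tendsto_mult_left F y)
    moreover have "c *\<^sub>R y \<in> W" using y W(1) by (simp add: subspace_scale)
    ultimately show "F (c *\<^sub>R y) = c * F y" using F LIMSEQ_unique by blast
  next
    fix y assume y: "y \<in> W"
    have "(\<lambda>k. \<bar>inner (x (r k)) y\<bar>) \<longlonglongrightarrow> \<bar>F y\<bar>" by (intro tendsto_rabs F y)
    moreover have "\<bar>inner (x (r k)) y\<bar> \<le> C * norm y" for k
      by (rule order_trans[OF Cauchy_Schwarz_ineq2]) (intro mult_right_mono bnd norm_ge_zero)
    ultimately show "\<bar>F y\<bar> \<le> C * norm y" by (intro LIMSEQ_le_const2) auto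
  qed
  then obtain l where l: "l \<in> W" "\<And>y. y \<in> W \<Longrightarrow> F y = inner l y"
    using riesz_representation_on[OF W] by blast
  have "(\<lambda>n. inner (x (r n)) y) \<longlonglongrightarrow> inner l y" for y
  proof -
    \<comment> \<open>\<open>p\<close> is the orthogonal projection of \<open>y\<close> onto
      \<open>W\<close>, obtained by representing the functional of \<open>y\<close> on
      \<open>W\<close>.\<close>
    obtain p where p: "p \<in> W" "\<And>w. w \<in> W \<Longrightarrow> inner y w = inner p w"
      using riesz_representation_on[OF W bounded_functional_on_inner[of W y]] by blast
    have "(\<lambda>n. inner (x (r n)) p) \<longlonglongrightarrow> inner l p" using F[OF p(1)] l(2)[OF p(1)] by simp
    then show ?thesis using p(2)[OF xW] p(2)[OF l(1)] by (simp add: inner_commute)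
  qed
  then show ?thesis using that r l(1) W_def by blast
qed

section \<open>The space of square integrable functions\<close>

definition square_integrable :: "('a::euclidean_space \<Rightarrow> 'b::euclidean_space) \<Rightarrow> bool" where
  "square_integrable f \<longleftrightarrow> f \<in> borel_measurable lebesgue \<and> integrable lebesgue (\<lambda>x. (norm (f x))\<^sup>2)"

lemma square_integrable_measurable[measurable_dest]:
  "square_integrable f \<Longrightarrow> f \<in> borel_measurable lebesgue"
  by (simp add: square_integrable_def)

lemma integrable_inner_of_squares:
  fixes f g :: "'a \<Rightarrow> 'b::euclidean_space"
  assumes [measurable]: "f \<in> borel_measurable M" "g \<in> borel_measurable M"
    and "integrable M (\<lambda>x. (norm (f x))\<^sup>2)" "integrable M (\<lambda>x. (norm (g x))\<^sup>2)"
  shows "integrable M (\<lambda>x. inner (f x) (g x))"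
proof (rule Bochner_Integration.integrable_bound[OF Bochner_Integration.integrable_add[OF assms(3,4)]])
  have "\<bar>inner a b\<bar> \<le> \<bar>(norm a)\<^sup>2 + (norm b)\<^sup>2\<bar>" for a b :: 'b
  proof -
    have "\<bar>inner a b\<bar> \<le> norm a * norm b" by (rule Cauchy_Schwarz_ineq2)
    also have "\<dots> \<le> (norm a)\<^sup>2 + (norm b)\<^sup>2"
      using sum_squares_bound[of "norm a" "norm b"] mult_nonneg_nonneg[of "norm a" "norm b"]
      by (simp del: mult_nonneg_nonneg)
    finally show ?thesis by simp
  qed
  then show "AE x in M. norm (inner (f x) (g x)) \<le> norm ((norm (f x))\<^sup>2 + (norm (g x))\<^sup>2)"
    by simp
qed measurable

lemma integrable_norm_add_square:
  fixes f g :: "'a \<Rightarrow> 'b::euclidean_space"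
  assumes [measurable]: "f \<in> borel_measurable M" "g \<in> borel_measurable M"
    and "integrable M (\<lambda>x. (norm (f x))\<^sup>2)" "integrable M (\<lambda>x. (norm (g x))\<^sup>2)"
  shows "integrable M (\<lambda>x. (norm (f x + g x))\<^sup>2)"
proof -
  have "(norm (f x + g x))\<^sup>2 = (norm (f x))\<^sup>2 + 2 * inner (f x) (g x) + (norm (g x))\<^sup>2" for x
    unfolding power2_norm_eq_inner by (simp add: inner_add_left inner_add_right inner_commute)
  then show ?thesis using integrable_inner_of_squares[OF assms] assms by simp
qed

lemma square_integrable_add:
  assumes "square_integrable f" "square_integrable g"
  shows "square_integrable (\<lambda>x. f x + g x)"
  using assms unfolding square_integrable_def
  by (auto intro!: integrable_norm_add_square)

lemma square_integrable_scaleR: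
  "square_integrable f \<Longrightarrow> square_integrable (\<lambda>x. c *\<^sub>R f x)"
  by (auto simp: square_integrable_def power_mult_distrib)

lemma square_integrable_uminus:
  "square_integrable f \<Longrightarrow> square_integrable (\<lambda>x. - f x)"
  by (auto simp: square_integrable_def)

lemma square_integrable_diff:
  assumes "square_integrable f" "square_integrable g"
  shows "square_integrable (\<lambda>x. f x - g x)"
  using square_integrable_add[OF assms(1) square_integrable_uminus[OF assms(2)]] by simp

lemma square_integrable_zero: "square_integrable (\<lambda>_. 0)"
  by (simp add: square_integrable_def)

lemma square_integrable_inner:
  "square_integrable f \<Longrightarrow> square_integrable g \<Longrightarrow> integrable lebesgue (\<lambda>x. inner (f x) (g x))"
  unfolding square_integrable_def by (intro integrable_inner_of_squares) auto

\<comment> \<open>The relation is partial, so that only square integrable functions represent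
  elements. All functions live on the whole space; functions on a domain enter through extension by
  zero, and one Hilbert space type serves every domain.\<close>
quotient_type (overloaded) ('a, 'b) l2 = "'a::euclidean_space \<Rightarrow> 'b::euclidean_space" /
  partial: "\<lambda>f g. square_integrable f \<and> square_integrable g \<and> (AE x in lebesgue. f x = g x)"
proof (rule part_equivpI)
  show "\<exists>x. square_integrable x \<and> square_integrable x \<and> (AE y in lebesgue. x y = (x y :: 'b))"
    by (intro exI[of _ "\<lambda>_. 0"]) (simp add: square_integrable_zero)
qed (auto intro!: sympI transpI elim: AE_mp)

instantiation l2 :: (euclidean_space, euclidean_space) real_inner
begin

lift_definition zero_l2 :: "('a, 'b) l2" is "\<lambda>_. 0"
  by (simp add: square_integrable_zero)

lift_definition plus_l2 :: "('a, 'b) l2 \<Rightarrow> ('a, 'b) l2 \<Rightarrow> ('a, 'b) l2" is "\<lambda>f g x. f x + g x"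
  by (auto intro: square_integrable_add)

lift_definition uminus_l2 :: "('a, 'b) l2 \<Rightarrow> ('a, 'b) l2" is "\<lambda>f x. - f x"
  by (auto intro: square_integrable_uminus)

lift_definition minus_l2 :: "('a, 'b) l2 \<Rightarrow> ('a, 'b) l2 \<Rightarrow> ('a, 'b) l2" is "\<lambda>f g x. f x - g x"
  by (auto intro: square_integrable_diff)

lift_definition scaleR_l2 :: "real \<Rightarrow> ('a, 'b) l2 \<Rightarrow> ('a, 'b) l2" is "\<lambda>c f x. c *\<^sub>R f x"
  by (auto intro: square_integrable_scaleR)

lift_definition inner_l2 :: "('a, 'b) l2 \<Rightarrow> ('a, 'b) l2 \<Rightarrow> real"
  is "\<lambda>f g. LINT x|lebesgue. inner (f x) (g x)"
  by (intro integral_cong_AE) (auto dest: square_integrable_measurable)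

definition norm_l2 :: "('a, 'b) l2 \<Rightarrow> real" where
  "norm_l2 x = sqrt (inner x x)"

definition dist_l2 :: "('a, 'b) l2 \<Rightarrow> ('a, 'b) l2 \<Rightarrow> real" where
  "dist_l2 x y = norm (x - y)"

definition sgn_l2 :: "('a, 'b) l2 \<Rightarrow> ('a, 'b) l2" where
  "sgn_l2 x = inverse (norm x) *\<^sub>R x"

definition uniformity_l2 :: "(('a, 'b) l2 \<times> ('a, 'b) l2) filter" where
  "uniformity_l2 = (INF e\<in>{0 <..}. principal {(x, y). dist x y < e})"

definition open_l2 :: "('a, 'b) l2 set \<Rightarrow> bool" where
  "open_l2 U \<longleftrightarrow> (\<forall>x\<in>U. eventually (\<lambda>(x', y). x' = x \<longrightarrow> y \<in> U) uniformity)"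

instance
proof
  fix x y z :: "('a, 'b) l2" and c d :: real
  show "x + y + z = x + (y + z)" by transfer (auto intro!: square_integrable_add simp: add.assoc)
  show "x + y = y + x" by transfer (auto intro!: square_integrable_add simp: add.commute)
  show "0 + x = x" by transfer auto
  show "- x + x = 0" by transfer (auto intro: square_integrable_zero)
  show "x - y = x + - y" by transfer (auto intro: square_integrable_diff)
  show "c *\<^sub>R (x + y) = c *\<^sub>R x + c *\<^sub>R y"
  proof transfer
    show "square_integrable (\<lambda>x. c *\<^sub>R (f x + g x)) \<and>
        square_integrable (\<lambda>x. c *\<^sub>R f x + c *\<^sub>R g x) \<and>
        (AE x in lebesgue. c *\<^sub>R (f x + g x) = c *\<^sub>R f x + c *\<^sub>R g x)"
      if "square_integrable f \<and> square_integrable f \<and> (AE x in lebesgue. f x = f x)"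
        "square_integrable g \<and> square_integrable g \<and> (AE x in lebesgue. g x = g x)"
      for c and f g :: "'a \<Rightarrow> 'b"
      using that square_integrable_scaleR[OF square_integrable_add[of f g], of c]
      by (simp add: scaleR_add_right)
  qed
  show "(c + d) *\<^sub>R x = c *\<^sub>R x + d *\<^sub>R x"
    by transfer (auto intro!: square_integrable_add square_integrable_scaleR simp: scaleR_add_left)
  show "c *\<^sub>R d *\<^sub>R x = (c * d) *\<^sub>R x"
    by transfer (auto intro!: square_integrable_scaleR simp del: scaleR_scaleR simp: scaleR_scaleR)
  show "1 *\<^sub>R x = x" by transfer auto
  show "dist x y = norm (x - y)" by (simp add: dist_l2_def)
  show "sgn x = inverse (norm x) *\<^sub>R x" by (simp add: sgn_l2_def)
  show "(uniformity :: (('a, 'b) l2 \<times> ('a, 'b) l2) filter) = (INF e\<in>{0 <..}. principal {(x, y). dist x y < e})"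
    by (simp add: uniformity_l2_def)
  show "open U \<longleftrightarrow> (\<forall>x\<in>U. eventually (\<lambda>(x', y). x' = x \<longrightarrow> y \<in> U) uniformity)" for U :: "('a, 'b) l2 set"
    by (simp add: open_l2_def)
  show "inner x y = inner y x" by transfer (simp add: inner_commute)
  show "inner (x + y) z = inner x z + inner y z"
    by transfer (auto simp: inner_add_left square_integrable_inner)
  show "inner (c *\<^sub>R x) y = c * inner x y"
    by transfer simp
  show "0 \<le> inner x x" by transfer simp
  show "inner x x = 0 \<longleftrightarrow> x = 0"
  proof transfer
    fix f :: "'a \<Rightarrow> 'b"
    assume "square_integrable f \<and> square_integrable f \<and> (AE x in lebesgue. f x = f x)"
    then have f: "square_integrable f" by simp
    have "(LINT x|lebesgue. inner (f x) (f x)) = 0 \<longleftrightarrow> (AE x in lebesgue. inner (f x) (f x) = 0)"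
      by (intro integral_nonneg_eq_0_iff_AE square_integrable_inner f) simp
    then show "(LINT x|lebesgue. inner (f x) (f x)) = 0 \<longleftrightarrow>
        square_integrable f \<and> square_integrable (\<lambda>_. 0::'b) \<and> (AE x in lebesgue. f x = 0)"
      using f by (simp add: square_integrable_zero)
  qed
  show "norm x = sqrt (inner x x)" by (simp add: norm_l2_def)
qed

end

lift_definition l2_of :: "('a::euclidean_space \<Rightarrow> 'b::euclidean_space) \<Rightarrow> ('a, 'b) l2"
  is "\<lambda>f. if square_integrable f then f else (\<lambda>_. 0)"
  by (simp add: square_integrable_zero)

lemma l2_of_eq_iff:
  "square_integrable f \<Longrightarrow> square_integrable g \<Longrightarrow> l2_of f = l2_of g \<longleftrightarrow> (AE x in lebesgue. f x = g x)"
  by transfer simp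

lemma inner_l2_of:
  "square_integrable f \<Longrightarrow> square_integrable g \<Longrightarrow>
    inner (l2_of f) (l2_of g) = (LINT x|lebesgue. inner (f x) (g x))"
  by transfer simp

lemma l2_of_add:
  "square_integrable f \<Longrightarrow> square_integrable g \<Longrightarrow> l2_of (\<lambda>x. f x + g x) = l2_of f + l2_of g"
  by transfer (simp add: square_integrable_add)

lemma l2_of_diff:
  "square_integrable f \<Longrightarrow> square_integrable g \<Longrightarrow> l2_of (\<lambda>x. f x - g x) = l2_of f - l2_of g"
  by transfer (simp add: square_integrable_diff)

lemma l2_of_scaleR:
  "square_integrable f \<Longrightarrow> l2_of (\<lambda>x. c *\<^sub>R f x) = c *\<^sub>R l2_of f"
  by transfer (simp add: square_integrable_scaleR)

lemma l2_cases:
  obtains f where "square_integrable f" "x = l2_of f"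
proof -
  have "\<exists>f. square_integrable f \<and> x = l2_of f" by transfer auto
  then show ?thesis using that by blast
qed

lemma norm_l2_of:
  assumes "square_integrable f"
  shows "(norm (l2_of f))\<^sup>2 = (LINT x|lebesgue. (norm (f x))\<^sup>2)"
  using assms by (simp add: power2_norm_eq_inner inner_l2_of)

lemma nn_integral_l2_of:
  assumes "square_integrable f"
  shows "(\<integral>\<^sup>+x. ennreal ((norm (f x))\<^sup>2) \<partial>lebesgue) = ennreal ((norm (l2_of f))\<^sup>2)"
  using assms by (subst nn_integral_eq_integral) (auto simp: norm_l2_of square_integrable_def)

lemma square_integrableI_nn_integral:
  assumes "f \<in> borel_measurable lebesgue" "(\<integral>\<^sup>+x. ennreal ((norm (f x))\<^sup>2) \<partial>lebesgue) < \<infinity>"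
  shows "square_integrable f"
  using assms by (auto simp: square_integrable_def integrable_iff_bounded)

text \<open>The weighted sum of \<open>2^k * (norm (f k x))^2\<close> has a finite integral and is
  therefore finite almost everywhere. Splitting \<open>norm (f k x)\<close> as
  \<open>(a * norm (f k x)) * (1 / a)\<close> with \<open>a^2 = 2^k\<close> bounds it by half of
  this summand plus half of \<open>(1/2)^k\<close>.\<close>

lemma AE_summable_of_geometric_l2:
  assumes f: "\<And>k. square_integrable (f k)" and small: "\<And>k. norm (l2_of (f k)) \<le> (1/2)^k"
  shows "AE x in lebesgue. summable (\<lambda>k. norm (f k x))"
proof -
  have [measurable]: "f k \<in> borel_measurable lebesgue" for k
    using f square_integrable_measurable by blast
  have "(\<integral>\<^sup>+x. (\<Sum>k. ennreal (2^k * (norm (f k x))\<^sup>2)) \<partial>lebesgue)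
      = (\<Sum>k. \<integral>\<^sup>+x. ennreal (2^k * (norm (f k x))\<^sup>2) \<partial>lebesgue)"
    by (intro nn_integral_suminf) measurable
  also have "\<dots> = (\<Sum>k. ennreal (2^k * (norm (l2_of (f k)))\<^sup>2))"
    by (simp add: ennreal_mult nn_integral_cmult nn_integral_l2_of[OF f])
  also have "\<dots> \<le> (\<Sum>k. ennreal ((1/2)^k))"
  proof (intro suminf_le ennreal_leI summableI)
    fix k
    have "2^k * (norm (l2_of (f k)))\<^sup>2 \<le> 2^k * ((1/2)^k)\<^sup>2"
      by (intro mult_left_mono power_mono small) auto
    also have "\<dots> = (1/2)^k" by (simp add: power2_eq_square power_divide)
    finally show "2^k * (norm (l2_of (f k)))\<^sup>2 \<le> (1/2)^k" .
  qed
  also have "\<dots> < \<infinity>"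
    by (subst suminf_ennreal2) (auto intro: summable_geometric)
  finally have "AE x in lebesgue. (\<Sum>k. ennreal (2^k * (norm (f k x))\<^sup>2)) \<noteq> \<infinity>"
    by (intro nn_integral_PInf_AE) auto
  then show ?thesis
  proof eventually_elim
    case (elim x)
    have sm: "summable (\<lambda>k. 2^k * (norm (f k x))\<^sup>2)"
      using elim by (intro summable_suminf_not_top) auto
    have "summable (\<lambda>k. (2^k * (norm (f k x))\<^sup>2 + (1/2)^k) / 2)"
      by (intro summable_divide summable_add sm summable_geometric) auto
    then show ?case
    proof (rule summable_comparison_test'[where N = 0])
      fix k
      define a where "a = sqrt (2^k)"
      have a: "a > 0" "a\<^sup>2 = 2^k" by (auto simp: a_def)
      have "norm (f k x) = (a * norm (f k x)) * (1 / a)" using a by simp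
      also have "\<dots> \<le> ((a * norm (f k x))\<^sup>2 + (1/a)\<^sup>2) / 2"
        using sum_squares_bound[of "a * norm (f k x)" "1/a"] a(1) by simp
      also have "\<dots> = (2^k * (norm (f k x))\<^sup>2 + (1/2)^k) / 2"
        using a by (simp add: power_mult_distrib power_divide)
      finally show "norm (norm (f k x)) \<le> (2^k * (norm (f k x))\<^sup>2 + (1/2)^k) / 2" by simp
    qed
  qed
qed

text \<open>A subsequence that approaches the limit at a geometric rate has almost everywhere
  summable errors.\<close>

lemma AE_convergent_subsequence_l2:
  assumes f: "\<And>k. square_integrable (f k)" and g: "square_integrable g"
    and conv: "(\<lambda>k. l2_of (f k)) \<longlonglongrightarrow> l2_of g"
  obtains r :: "nat \<Rightarrow> nat" where "strict_mono r"
    "AE x in lebesgue. (\<lambda>k. f (r k) x) \<longlonglongrightarrow> g x"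
proof -
  have "\<exists>r::nat\<Rightarrow>nat. \<forall>k. (norm (l2_of (f (r k)) - l2_of g) \<le> (1/2)^k) \<and> r k < r (Suc k)"
  proof (rule dependent_nat_choice)
    show "\<exists>n. norm (l2_of (f n) - l2_of g) \<le> (1/2)^0"
      using LIMSEQ_D[OF conv, of 1] by (auto intro: less_imp_le)
    show "\<exists>m. norm (l2_of (f m) - l2_of g) \<le> (1/2)^Suc k \<and> n < m" for n k
    proof -
      obtain N where "\<And>m. m \<ge> N \<Longrightarrow> norm (l2_of (f m) - l2_of g) < (1/2)^Suc k"
        using LIMSEQ_D[OF conv, of "(1/2)^Suc k"] by auto
      then show ?thesis by (intro exI[of _ "max N (Suc n)"]) (auto intro: less_imp_le)
    qed
  qed
  then obtain r where r: "\<And>k. norm (l2_of (f (r k)) - l2_of g) \<le> (1/2)^k" "\<And>k. r k < r (Suc k)"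
    by blast
  have "AE x in lebesgue. summable (\<lambda>k. norm (f (r k) x - g x))"
    using r(1) by (intro AE_summable_of_geometric_l2)
      (auto simp: l2_of_diff f g intro: square_integrable_diff f g)
  then have "AE x in lebesgue. (\<lambda>k. f (r k) x) \<longlonglongrightarrow> g x"
    by eventually_elim (auto dest!: summable_LIMSEQ_zero intro: LIM_zero_cancel simp: tendsto_norm_zero_iff)
  then show ?thesis using that[of r] r(2) by (simp add: strict_mono_Suc_iff)
qed

text \<open>Riesz-Fischer: a subsequence with geometrically small increments converges almost
  everywhere, and its pointwise limit is the limit in norm.\<close>

lemma Cauchy_l2_convergent:
  fixes X :: "nat \<Rightarrow> ('a::euclidean_space, 'b::euclidean_space) l2"
  assumes C: "Cauchy X" shows "convergent X"
proof -
  have "\<exists>r::nat\<Rightarrow>nat. \<forall>k. (\<forall>m\<ge>r k. norm (X m - X (r k)) \<le> (1/2)^k) \<and> r k < r (Suc k)"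
  proof (rule dependent_nat_choice)
    show "\<exists>n. \<forall>m\<ge>n. norm (X m - X n) \<le> (1/2)^0"
      using C[unfolded Cauchy_iff, rule_format, of 1] by (auto intro: less_imp_le)
    show "\<exists>l. (\<forall>m\<ge>l. norm (X m - X l) \<le> (1/2)^Suc k) \<and> n < l" for n k
    proof -
      obtain N where "\<And>m l. m \<ge> N \<Longrightarrow> l \<ge> N \<Longrightarrow> norm (X m - X l) < (1/2)^Suc k"
        using C[unfolded Cauchy_iff, rule_format, of "(1/2)^Suc k"] by auto
      then show ?thesis by (intro exI[of _ "max N (Suc n)"]) (auto intro: less_imp_le)
    qed
  qed
  then obtain r where r: "\<And>k m. m \<ge> r k \<Longrightarrow> norm (X m - X (r k)) \<le> (1/2)^k" "\<And>k. r k < r (Suc k)"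
    by blast
  have "\<exists>f. \<forall>n. square_integrable (f n) \<and> X n = l2_of (f n)"
    using l2_cases by (intro choice) blast
  then obtain f where f: "\<And>n. square_integrable (f n)" "\<And>n. X n = l2_of (f n)" by blast
  have [measurable]: "f k \<in> borel_measurable lebesgue" for k
    using f(1) square_integrable_measurable by blast
  have "AE x in lebesgue. summable (\<lambda>k. norm (f (r (Suc k)) x - f (r k) x))"
    using r(1)[OF less_imp_le[OF r(2)]]
    by (intro AE_summable_of_geometric_l2) (auto simp: l2_of_diff f intro: square_integrable_diff f)
  then have conv: "AE x in lebesgue. convergent (\<lambda>k. f (r k) x)"
  proof eventually_elim
    case (elim x)
    have "summable (\<lambda>k. f (r (Suc k)) x - f (r k) x)" using elim by (rule summable_norm_cancel)
    then have "convergent (\<lambda>n. \<Sum>k<n. f (r (Suc k)) x - f (r k) x)"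
      by (simp add: summable_iff_convergent)
    then have "convergent (\<lambda>n. f (r 0) x + (f (r n) x - f (r 0) x))"
      unfolding sum_lessThan_telescope[of "\<lambda>k. f (r k) x"] by (intro convergent_add convergent_const)
    then show ?case by simp
  qed
  define g where "g x = lim (\<lambda>k. f (r k) x)" for x
  have [measurable]: "g \<in> borel_measurable lebesgue" unfolding g_def by measurable
  have lim: "AE x in lebesgue. (\<lambda>k. f (r k) x) \<longlonglongrightarrow> g x"
    using conv by eventually_elim (simp add: g_def convergent_LIMSEQ_iff)
  have mono_r: "strict_mono r" using r(2) by (simp add: strict_mono_Suc_iff)
  \<comment> \<open>Fatou's lemma carries the Cauchy estimate over to the pointwise limit; it also
    yields that \<open>g\<close> is square integrable.\<close>
  have dist_g: "(\<integral>\<^sup>+x. ennreal ((norm (g x - f (r k) x))\<^sup>2) \<partial>lebesgue) \<le> ennreal (((1/2)^k)\<^sup>2)" for k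
  proof -
    have "(\<integral>\<^sup>+x. ennreal ((norm (g x - f (r k) x))\<^sup>2) \<partial>lebesgue)
        = (\<integral>\<^sup>+x. liminf (\<lambda>m. ennreal ((norm (f (r m) x - f (r k) x))\<^sup>2)) \<partial>lebesgue)"
    proof (rule nn_integral_cong_AE, use lim in eventually_elim)
      case (elim x)
      have "(\<lambda>m. ennreal ((norm (f (r m) x - f (r k) x))\<^sup>2)) \<longlonglongrightarrow> ennreal ((norm (g x - f (r k) x))\<^sup>2)"
        by (intro tendsto_ennrealI tendsto_intros elim)
      then show ?case by (intro lim_imp_Liminf[symmetric]) simp_all
    qed
    also have "\<dots> \<le> liminf (\<lambda>m. \<integral>\<^sup>+x. ennreal ((norm (f (r m) x - f (r k) x))\<^sup>2) \<partial>lebesgue)"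
      by (intro nn_integral_liminf) measurable
    also have "\<dots> \<le> ennreal (((1/2)^k)\<^sup>2)"
    proof (intro Liminf_le eventually_sequentiallyI[of k])
      fix m assume "k \<le> m"
      then have "r k \<le> r m" using mono_r by (simp add: strict_mono_less_eq)
      have "(\<integral>\<^sup>+x. ennreal ((norm (f (r m) x - f (r k) x))\<^sup>2) \<partial>lebesgue) = ennreal ((norm (X (r m) - X (r k)))\<^sup>2)"
        by (subst nn_integral_l2_of) (auto simp: f(2) l2_of_diff f(1) intro: square_integrable_diff f)
      also have "\<dots> \<le> ennreal (((1/2)^k)\<^sup>2)"
        by (intro ennreal_leI power_mono r(1) \<open>r k \<le> r m\<close>) auto
      finally show "(\<integral>\<^sup>+x. ennreal ((norm (f (r m) x - f (r k) x))\<^sup>2) \<partial>lebesgue) \<le> ennreal (((1/2)^k)\<^sup>2)" .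
    qed simp
    finally show ?thesis .
  qed
  have sd: "square_integrable (\<lambda>x. g x - f (r k) x)" for k
    using dist_g[of k] by (intro square_integrableI_nn_integral) (auto intro: le_less_trans)
  have g: "square_integrable g"
    using square_integrable_add[OF sd[of 0] f(1)[of "r 0"]] by simp
  have "norm (X (r k) - l2_of g) \<le> (1/2)^k" for k
  proof -
    have "ennreal ((norm (l2_of g - X (r k)))\<^sup>2) \<le> ennreal (((1/2)^k)\<^sup>2)"
      using dist_g[of k] nn_integral_l2_of[OF sd[of k]] by (simp add: l2_of_diff g f)
    then have "(norm (l2_of g - X (r k)))\<^sup>2 \<le> ((1/2)^k)\<^sup>2"
      by (subst (asm) ennreal_le_iff) auto
    then show ?thesis by (metis norm_minus_commute power2_le_imp_le zero_le_divide_1_iff zero_le_numeral zero_le_power)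
  qed
  then have "(\<lambda>k. X (r k) - l2_of g) \<longlonglongrightarrow> 0"
    by (intro Lim_null_comparison[where g = "\<lambda>k. (1/2)^k" and f = "\<lambda>k. X (r k) - l2_of g"]
        always_eventually allI LIMSEQ_power_zero) auto
  then have "(X \<circ> r) \<longlonglongrightarrow> l2_of g" by (simp add: o_def LIM_zero_iff)
  then have "X \<longlonglongrightarrow> l2_of g" by (rule Cauchy_converges_subseq[OF C mono_r])
  then show ?thesis by (auto simp: convergent_def)
qed

instance l2 :: (euclidean_space, euclidean_space) complete_space
  by standard (rule Cauchy_l2_convergent)

section \<open>Smooth functions and test functions\<close>

lemma partial_derivative_eq:
  "(f has_derivative D) (at x) \<Longrightarrow> partial_derivative i f x = D (axis i 1)"
  unfolding partial_derivative_def by (metis frechet_derivative_at)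

lemma smooth_iff:
  "smooth f \<longleftrightarrow> (\<forall>x. f differentiable (at x)) \<and> (\<forall>i. smooth (partial_derivative i f))"
proof
  assume f: "smooth f"
  then have "fold partial_derivative (i # is) f differentiable_on UNIV" for i "is"
    unfolding smooth_def by blast
  moreover have "fold partial_derivative [] f differentiable_on UNIV"
    using f unfolding smooth_def by blast
  ultimately show "(\<forall>x. f differentiable (at x)) \<and> (\<forall>i. smooth (partial_derivative i f))"
    by (simp add: smooth_def differentiable_on_def)
next
  assume f: "(\<forall>x. f differentiable (at x)) \<and> (\<forall>i. smooth (partial_derivative i f))"
  show "smooth f"
    unfolding smooth_def
  proof
    fix "is" show "fold partial_derivative is f differentiable_on UNIV"
      using f by (cases "is") (auto simp: smooth_def differentiable_on_def)
  qed
qed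

lemma smooth_coinduct:
  assumes "C f" and "\<And>g x. C g \<Longrightarrow> g differentiable (at x)"
    and step: "\<And>g i. C g \<Longrightarrow> C (partial_derivative i g)"
  shows "smooth f"
  unfolding smooth_def
proof
  fix "is"
  have "C (fold partial_derivative is f)"
    using \<open>C f\<close> by (induction "is" arbitrary: f) (auto intro: step)
  then show "fold partial_derivative is f differentiable_on UNIV"
    using assms(2) by (simp add: differentiable_on_def)
qed

text \<open>\<open>exp_tail 0\<close> is the classical flat function. The factors
  \<open>1 / t ^ m\<close> are included because the derivative of \<open>exp_tail m\<close> is
  \<open>exp_tail (m + 2) - m * exp_tail (m + 1)\<close>, so linear combinations of the family are
  closed under differentiation.\<close>

definition exp_tail :: "nat \<Rightarrow> real \<Rightarrow> real" where
  "exp_tail m t = (if t > 0 then exp (- 1 / t) / t ^ m else 0)"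

lemma exp_tail_nonneg: "0 \<le> exp_tail m t"
  by (simp add: exp_tail_def)

lemma exp_tail_pos: "t > 0 \<Longrightarrow> 0 < exp_tail m t"
  by (simp add: exp_tail_def)

lemma exp_tail_nonpos: "t \<le> 0 \<Longrightarrow> exp_tail m t = 0"
  by (simp add: exp_tail_def)

lemma exp_ge_power_over_fact:
  fixes x :: real assumes "0 \<le> x" shows "x ^ m / fact m \<le> exp x"
proof -
  have s: "(\<lambda>n. x ^ n /\<^sub>R fact n) sums exp x" by (rule exp_converges)
  have "(\<Sum>n\<in>{m}. x ^ n /\<^sub>R fact n) \<le> (\<Sum>n. x ^ n /\<^sub>R fact n)"
    using assms by (intro sum_le_suminf sums_summable[OF s]) auto
  then show ?thesis using sums_unique[OF s] by (simp add: divide_inverse mult.commute)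
qed

text \<open>For \<open>t > 0\<close> this compares \<open>exp (1 / t)\<close> with the
  \<open>m\<close>-th term of its power series.\<close>

lemma exp_tail_le_fact: "exp_tail m t \<le> fact m"
proof (cases "t > 0")
  case True
  have "(1 / t) ^ m / fact m \<le> exp (1 / t)" using True by (intro exp_ge_power_over_fact) simp
  then have "(1 / t) ^ m \<le> fact m * exp (1 / t)" by (metis fact_gt_zero mult.commute pos_divide_le_eq)
  then have "(1 / t) ^ m * exp (- (1 / t)) \<le> fact m * exp (1 / t) * exp (- (1 / t))"
    by (intro mult_right_mono) auto
  then show ?thesis using True
    by (simp add: exp_tail_def power_divide mult.assoc flip: exp_add)
qed (simp add: exp_tail_def)

text \<open>Follows from \<open>exp_tail m t = t * exp_tail (m + 1) t\<close>. This linear decay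
  makes the difference quotients at 0 tend to 0.\<close>

lemma exp_tail_le_linear: "exp_tail m t \<le> fact (Suc m) * \<bar>t\<bar>"
proof (cases "t > 0")
  case True
  then have "exp_tail m t = t * exp_tail (Suc m) t" by (simp add: exp_tail_def)
  also have "\<dots> \<le> t * fact (Suc m)" using True by (intro mult_left_mono exp_tail_le_fact) simp
  finally show ?thesis using True by (simp add: mult.commute)
next
  case False
  then have "exp_tail m t = 0" by (simp add: exp_tail_def)
  then show ?thesis by (simp del: fact_Suc)
qed

lemma has_real_derivative_exp_tail:
  "(exp_tail m has_real_derivative (exp_tail (Suc (Suc m)) t - real m * exp_tail (Suc m) t)) (at t)"
proof -
  consider "t > 0" | "t < 0" | "t = 0" by linarith
  then show ?thesis
  proof cases
    case 1
    have "((\<lambda>t. exp (- 1 / t) / t ^ m) has_real_derivative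
        (exp (- 1 / t) * (1 / t\<^sup>2) * t ^ m - exp (- 1 / t) * (real m * t ^ (m - 1))) / (t ^ m * t ^ m)) (at t)"
      using 1 by (auto intro!: derivative_eq_intros simp: power2_eq_square)
    also have "(exp (- 1 / t) * (1 / t\<^sup>2) * t ^ m - exp (- 1 / t) * (real m * t ^ (m - 1))) / (t ^ m * t ^ m)
        = exp_tail (Suc (Suc m)) t - real m * exp_tail (Suc m) t"
      using 1 by (cases m) (auto simp: exp_tail_def field_simps power2_eq_square)
    finally have D: "((\<lambda>t. exp (- 1 / t) / t ^ m) has_real_derivative
        (exp_tail (Suc (Suc m)) t - real m * exp_tail (Suc m) t)) (at t)" .
    show ?thesis
      by (rule has_field_derivative_transform_within_open[OF D, of "{0<..}"])
         (use 1 in \<open>auto simp: exp_tail_def\<close>)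
  next
    case 2
    have D: "((\<lambda>t::real. 0) has_real_derivative 0) (at t)" by simp
    have "(exp_tail m has_real_derivative 0) (at t)"
      by (rule has_field_derivative_transform_within_open[OF D, of "{..<0}"])
         (use 2 in \<open>auto simp: exp_tail_def\<close>)
    then show ?thesis using 2 by (simp add: exp_tail_nonpos)
  next
    case 3
    \<comment> \<open>The difference quotient of \<open>exp_tail m\<close> at 0 is
      \<open>exp_tail (Suc m)\<close> itself.\<close>
    have "((\<lambda>h. exp_tail (Suc m) h) \<longlongrightarrow> 0) (at 0)"
    proof (rule Lim_null_comparison[where g = "\<lambda>h. fact (Suc (Suc m)) * \<bar>h\<bar>"])
      show "\<forall>\<^sub>F h in at 0. norm (exp_tail (Suc m) h) \<le> fact (Suc (Suc m)) * \<bar>h\<bar>"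
        using exp_tail_le_linear[of "Suc m"] exp_tail_nonneg[of "Suc m"] by (simp del: fact_Suc)
      show "((\<lambda>h. fact (Suc (Suc m)) * \<bar>h\<bar>) \<longlongrightarrow> (0::real)) (at 0)"
        by (intro tendsto_mult_right_zero tendsto_rabs_zero tendsto_ident_at)
    qed
    moreover have "exp_tail (Suc m) h = (exp_tail m (0 + h) - exp_tail m 0) / h" if "h \<noteq> 0" for h
      using that by (simp add: exp_tail_def)
    ultimately have "((\<lambda>h. (exp_tail m (0 + h) - exp_tail m 0) / h) \<longlongrightarrow> 0) (at 0)"
      by (subst (asm) Lim_cong_within[OF refl refl refl]) auto
    then have "(exp_tail m has_real_derivative 0) (at 0)" by (simp add: DERIV_def)
    then show ?thesis using 3 by (simp add: exp_tail_nonpos)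
  qed
qed

lemma continuous_on_exp_tail: "continuous_on S (exp_tail m)"
  using has_real_derivative_exp_tail by (meson DERIV_isCont continuous_at_imp_continuous_on)

text \<open>Differentiating a product or a composition with \<open>exp_tail m\<close> produces only
  expressions built by the same rules, so the class is closed under partial derivatives and
  \<open>smooth_coinduct\<close> applies to it. The rule \<open>base\<close> then turns every other
  rule into a closure property of \<open>smooth\<close>.\<close>

inductive smooth_alg :: "(real^'n::finite \<Rightarrow> real) \<Rightarrow> bool" where
  base: "smooth f \<Longrightarrow> smooth_alg f"
| const: "smooth_alg (\<lambda>_. c)"
| coord: "smooth_alg (\<lambda>x. x $ i)"
| add: "smooth_alg f \<Longrightarrow> smooth_alg g \<Longrightarrow> smooth_alg (\<lambda>x. f x + g x)"
| mult: "smooth_alg f \<Longrightarrow> smooth_alg g \<Longrightarrow> smooth_alg (\<lambda>x. f x * g x)"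
| tail: "smooth_alg f \<Longrightarrow> smooth_alg (\<lambda>x. exp_tail m (f x))"

lemma has_derivative_partial_derivative:
  fixes f :: "real^'n::finite \<Rightarrow> real"
  assumes "f differentiable (at x)"
  shows "(f has_derivative (\<lambda>h. \<Sum>i\<in>UNIV. partial_derivative i f x * h $ i)) (at x)"
proof -
  let ?D = "frechet_derivative f (at x)"
  have D: "(f has_derivative ?D) (at x)" using assms by (simp add: frechet_derivative_works)
  have "?D h = (\<Sum>i\<in>UNIV. partial_derivative i f x * h $ i)" for h
  proof -
    interpret linear ?D using D by (rule has_derivative_linear)
    have "?D h = ?D (\<Sum>i\<in>UNIV. h $ i *\<^sub>R axis i 1)"
      using basis_expansion[of h] by (simp add: scalar_mult_eq_scaleR)
    also have "\<dots> = (\<Sum>i\<in>UNIV. h $ i * ?D (axis i 1))" by (simp add: sum scale)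
    finally show ?thesis by (simp add: partial_derivative_def mult.commute)
  qed
  then have "?D = (\<lambda>h. \<Sum>i\<in>UNIV. partial_derivative i f x * h $ i)" by (rule ext)
  then show ?thesis using D by simp
qed

lemma partial_derivative_add:
  assumes "f differentiable (at x)" "g differentiable (at x)"
  shows "partial_derivative i (\<lambda>x. f x + g x) x = partial_derivative i f x + partial_derivative i g x"
  using has_derivative_add[OF assms[unfolded frechet_derivative_works]]
  by (auto dest!: partial_derivative_eq[where i = i] simp: partial_derivative_def)

lemma partial_derivative_mult:
  assumes "f differentiable (at x)" "g differentiable (at x)"
  shows "partial_derivative i (\<lambda>x. f x * g x) x = f x * partial_derivative i g x + partial_derivative i f x * g x"
  using has_derivative_mult[OF assms[unfolded frechet_derivative_works]]
  by (auto dest!: partial_derivative_eq[where i = i] simp: partial_derivative_def)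

lemma partial_derivative_compose:
  assumes "f differentiable (at x)" "(h has_real_derivative d) (at (f x))"
  shows "partial_derivative i (\<lambda>x. h (f x)) x = d * partial_derivative i f x"
    and "(\<lambda>x. h (f x)) differentiable (at x)"
proof -
  have "((\<lambda>x. h (f x)) has_derivative (\<lambda>y. d * frechet_derivative f (at x) y)) (at x)"
    using has_derivative_compose[OF assms(1)[unfolded frechet_derivative_works]
        assms(2)[unfolded has_field_derivative_def]] by simp
  then show "partial_derivative i (\<lambda>x. h (f x)) x = d * partial_derivative i f x"
    "(\<lambda>x. h (f x)) differentiable (at x)"
    using partial_derivative_eq[where i = i] by (fastforce simp: partial_derivative_def, auto simp: differentiable_def)
qed

lemma partial_derivative_const: "partial_derivative i (\<lambda>_. c) x = 0"
  using partial_derivative_eq[OF has_derivative_const[of c "at x"], of i] by simp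

lemma partial_derivative_coord: "partial_derivative i (\<lambda>x. x $ j) x = (if i = j then 1 else 0)"
  using partial_derivative_eq[OF bounded_linear.has_derivative[OF bounded_linear_vec_nth has_derivative_ident], of i j x]
  by (simp add: axis_def)

lemma smooth_alg_closed:
  fixes f :: "real^'n::finite \<Rightarrow> real"
  assumes "smooth_alg f"
  shows "(\<forall>x. f differentiable (at x)) \<and> (\<forall>i. smooth_alg (partial_derivative i f))"
  using assms
proof induction
  case (base f)
  then show ?case using smooth_iff[of f] by (auto intro: smooth_alg.base)
next
  case (const c)
  have "partial_derivative i (\<lambda>_::real^'n. c) = (\<lambda>_. 0)" for i by (simp add: fun_eq_iff partial_derivative_const)
  then show ?case by (auto intro: smooth_alg.const)
next
  case (coord j)
  have "partial_derivative i (\<lambda>x. x $ j) = (\<lambda>_. if i = j then 1 else 0)" for i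
    by (rule ext) (rule partial_derivative_coord)
  moreover have "(\<lambda>x::real^'n. x $ j) differentiable (at x)" for x
    using bounded_linear.has_derivative[OF bounded_linear_vec_nth has_derivative_ident] by (auto simp: differentiable_def)
  ultimately show ?case by (auto intro: smooth_alg.const)
next
  case (add f g)
  have "partial_derivative i (\<lambda>x. f x + g x) = (\<lambda>x. partial_derivative i f x + partial_derivative i g x)" for i
    using add by (intro ext partial_derivative_add) auto
  then show ?case using add by (auto intro: smooth_alg.add)
next
  case (mult f g)
  have "partial_derivative i (\<lambda>x. f x * g x)
      = (\<lambda>x. f x * partial_derivative i g x + partial_derivative i f x * g x)" for i
    using mult by (intro ext partial_derivative_mult) auto
  moreover have "smooth_alg (\<lambda>x. f x * partial_derivative i g x + partial_derivative i f x * g x)" for i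
    using mult by (intro smooth_alg.add smooth_alg.mult) auto
  moreover have "(\<lambda>x. f x * g x) differentiable (at x)" for x
    using mult by (intro differentiable_mult) auto
  ultimately show ?case by simp
next
  case (tail f m)
  have "partial_derivative i (\<lambda>x. exp_tail m (f x))
      = (\<lambda>x. (exp_tail (Suc (Suc m)) (f x) + (- real m) * exp_tail (Suc m) (f x)) * partial_derivative i f x)" for i
    using partial_derivative_compose(1)[OF _ has_real_derivative_exp_tail, of f] tail by (intro ext) simp
  moreover have "smooth_alg (\<lambda>x. (exp_tail (Suc (Suc m)) (f x) + (- real m) * exp_tail (Suc m) (f x))
      * partial_derivative i f x)" for i
    using tail by (intro smooth_alg.mult smooth_alg.add smooth_alg.tail smooth_alg.const) auto
  moreover have "(\<lambda>x. exp_tail m (f x)) differentiable (at x)" for x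
    using partial_derivative_compose(2)[OF _ has_real_derivative_exp_tail, of f] tail by blast
  ultimately show ?case by simp
qed

lemma smooth_alg_imp_smooth: "smooth_alg f \<Longrightarrow> smooth f"
  using smooth_alg_closed by (intro smooth_coinduct[of smooth_alg]) auto

lemma smooth_const: "smooth (\<lambda>_. c)"
  by (intro smooth_alg_imp_smooth smooth_alg.const)

lemma smooth_coord: "smooth (\<lambda>x. x $ i)"
  by (intro smooth_alg_imp_smooth smooth_alg.coord)

lemma smooth_add: "smooth f \<Longrightarrow> smooth g \<Longrightarrow> smooth (\<lambda>x. f x + g x)"
  by (rule smooth_alg_imp_smooth, rule smooth_alg.add; rule smooth_alg.base)

lemma smooth_mult: "smooth f \<Longrightarrow> smooth g \<Longrightarrow> smooth (\<lambda>x. f x * g x)"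
  by (rule smooth_alg_imp_smooth, rule smooth_alg.mult; rule smooth_alg.base)

lemma smooth_exp_tail: "smooth f \<Longrightarrow> smooth (\<lambda>x. exp_tail m (f x))"
  by (rule smooth_alg_imp_smooth, rule smooth_alg.tail; rule smooth_alg.base)

lemma smooth_prod: "(\<And>i. i \<in> I \<Longrightarrow> smooth (f i)) \<Longrightarrow> smooth (\<lambda>x. \<Prod>i\<in>I. f i x)"
  by (induction I rule: infinite_finite_induct) (auto intro: smooth_const smooth_mult)

lemma smooth_diff: "smooth f \<Longrightarrow> smooth g \<Longrightarrow> smooth (\<lambda>x. f x - g x)"
  using smooth_add[of f "\<lambda>x. (-1) * g x"] smooth_mult[OF smooth_const[of "-1"], of g] by simp

lemma smooth_differentiable: "smooth f \<Longrightarrow> f differentiable (at x)"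
  using smooth_iff[of f] by blast

lemma smooth_partial_derivative: "smooth f \<Longrightarrow> smooth (partial_derivative i f)"
  using smooth_iff[of f] by blast

lemma smooth_continuous: "smooth f \<Longrightarrow> continuous_on S f"
  by (meson smooth_differentiable differentiable_imp_continuous_within continuous_at_imp_continuous_on)

section \<open>Test functions: supports and closure properties\<close>

lemma test_functionsI:
  assumes "smooth \<phi>" "compact K" "K \<subseteq> \<Omega>" "\<And>x. x \<notin> K \<Longrightarrow> \<phi> x = 0"
  shows "\<phi> \<in> test_functions \<Omega>"
proof -
  have "closure {x. \<phi> x \<noteq> 0} \<subseteq> K"
    using assms(2,4) by (intro closure_minimal compact_imp_closed) auto
  moreover from this have "compact (closure {x. \<phi> x \<noteq> 0})"
    using compact_Int_closed[OF assms(2) closed_closure[of "{x. \<phi> x \<noteq> 0}"]]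
    by (simp add: Int_absorb1)
  ultimately show ?thesis using assms by (auto simp: test_functions_def)
qed

lemma test_functionsE:
  assumes "\<phi> \<in> test_functions \<Omega>"
  obtains K where "smooth \<phi>" "compact K" "K \<subseteq> \<Omega>" "\<And>x. x \<notin> K \<Longrightarrow> \<phi> x = 0"
    "\<And>x i. x \<notin> K \<Longrightarrow> partial_derivative i \<phi> x = 0"
proof
  let ?K = "closure {x. \<phi> x \<noteq> 0}"
  show "smooth \<phi>" "compact ?K" "?K \<subseteq> \<Omega>" using assms by (auto simp: test_functions_def)
  show 0: "\<phi> x = 0" if "x \<notin> ?K" for x using that closure_subset[of "{x. \<phi> x \<noteq> 0}"] by auto
  show "partial_derivative i \<phi> x = 0" if "x \<notin> ?K" for x i
  proof -
    have "((\<lambda>_. 0::real) has_derivative (\<lambda>_. 0)) (at x)" by simp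
    then have "(\<phi> has_derivative (\<lambda>_. 0)) (at x)"
    proof (rule has_derivative_transform_within_open)
      show "open (- ?K)" by (intro open_Compl closed_closure)
      show "x \<in> - ?K" using that by simp
      show "0 = \<phi> y" if "y \<in> - ?K" for y using 0[of y] that by simp
    qed
    then show ?thesis using partial_derivative_eq by fastforce
  qed
qed

lemma test_functions_smooth: "\<phi> \<in> test_functions \<Omega> \<Longrightarrow> smooth \<phi>"
  by (simp add: test_functions_def)

lemma test_functions_partial_derivative:
  "\<phi> \<in> test_functions \<Omega> \<Longrightarrow> partial_derivative i \<phi> \<in> test_functions \<Omega>"
  by (erule test_functionsE, rule test_functionsI) (auto intro: smooth_partial_derivative)

lemma test_functions_mult:
  "\<phi> \<in> test_functions \<Omega> \<Longrightarrow> smooth \<psi> \<Longrightarrow> (\<lambda>x. \<phi> x * \<psi> x) \<in> test_functions \<Omega>"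
  by (erule test_functionsE, rule test_functionsI) (auto intro: smooth_mult)

lemma test_functions_add:
  assumes "\<phi> \<in> test_functions \<Omega>" "\<psi> \<in> test_functions \<Omega>"
  shows "(\<lambda>x. \<phi> x + \<psi> x) \<in> test_functions \<Omega>"
proof -
  obtain K where K: "smooth \<phi>" "compact K" "K \<subseteq> \<Omega>" "\<And>x. x \<notin> K \<Longrightarrow> \<phi> x = 0"
    using assms(1) by (rule test_functionsE) blast
  obtain L where L: "smooth \<psi>" "compact L" "L \<subseteq> \<Omega>" "\<And>x. x \<notin> L \<Longrightarrow> \<psi> x = 0"
    using assms(2) by (rule test_functionsE) blast
  show ?thesis using K L by (intro test_functionsI[of _ "K \<union> L"] smooth_add) auto
qed

lemma test_functions_scale:
  "\<phi> \<in> test_functions \<Omega> \<Longrightarrow> (\<lambda>x. c * \<phi> x) \<in> test_functions \<Omega>"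
  using test_functions_mult[OF _ smooth_const[of c]] by (simp add: mult.commute)

lemma test_functions_zero: "(\<lambda>_. 0) \<in> test_functions \<Omega>"
  by (rule test_functionsI[of _ "{}"]) (auto intro: smooth_const)

lemma test_functions_bounded:
  assumes "\<phi> \<in> test_functions \<Omega>" obtains C where "C \<ge> 0" "\<And>x. \<bar>\<phi> x\<bar> \<le> C"
proof -
  obtain K where K: "smooth \<phi>" "compact K" "\<And>x. x \<notin> K \<Longrightarrow> \<phi> x = 0"
    using assms by (rule test_functionsE) blast
  have "bounded (\<phi> ` K)" using K by (intro compact_imp_bounded compact_continuous_image smooth_continuous)
  then obtain C where C: "C > 0" "\<And>x. x \<in> K \<Longrightarrow> \<bar>\<phi> x\<bar> \<le> C" by (auto simp: bounded_pos)
  have "\<bar>\<phi> x\<bar> \<le> C" for x using C K(3) by (cases "x \<in> K") auto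
  then show ?thesis using that[of C] C(1) by simp
qed

lemma test_functions_borel: "\<phi> \<in> test_functions \<Omega> \<Longrightarrow> \<phi> \<in> borel_measurable borel"
  by (intro borel_measurable_continuous_onI smooth_continuous test_functions_smooth)

lemma test_functions_integrable:
  assumes "\<phi> \<in> test_functions \<Omega>" shows "integrable lborel \<phi>"
proof -
  obtain K where K: "smooth \<phi>" "compact K" "\<And>x. x \<notin> K \<Longrightarrow> \<phi> x = 0"
    using assms by (rule test_functionsE) blast
  have "integrable lborel (\<lambda>x. indicator K x *\<^sub>R \<phi> x)"
    by (rule borel_integrable_compact[OF K(2) smooth_continuous[OF K(1)]])
  also have "(\<lambda>x. indicator K x *\<^sub>R \<phi> x) = \<phi>" using K(3) by (auto simp: indicator_def fun_eq_iff)
  finally show ?thesis .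
qed

text \<open>
  A smooth substitute for \<open>sgn t * max 0 (\<bar>t\<bar> - q)\<close>: composition with it maps test functions to test
  functions, so that truncation in \<open>W\<^sub>0\<^sup>1\<^sup>,\<^sup>2\<close> needs no mollification.
\<close>

definition truncated :: "real \<Rightarrow> real \<Rightarrow> real" where
  "truncated q t = exp_tail 0 (t - q) - exp_tail 0 (- t - q)"

definition truncated_deriv :: "real \<Rightarrow> real \<Rightarrow> real" where
  "truncated_deriv q t = exp_tail 2 (t - q) + exp_tail 2 (- t - q)"

lemma has_real_derivative_truncated:
  "(truncated q has_real_derivative truncated_deriv q t) (at t)"
proof -
  have D: "(exp_tail 0 has_real_derivative exp_tail 2 s) (at s)" for s
    using has_real_derivative_exp_tail[of 0 s] by (simp add: numeral_2_eq_2)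
  have "((\<lambda>t. exp_tail 0 (t - q) - exp_tail 0 (- t - q)) has_real_derivative
      (exp_tail 2 (t - q) * 1 - exp_tail 2 (- t - q) * (- 1))) (at t)"
    by (intro DERIV_diff DERIV_chain2[OF D]) (auto intro!: derivative_eq_intros)
  then show ?thesis by (simp add: truncated_def[abs_def] truncated_deriv_def)
qed

lemma test_functions_truncated:
  assumes "\<phi> \<in> test_functions \<Omega>" "q \<ge> 0"
  shows "(\<lambda>x. truncated q (\<phi> x)) \<in> test_functions \<Omega>"
proof -
  obtain K where K: "smooth \<phi>" "compact K" "K \<subseteq> \<Omega>" "\<And>x. x \<notin> K \<Longrightarrow> \<phi> x = 0"
    using assms(1) by (rule test_functionsE) blast
  have "smooth (\<lambda>x. exp_tail 0 (\<phi> x - q) - exp_tail 0 ((-1) * \<phi> x - q))"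
    by (intro smooth_diff smooth_exp_tail smooth_mult smooth_const K(1))
  then show ?thesis
    using K assms(2) by (intro test_functionsI[of _ K]) (auto simp: truncated_def exp_tail_nonpos)
qed

lemma truncated_deriv_nonneg: "0 \<le> truncated_deriv q t"
  by (simp add: truncated_deriv_def exp_tail_nonneg)

text \<open>The constant is \<open>2 * fact 2\<close>, one factorial bound for each tail. It is also
  the Lipschitz constant of the truncation and the origin of \<open>c / 4\<close> in
  \<open>energy_truncated\<close>.\<close>

lemma truncated_deriv_le: "truncated_deriv q t \<le> 4"
  using exp_tail_le_fact[of 2 "t - q"] exp_tail_le_fact[of 2 "- t - q"]
  by (simp add: truncated_deriv_def fact_2)

lemma truncated_lipschitz: "\<bar>truncated q s - truncated q t\<bar> \<le> 4 * \<bar>s - t\<bar>"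
proof -
  have "norm (truncated q s - truncated q t) \<le> 4 * norm (s - t)"
    using has_real_derivative_truncated truncated_deriv_nonneg truncated_deriv_le
    by (intro field_differentiable_bound[of UNIV "truncated q" "truncated_deriv q"]) auto
  then show ?thesis by simp
qed

lemma abs_truncated_le: "\<bar>truncated q t\<bar> \<le> 1"
  using exp_tail_le_fact[of 0 "t - q"] exp_tail_le_fact[of 0 "- t - q"]
    exp_tail_nonneg[of 0 "t - q"] exp_tail_nonneg[of 0 "- t - q"]
  by (simp add: truncated_def abs_le_iff)

lemma truncated_eq_0_iff: 
  assumes "q \<ge> 0" shows "truncated q t = 0 \<longleftrightarrow> \<bar>t\<bar> \<le> q"
proof -
  consider "t > q" | "- t > q" | "\<bar>t\<bar> \<le> q" by linarith
  then show ?thesis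
    by cases (use assms exp_tail_pos[of "t - q" 0] exp_tail_pos[of "- t - q" 0] in
      \<open>auto simp: truncated_def exp_tail_nonpos\<close>)
qed

text \<open>The pointwise form of the maximum principle: beyond the level \<open>q\<close> the
  difference \<open>t - s\<close> has the sign of \<open>t\<close>, which is also the sign of
  \<open>truncated q t\<close>.\<close>

lemma truncated_sgn:
  assumes "q \<ge> 0" "\<bar>s\<bar> \<le> q" 
  shows "0 \<le> (t - s) * truncated q t"
proof -
  consider "t > q" | "- t > q" | "\<bar>t\<bar> \<le> q" by linarith
  then show ?thesis
  proof cases
    case 1
    then have "truncated q t = exp_tail 0 (t - q)" using assms by (simp add: truncated_def exp_tail_nonpos)
    then show ?thesis using 1 assms exp_tail_nonneg[of 0 "t - q"] by simp
  next
    case 2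
    then have "truncated q t = - exp_tail 0 (- t - q)" using assms by (simp add: truncated_def exp_tail_nonpos)
    then show ?thesis using 2 assms exp_tail_nonneg[of 0 "- t - q"] by (simp add: mult_nonpos_nonneg)
  next
    case 3
    then show ?thesis using assms truncated_eq_0_iff[of q t] by simp
  qed
qed

lemma continuous_on_truncated: "continuous_on S (truncated q)"
  using has_real_derivative_truncated by (meson DERIV_isCont continuous_at_imp_continuous_on)

lemma continuous_on_truncated_deriv: "continuous_on S (truncated_deriv q)"
  unfolding truncated_deriv_def
  by (intro continuous_intros continuous_on_compose2[OF continuous_on_exp_tail[of UNIV]]) auto

text \<open>A smooth substitute for the indicator of the open box, with support in the closed box:
  each factor has the form \<open>exp (- 1 / (k * s))\<close>, which tends to 1 as soon as
  \<open>s > 0\<close>.\<close>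

definition box_bump :: "real^'n::finite \<Rightarrow> real^'n \<Rightarrow> nat \<Rightarrow> real^'n \<Rightarrow> real" where
  "box_bump a b k x = (\<Prod>i\<in>UNIV. exp_tail 0 (real k * (x $ i - a $ i)) * exp_tail 0 (real k * (b $ i - x $ i)))"

lemma box_bump_test_function:
  assumes "cbox a b \<subseteq> \<Omega>" shows "box_bump a b k \<in> test_functions \<Omega>"
proof (rule test_functionsI[of _ "cbox a b"])
  show "smooth (box_bump a b k)"
    unfolding box_bump_def
    by (intro smooth_prod smooth_mult smooth_exp_tail smooth_diff smooth_const smooth_coord)
  show "compact (cbox a b)" by simp
  show "box_bump a b k x = 0" if "x \<notin> cbox a b" for x
  proof -
    obtain i where "x $ i < a $ i \<or> b $ i < x $ i"
      using \<open>x \<notin> cbox a b\<close> by (auto simp: mem_box_cart not_le)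
    then have "exp_tail 0 (real k * (x $ i - a $ i)) * exp_tail 0 (real k * (b $ i - x $ i)) = 0"
      by (auto simp: exp_tail_nonpos mult_nonneg_nonpos)
    then show ?thesis unfolding box_bump_def by (meson UNIV_I finite prod_zero_iff)
  qed
qed (use assms in auto)

lemma box_bump_bounds: "0 \<le> box_bump a b k x" "box_bump a b k x \<le> 1"
proof -
  have 1: "exp_tail 0 t \<le> 1" for t using exp_tail_le_fact[of 0 t] by simp
  show "0 \<le> box_bump a b k x" "box_bump a b k x \<le> 1"
    unfolding box_bump_def
    by (auto intro!: prod_nonneg prod_le_1 mult_le_one simp: exp_tail_nonneg 1)
qed

lemma box_bump_tendsto: "(\<lambda>k. box_bump a b k x) \<longlonglongrightarrow> indicator (box a b) x"
proof (cases "x \<in> box a b")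
  case True
  have lim: "(\<lambda>k. exp_tail 0 (real k * t)) \<longlonglongrightarrow> 1" if "t > 0" for t
  proof -
    have "(\<lambda>k. exp (- (1 / t) * (1 / real k))) \<longlonglongrightarrow> exp (- (1 / t) * 0)"
      by (intro tendsto_intros lim_1_over_n)
    then have "(\<lambda>k. exp (- (1 / t) * (1 / real k))) \<longlonglongrightarrow> 1" by (rule tendsto_eq_rhs) simp
    then show ?thesis
      by (rule Lim_transform_eventually)
        (use that in \<open>auto simp: exp_tail_def field_simps intro!: eventually_sequentiallyI[of 1]\<close>)
  qed
  have "(\<lambda>k. box_bump a b k x) \<longlonglongrightarrow> (\<Prod>i\<in>(UNIV :: 'a set). 1 * 1)"
    unfolding box_bump_def
    by (intro tendsto_intros lim) (use True in \<open>auto simp: mem_box_cart\<close>)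
  then show ?thesis using True by simp
next
  case False
  then obtain i where "x $ i \<le> a $ i \<or> b $ i \<le> x $ i" by (auto simp: mem_box_cart not_less)
  then have "exp_tail 0 (real k * (x $ i - a $ i)) * exp_tail 0 (real k * (b $ i - x $ i)) = 0" for k
    by (auto simp: exp_tail_nonpos mult_nonneg_nonpos)
  then have "box_bump a b k x = 0" for k unfolding box_bump_def by (meson UNIV_I finite prod_zero_iff)
  then show ?thesis using False by simp
qed

section \<open>Integration by parts and translation estimates\<close>

definition classical_gradient :: "(real^'n::finite \<Rightarrow> real) \<Rightarrow> real^'n \<Rightarrow> real^'n" where
  "classical_gradient \<phi> x = (\<chi> i. partial_derivative i \<phi> x)"

lemma classical_gradient_nth [simp]: "classical_gradient \<phi> x $ i = partial_derivative i \<phi> x"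
  by (simp add: classical_gradient_def)

lemma continuous_on_classical_gradient:
  assumes "smooth \<phi>" shows "continuous_on S (classical_gradient \<phi>)"
  unfolding classical_gradient_def
  by (intro continuous_on_vec_lambda smooth_continuous smooth_partial_derivative assms)

lemma has_real_derivative_along_line:
  assumes "smooth \<phi>"
  shows "((\<lambda>t. \<phi> (x + t *\<^sub>R z)) has_real_derivative (classical_gradient \<phi> (x + t *\<^sub>R z) \<bullet> z)) (at t)"
proof -
  have "((\<lambda>t. x + t *\<^sub>R z) has_derivative (\<lambda>h. h *\<^sub>R z)) (at t)"
    by (auto intro!: derivative_eq_intros)
  from has_derivative_compose[OF this has_derivative_partial_derivative[OF smooth_differentiable[OF assms]]]
  have "((\<lambda>t. \<phi> (x + t *\<^sub>R z)) has_derivative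
      (\<lambda>h. \<Sum>i\<in>UNIV. partial_derivative i \<phi> (x + t *\<^sub>R z) * (h *\<^sub>R z) $ i)) (at t)" .
  also have "(\<lambda>h. \<Sum>i\<in>UNIV. partial_derivative i \<phi> (x + t *\<^sub>R z) * (h *\<^sub>R z) $ i)
      = (*) (classical_gradient \<phi> (x + t *\<^sub>R z) \<bullet> z)"
    by (auto simp: inner_vec_def sum_distrib_right intro!: ext sum.cong)
  finally show ?thesis by (simp add: has_field_derivative_def)
qed

lemma difference_along_line:
  assumes "smooth \<phi>"
  shows "integrable lborel (\<lambda>t. (classical_gradient \<phi> (x + t *\<^sub>R z) \<bullet> z) * indicator {0..1} t)"
    and "(LINT t|lborel. (classical_gradient \<phi> (x + t *\<^sub>R z) \<bullet> z) * indicator {0..1} t) = \<phi> (x + z) - \<phi> x"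
proof -
  have "continuous_on UNIV (\<lambda>t. classical_gradient \<phi> (x + t *\<^sub>R z) \<bullet> z)"
    by (intro continuous_intros continuous_on_compose2[OF continuous_on_classical_gradient[OF assms, of UNIV]]) auto
  then have c: "isCont (\<lambda>t. classical_gradient \<phi> (x + t *\<^sub>R z) \<bullet> z) t" for t
    by (simp add: continuous_on_eq_continuous_at)
  show "integrable lborel (\<lambda>t. (classical_gradient \<phi> (x + t *\<^sub>R z) \<bullet> z) * indicator {0..1} t)"
    using has_bochner_integral_FTC_Icc_real[OF _ has_real_derivative_along_line[OF assms] c, of 0 1]
    by (auto simp: has_bochner_integral_iff)
  show "(LINT t|lborel. (classical_gradient \<phi> (x + t *\<^sub>R z) \<bullet> z) * indicator {0..1} t) = \<phi> (x + z) - \<phi> x"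
    using integral_FTC_Icc_real[OF _ has_real_derivative_along_line[OF assms] c, of 0 1] by simp
qed

lemma nn_integral_lborel_translate:
  fixes f :: "'a::euclidean_space \<Rightarrow> ennreal"
  assumes "f \<in> borel_measurable borel"
  shows "(\<integral>\<^sup>+x. f (x + c) \<partial>lborel) = (\<integral>\<^sup>+x. f x \<partial>lborel)"
proof -
  have "(\<integral>\<^sup>+x. f x \<partial>lborel) = (\<integral>\<^sup>+x. f x \<partial>(distr lborel borel ((+) c)))"
    by (simp only: lborel_distr_plus)
  also have "\<dots> = (\<integral>\<^sup>+x. f (c + x) \<partial>lborel)"
    using assms by (intro nn_integral_distr) auto
  finally show ?thesis by (simp add: add.commute)
qed

lemma integral_lborel_translate:
  fixes f :: "'a::euclidean_space \<Rightarrow> real"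
  assumes "f \<in> borel_measurable borel"
  shows "(LINT x|lborel. f (x + c)) = (LINT x|lborel. f x)"
    and "integrable lborel f \<Longrightarrow> integrable lborel (\<lambda>x. f (x + c))"
proof -
  have "(LINT x|lborel. f x) = (LINT x|distr lborel borel ((+) c). f x)"
    by (simp only: lborel_distr_plus)
  also have "\<dots> = (LINT x|lborel. f (c + x))"
    using assms by (intro integral_distr) auto
  finally show "(LINT x|lborel. f (x + c)) = (LINT x|lborel. f x)" by (simp add: add.commute)
  assume "integrable lborel f"
  then have "integrable (distr lborel borel ((+) c)) f" by (simp only: lborel_distr_plus)
  then have "integrable lborel (\<lambda>x. f (c + x))"
    by (rule integrable_distr[rotated]) auto
  then show "integrable lborel (\<lambda>x. f (x + c))" by (simp add: add.commute)
qed

text \<open>Averaging the partial derivative over a unit segment in its own direction does not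
  change its integral, by Fubini and translation invariance. It turns the integrand into
  \<open>\<phi> (x + e) - \<phi> x\<close>, whose integral vanishes by translation
  invariance.\<close>

lemma integral_partial_derivative:
  assumes \<phi>: "\<phi> \<in> test_functions \<Omega>"
  shows "(LINT x|lborel. partial_derivative i \<phi> x) = 0"
proof -
  let ?e = "axis i 1 :: real^'a" and ?h = "partial_derivative i \<phi>"
  have s: "smooth \<phi>" using \<phi> by (rule test_functions_smooth)
  have h: "?h \<in> test_functions \<Omega>" using \<phi> by (rule test_functions_partial_derivative)
  have [measurable]: "?h \<in> borel_measurable borel" using h by (rule test_functions_borel)
  have inner: "classical_gradient \<phi> y \<bullet> ?e = ?h y" for y by (simp add: inner_axis)
  have int: "integrable (lborel \<Otimes>\<^sub>M lborel) (\<lambda>(t, x). ?h (x + t *\<^sub>R ?e) * indicator {0..1::real} t)"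
  proof (rule lborel_pair.Fubini_integrable)
    have "(LINT y|lborel. norm (?h (y + t *\<^sub>R ?e) * indicator {0..1} t))
        = (LINT y|lborel. \<bar>?h y\<bar>) * indicator {0..1} t" for t :: real
      using integral_lborel_translate(1)[of "\<lambda>y. \<bar>?h y\<bar>" "t *\<^sub>R ?e"]
      by (simp add: abs_mult)
    then show "integrable lborel (\<lambda>t. LINT y|lborel. norm (case (t, y) of (t, x) \<Rightarrow>
        ?h (x + t *\<^sub>R ?e) * indicator {0..1::real} t))" by simp
    show "AE t in lborel. integrable lborel (\<lambda>y. case (t, y) of (t, x) \<Rightarrow>
        ?h (x + t *\<^sub>R ?e) * indicator {0..1::real} t)"
      using integral_lborel_translate(2)[OF _ test_functions_integrable[OF h]] by simp
  qed measurable
  have "(LINT x|lborel. (LINT t|lborel. ?h (x + t *\<^sub>R ?e) * indicator {0..1::real} t))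
      = (LINT t|lborel. (LINT x|lborel. ?h (x + t *\<^sub>R ?e) * indicator {0..1::real} t))"
    using lborel_pair.Fubini_integral[OF int] .
  also have "\<dots> = (LINT t|lborel. (LINT x|lborel. ?h x) * indicator {0..1::real} t)"
    using integral_lborel_translate(1)[of ?h] by simp
  also have "\<dots> = (LINT x|lborel. ?h x)" by simp
  finally have "(LINT x|lborel. ?h x) = (LINT x|lborel. \<phi> (x + ?e) - \<phi> x)"
    using difference_along_line(2)[OF s, of _ ?e] by (simp only: inner)
  also have "\<dots> = (LINT x|lborel. \<phi> (x + ?e)) - (LINT x|lborel. \<phi> x)"
    using integral_lborel_translate(2)[OF test_functions_borel test_functions_integrable] 
      test_functions_integrable \<phi>
    by (intro Bochner_Integration.integral_diff) auto
  also have "\<dots> = 0" using integral_lborel_translate(1)[OF test_functions_borel[OF \<phi>]] by simp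
  finally show ?thesis .
qed

lemma integration_by_parts:
  assumes \<phi>: "\<phi> \<in> test_functions \<Omega>" and \<psi>: "\<psi> \<in> test_functions \<Omega>"
  shows "(LINT x|lborel. \<phi> x * partial_derivative i \<psi> x) = - (LINT x|lborel. partial_derivative i \<phi> x * \<psi> x)"
proof -
  have s: "smooth \<phi>" "smooth \<psi>" using assms test_functions_smooth by blast+
  have "(\<lambda>x. \<phi> x * \<psi> x) \<in> test_functions \<Omega>" using \<phi> s(2) by (rule test_functions_mult)
  then have "(LINT x|lborel. partial_derivative i (\<lambda>x. \<phi> x * \<psi> x) x) = 0"
    by (rule integral_partial_derivative)
  moreover have "partial_derivative i (\<lambda>x. \<phi> x * \<psi> x) x
      = \<phi> x * partial_derivative i \<psi> x + partial_derivative i \<phi> x * \<psi> x" for x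
    using s by (intro partial_derivative_mult smooth_differentiable)
  moreover have "integrable lborel (\<lambda>x. \<phi> x * partial_derivative i \<psi> x)"
    by (rule test_functions_integrable[OF test_functions_mult[OF \<phi> smooth_partial_derivative[OF s(2)]]])
  moreover have "integrable lborel (\<lambda>x. partial_derivative i \<phi> x * \<psi> x)"
    by (rule test_functions_integrable[OF test_functions_mult[OF test_functions_partial_derivative[OF \<phi>] s(2)]])
  ultimately show ?thesis by simp
qed

text \<open>Jensen's inequality for the square, obtained from the nonnegativity of the variance
  about the mean \<open>c\<close>.\<close>

lemma square_mean_le:
  fixes f :: "'a::euclidean_space \<Rightarrow> real"
  assumes A: "A \<in> sets borel" "measure lborel A > 0" "bounded A"
    and f: "f \<in> borel_measurable borel" "\<And>x. x \<in> A \<Longrightarrow> \<bar>f x\<bar> \<le> C"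
  shows "((LINT x|lborel. f x * indicator A x) / measure lborel A)\<^sup>2
      \<le> (LINT x|lborel. (f x)\<^sup>2 * indicator A x) / measure lborel A"
proof -
  let ?m = "measure lborel A"
  have fin: "emeasure lborel A < \<infinity>" using A(3) emeasure_bounded_finite by blast
  define c where "c = (LINT x|lborel. f x * indicator A x) / ?m"
  have [measurable]: "A \<in> sets borel" "f \<in> borel_measurable borel" by fact+
  have iA: "integrable lborel (\<lambda>x. indicator A x :: real)"
    using fin by (intro integrable_real_indicator) auto
  have i: "integrable lborel (\<lambda>x. g x * indicator A x)"
    if "g \<in> borel_measurable borel" "\<And>x. x \<in> A \<Longrightarrow> \<bar>g x\<bar> \<le> D" for g :: "'a \<Rightarrow> real" and D
    by (rule Bochner_Integration.integrable_bound[OF integrable_mult_right[OF iA, of D]])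
       (use that in \<open>auto simp: indicator_def intro: order_trans[OF _ abs_ge_self]\<close>)
  have i1: "integrable lborel (\<lambda>x. f x * indicator A x)" by (rule i[OF f])
  have i2: "integrable lborel (\<lambda>x. (f x)\<^sup>2 * indicator A x)"
  proof (rule i[of _ "C\<^sup>2"])
    show "\<bar>(f x)\<^sup>2\<bar> \<le> C\<^sup>2" if "x \<in> A" for x
      using power_mono[OF f(2)[OF that] abs_ge_zero, of 2] by simp
  qed measurable
  have m: "(LINT x|lborel. indicator A x :: real) = ?m" by simp
  have "0 \<le> (LINT x|lborel. (f x - c)\<^sup>2 * indicator A x)" by simp
  also have "(LINT x|lborel. (f x - c)\<^sup>2 * indicator A x)
      = (LINT x|lborel. (f x)\<^sup>2 * indicator A x - 2 * c * (f x * indicator A x) + c\<^sup>2 * indicator A x)"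
    by (intro Bochner_Integration.integral_cong) (auto simp: power2_eq_square algebra_simps)
  also have "\<dots> = (LINT x|lborel. (f x)\<^sup>2 * indicator A x) - 2 * c * (c * ?m) + c\<^sup>2 * ?m"
    using i1 i2 iA A(2) m by (simp add: c_def)
  finally have "c\<^sup>2 * ?m \<le> (LINT x|lborel. (f x)\<^sup>2 * indicator A x)" by (simp add: power2_eq_square)
  then show ?thesis using A(2) by (simp add: c_def[symmetric] pos_le_divide_eq)
qed

lemma classical_gradient_bounded:
  assumes "\<phi> \<in> test_functions \<Omega>" obtains C where "\<And>x. norm (classical_gradient \<phi> x) \<le> C"
proof -
  have "\<exists>C. \<forall>x. \<bar>partial_derivative i \<phi> x\<bar> \<le> C" for i
    using test_functions_bounded[OF test_functions_partial_derivative[OF assms]] by metis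
  then obtain C where C: "\<And>i x. \<bar>partial_derivative i \<phi> x\<bar> \<le> C i" by metis
  have "norm (classical_gradient \<phi> x) \<le> (\<Sum>i\<in>UNIV. C i)" for x
    by (rule order_trans[OF norm_le_l1_cart]) (auto intro!: sum_mono C)
  then show ?thesis by (rule that)
qed

text \<open>The difference is the mean over the segment of the directional derivative. Jensen bounds
  its square by the mean of the squares, and after Fubini each point of the segment contributes the
  same integral.\<close>

lemma translation_estimate:
  assumes \<phi>: "\<phi> \<in> test_functions \<Omega>"
  shows "(\<integral>\<^sup>+x. ennreal ((\<phi> (x + z) - \<phi> x)\<^sup>2) \<partial>lborel)
      \<le> ennreal ((norm z)\<^sup>2) * (\<integral>\<^sup>+x. ennreal ((norm (classical_gradient \<phi> x))\<^sup>2) \<partial>lborel)"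
proof -
  let ?g = "\<lambda>y. classical_gradient \<phi> y \<bullet> z"
  have s: "smooth \<phi>" using \<phi> by (rule test_functions_smooth)
  have [measurable]: "?g \<in> borel_measurable borel"
    by (intro borel_measurable_continuous_onI continuous_intros continuous_on_classical_gradient s)
  have [measurable]: "classical_gradient \<phi> \<in> borel_measurable borel"
    by (intro borel_measurable_continuous_onI continuous_on_classical_gradient s)
  obtain C where C: "\<And>x. norm (classical_gradient \<phi> x) \<le> C"
    using classical_gradient_bounded[OF \<phi>] by metis
  have gC: "\<bar>?g y\<bar> \<le> C * norm z" for y
    by (rule order_trans[OF Cauchy_Schwarz_ineq2]) (intro mult_right_mono C norm_ge_zero)
  have pt: "ennreal ((\<phi> (x + z) - \<phi> x)\<^sup>2) \<le> (\<integral>\<^sup>+t. ennreal ((?g (x + t *\<^sub>R z))\<^sup>2 * indicator {0..1} t) \<partial>lborel)" for x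
  proof -
    have "((LINT t|lborel. ?g (x + t *\<^sub>R z) * indicator {0..1} t) / measure lborel {0..1::real})\<^sup>2
        \<le> (LINT t|lborel. (?g (x + t *\<^sub>R z))\<^sup>2 * indicator {0..1} t) / measure lborel {0..1::real}"
      by (rule square_mean_le[of _ _ "C * norm z"]) (use gC in auto)
    then have "(\<phi> (x + z) - \<phi> x)\<^sup>2 \<le> (LINT t|lborel. (?g (x + t *\<^sub>R z))\<^sup>2 * indicator {0..1} t)"
      using difference_along_line(2)[OF s] by simp
    also have "ennreal \<dots> = (\<integral>\<^sup>+t. ennreal ((?g (x + t *\<^sub>R z))\<^sup>2 * indicator {0..1} t) \<partial>lborel)"
    proof (rule nn_integral_eq_integral[symmetric])
      have "integrable lborel (\<lambda>t. indicator {0..1::real} t *\<^sub>R (?g (x + t *\<^sub>R z))\<^sup>2)"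
        by (intro borel_integrable_compact continuous_intros
            continuous_on_compose2[OF continuous_on_classical_gradient[OF s, of UNIV]]) auto
      then show "integrable lborel (\<lambda>t. (?g (x + t *\<^sub>R z))\<^sup>2 * indicator {0..1} t)"
        by (simp add: mult.commute)
    qed simp
    finally show ?thesis by (simp add: ennreal_leI)
  qed
  have "(\<integral>\<^sup>+x. ennreal ((\<phi> (x + z) - \<phi> x)\<^sup>2) \<partial>lborel)
      \<le> (\<integral>\<^sup>+x. (\<integral>\<^sup>+t. ennreal ((?g (x + t *\<^sub>R z))\<^sup>2 * indicator {0..1} t) \<partial>lborel) \<partial>lborel)"
    by (intro nn_integral_mono pt)
  also have "\<dots> = (\<integral>\<^sup>+t. (\<integral>\<^sup>+x. ennreal ((?g (x + t *\<^sub>R z))\<^sup>2 * indicator {0..1} t) \<partial>lborel) \<partial>lborel)"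
    by (rule lborel_pair.Fubini') measurable
  also have "\<dots> = (\<integral>\<^sup>+t. (\<integral>\<^sup>+x. ennreal ((?g x)\<^sup>2) \<partial>lborel) * indicator {0..1::real} t \<partial>lborel)"
  proof (rule nn_integral_cong)
    fix t :: real
    have "(\<integral>\<^sup>+x. ennreal ((?g (x + t *\<^sub>R z))\<^sup>2 * indicator {0..1} t) \<partial>lborel)
        = (\<integral>\<^sup>+x. ennreal ((?g (x + t *\<^sub>R z))\<^sup>2) \<partial>lborel) * indicator {0..1} t"
      by (simp split: split_indicator)
    also have "(\<integral>\<^sup>+x. ennreal ((?g (x + t *\<^sub>R z))\<^sup>2) \<partial>lborel) = (\<integral>\<^sup>+x. ennreal ((?g x)\<^sup>2) \<partial>lborel)"
      using nn_integral_lborel_translate[of "\<lambda>x. ennreal ((?g x)\<^sup>2)" "t *\<^sub>R z"] by simp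
    finally show "(\<integral>\<^sup>+x. ennreal ((?g (x + t *\<^sub>R z))\<^sup>2 * indicator {0..1} t) \<partial>lborel)
        = (\<integral>\<^sup>+x. ennreal ((?g x)\<^sup>2) \<partial>lborel) * indicator {0..1} t" .
  qed
  also have "\<dots> = (\<integral>\<^sup>+x. ennreal ((?g x)\<^sup>2) \<partial>lborel)"
    by (simp add: nn_integral_cmult_indicator)
  also have "\<dots> \<le> (\<integral>\<^sup>+x. ennreal ((norm z)\<^sup>2) * ennreal ((norm (classical_gradient \<phi> x))\<^sup>2) \<partial>lborel)"
  proof (intro nn_integral_mono)
    fix x
    have "(?g x)\<^sup>2 \<le> (norm (classical_gradient \<phi> x) * norm z)\<^sup>2"
      using Cauchy_Schwarz_ineq2 by (intro abs_le_square_iff[THEN iffD1]) simp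
    then show "ennreal ((?g x)\<^sup>2) \<le> ennreal ((norm z)\<^sup>2) * ennreal ((norm (classical_gradient \<phi> x))\<^sup>2)"
      by (simp add: ennreal_mult[symmetric] power_mult_distrib mult.commute ennreal_leI)
  qed
  also have "\<dots> = ennreal ((norm z)\<^sup>2) * (\<integral>\<^sup>+x. ennreal ((norm (classical_gradient \<phi> x))\<^sup>2) \<partial>lborel)"
    by (rule nn_integral_cmult) measurable
  finally show ?thesis .
qed

text \<open>A translation that moves \<open>\<Omega>\<close> off itself makes
  \<open>\<phi> (x + z) - \<phi> x\<close> dominate \<open>\<phi> x\<close> pointwise, so the
  translation estimate is already the claim.\<close>

lemma poincare_test_functions:
  fixes \<Omega> :: "(real^'n::finite) set"
  assumes "bounded \<Omega>"
  obtains P where "P > 0" "\<And>\<phi>. \<phi> \<in> test_functions \<Omega> \<Longrightarrow>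
    (\<integral>\<^sup>+x. ennreal ((\<phi> x)\<^sup>2) \<partial>lborel) \<le> ennreal P * (\<integral>\<^sup>+x. ennreal ((norm (classical_gradient \<phi> x))\<^sup>2) \<partial>lborel)"
proof -
  obtain R where R: "R > 0" "\<And>x. x \<in> \<Omega> \<Longrightarrow> norm x \<le> R" using assms by (auto simp: bounded_pos)
  \<comment> \<open>Any length above \<open>2 * R\<close> moves \<open>\<Omega>\<close> off itself,
    in any coordinate direction; hence \<open>undefined\<close> as the index.\<close>
  define z :: "real^'n" where "z = (3 * R) *\<^sub>R axis undefined 1"
  have nz: "norm z = 3 * R" using R(1) by (simp add: z_def)
  show ?thesis
  proof
    show "(norm z)\<^sup>2 > 0" using R nz by simp
    fix \<phi> assume \<phi>: "\<phi> \<in> test_functions \<Omega>"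
    obtain K where K: "K \<subseteq> \<Omega>" "\<And>x. x \<notin> K \<Longrightarrow> \<phi> x = 0"
      using \<phi> by (rule test_functionsE) blast
    have "(\<integral>\<^sup>+x. ennreal ((\<phi> x)\<^sup>2) \<partial>lborel) \<le> (\<integral>\<^sup>+x. ennreal ((\<phi> (x + z) - \<phi> x)\<^sup>2) \<partial>lborel)"
    proof (intro nn_integral_mono ennreal_leI)
      fix x
      show "(\<phi> x)\<^sup>2 \<le> (\<phi> (x + z) - \<phi> x)\<^sup>2"
      proof (cases "x \<in> \<Omega>")
        case True
        have "norm (x + z) \<ge> norm z - norm x" by (metis add.commute norm_diff_ineq)
        then have "x + z \<notin> \<Omega>" using R(2)[OF True] R(1) nz R(2)[of "x + z"] by auto
        then have "\<phi> (x + z) = 0" using K by blast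
        then show ?thesis by simp
      next
        case False
        then have "\<phi> x = 0" using K by blast
        then show ?thesis by simp
      qed
    qed
    also have "\<dots> \<le> ennreal ((norm z)\<^sup>2) * (\<integral>\<^sup>+x. ennreal ((norm (classical_gradient \<phi> x))\<^sup>2) \<partial>lborel)"
      by (rule translation_estimate[OF \<phi>])
    finally show "(\<integral>\<^sup>+x. ennreal ((\<phi> x)\<^sup>2) \<partial>lborel)
        \<le> ennreal ((norm z)\<^sup>2) * (\<integral>\<^sup>+x. ennreal ((norm (classical_gradient \<phi> x))\<^sup>2) \<partial>lborel)" .
  qed
qed

text \<open>The deviation of \<open>\<phi>\<close> from its mean over a ball of radius
  \<open>h\<close> is an average of the differences \<open>\<phi> (x + z) - \<phi> x\<close> with
  \<open>norm z < h\<close>. Jensen and Fubini reduce it to the translation estimate for each single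
  \<open>z\<close>. This is the quantitative core of the compact embedding.\<close>

lemma ball_mean_estimate:
  fixes \<Omega> :: "(real^'n::finite) set"
  assumes \<phi>: "\<phi> \<in> test_functions \<Omega>" and h: "h > 0"
  shows "(\<integral>\<^sup>+x. ennreal (((LINT y|lborel. \<phi> y * indicator (ball x h) y) / measure lborel (ball (0::real^'n::finite) h) - \<phi> x)\<^sup>2) \<partial>lborel)
      \<le> ennreal (h\<^sup>2) * (\<integral>\<^sup>+x. ennreal ((norm (classical_gradient \<phi> x))\<^sup>2) \<partial>lborel)"
proof -
  let ?B = "ball (0::real^'n) h"
  let ?m = "measure lborel ?B"
  let ?D = "\<integral>\<^sup>+x. ennreal ((norm (classical_gradient \<phi> x))\<^sup>2) \<partial>lborel"
  have m: "?m > 0" using h by (simp add: content_ball_pos)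
  have [measurable]: "\<phi> \<in> borel_measurable borel" using \<phi> by (rule test_functions_borel)
  obtain C where C: "\<And>x. \<bar>\<phi> x\<bar> \<le> C" using \<phi> by (rule test_functions_bounded) blast
  have fin: "emeasure lborel ?B < \<infinity>" by (intro emeasure_bounded_finite bounded_ball)
  have pt: "ennreal (((LINT y|lborel. \<phi> y * indicator (ball x h) y) / ?m - \<phi> x)\<^sup>2)
      \<le> (\<integral>\<^sup>+z. ennreal ((\<phi> (x + z) - \<phi> x)\<^sup>2 * (indicator ?B z / ?m)) \<partial>lborel)" for x
  proof -
    have iB: "integrable lborel (\<lambda>z. indicator ?B z :: real)"
      using fin by (intro integrable_real_indicator) auto
    have i: "integrable lborel (\<lambda>z. g z * indicator ?B z)"
      if "g \<in> borel_measurable borel" "\<And>z. \<bar>g z\<bar> \<le> D" for g :: "real^'n \<Rightarrow> real" and D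
      by (rule Bochner_Integration.integrable_bound[OF integrable_mult_right[OF iB, of D]])
         (use that in \<open>auto simp: indicator_def intro: order_trans[OF _ abs_ge_self]\<close>)
    have "(LINT y|lborel. \<phi> y * indicator (ball x h) y) = (LINT z|lborel. \<phi> (z + x) * indicator (ball x h) (z + x))"
      by (intro integral_lborel_translate(1)[symmetric] borel_measurable_times borel_measurable_indicator) auto
    also have "\<dots> = (LINT z|lborel. \<phi> (x + z) * indicator ?B z)"
      by (intro Bochner_Integration.integral_cong) (auto simp: indicator_def dist_norm add.commute)
    finally have e1: "(LINT y|lborel. \<phi> y * indicator (ball x h) y) / ?m - \<phi> x
        = (LINT z|lborel. (\<phi> (x + z) - \<phi> x) * indicator ?B z) / ?m"
      using i[of "\<lambda>z. \<phi> (x + z)" C] i[of "\<lambda>z. \<phi> x" C] C m iB fin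
      by (simp add: left_diff_distrib diff_divide_distrib)
    have "((LINT z|lborel. (\<phi> (x + z) - \<phi> x) * indicator ?B z) / ?m)\<^sup>2
        \<le> (LINT z|lborel. (\<phi> (x + z) - \<phi> x)\<^sup>2 * indicator ?B z) / ?m"
    proof (rule square_mean_le[where C = "2 * C"])
      show "\<bar>\<phi> (x + z) - \<phi> x\<bar> \<le> 2 * C" for z
        using C[of "x + z"] C[of x] by linarith
    qed (use m in auto)
    also have "\<dots> = (LINT z|lborel. (\<phi> (x + z) - \<phi> x)\<^sup>2 * (indicator ?B z / ?m))" by simp
    finally have e2: "((LINT z|lborel. (\<phi> (x + z) - \<phi> x) * indicator ?B z) / ?m)\<^sup>2 \<le>
        (LINT z|lborel. (\<phi> (x + z) - \<phi> x)\<^sup>2 * (indicator ?B z / ?m))" .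
    have e3: "ennreal (LINT z|lborel. (\<phi> (x + z) - \<phi> x)\<^sup>2 * (indicator ?B z / ?m)) = (\<integral>\<^sup>+z. ennreal ((\<phi> (x + z) - \<phi> x)\<^sup>2 * (indicator ?B z / ?m)) \<partial>lborel)"
    proof (rule nn_integral_eq_integral[symmetric])
      have "(\<phi> (x + z) - \<phi> x)\<^sup>2 \<le> (2 * C)\<^sup>2" for z
      proof -
        have "\<bar>\<phi> (x + z) - \<phi> x\<bar> \<le> \<bar>2 * C\<bar>" using C[of "x + z"] C[of x] by linarith
        then show ?thesis by (simp only: abs_le_square_iff)
      qed
      then show "integrable lborel (\<lambda>z. (\<phi> (x + z) - \<phi> x)\<^sup>2 * (indicator ?B z / ?m))"
        using i[of "\<lambda>z. (\<phi> (x + z) - \<phi> x)\<^sup>2" "(2 * C)\<^sup>2"] by simp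
    qed (use m in simp)
    show ?thesis unfolding e1 e3[symmetric] by (rule ennreal_leI[OF e2])
  qed
  have factor: "(\<integral>\<^sup>+z. (\<integral>\<^sup>+x. ennreal ((\<phi> (x + z) - \<phi> x)\<^sup>2 * w z) \<partial>lborel) \<partial>lborel)
      = (\<integral>\<^sup>+z. (\<integral>\<^sup>+x. ennreal ((\<phi> (x + z) - \<phi> x)\<^sup>2) \<partial>lborel) * ennreal (w z) \<partial>lborel)"
    if "\<And>z. 0 \<le> w z" for w :: "real^'n \<Rightarrow> real"
    using that by (simp add: ennreal_mult nn_integral_multc)
  have swap: "(\<integral>\<^sup>+x. (\<integral>\<^sup>+z. ennreal ((\<phi> (x + z) - \<phi> x)\<^sup>2 * w z) \<partial>lborel) \<partial>lborel)
      = (\<integral>\<^sup>+z. (\<integral>\<^sup>+x. ennreal ((\<phi> (x + z) - \<phi> x)\<^sup>2 * w z) \<partial>lborel) \<partial>lborel)"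
    if [measurable]: "w \<in> borel_measurable borel" for w :: "real^'n \<Rightarrow> real"
    by (rule lborel_pair.Fubini') measurable
  have "(\<integral>\<^sup>+x. ennreal (((LINT y|lborel. \<phi> y * indicator (ball x h) y) / ?m - \<phi> x)\<^sup>2) \<partial>lborel)
      \<le> (\<integral>\<^sup>+x. (\<integral>\<^sup>+z. ennreal ((\<phi> (x + z) - \<phi> x)\<^sup>2 * (indicator ?B z / ?m)) \<partial>lborel) \<partial>lborel)"
    by (intro nn_integral_mono pt)
  also have "\<dots> = (\<integral>\<^sup>+z. (\<integral>\<^sup>+x. ennreal ((\<phi> (x + z) - \<phi> x)\<^sup>2 * (indicator ?B z / ?m)) \<partial>lborel) \<partial>lborel)"
    by (rule swap) (intro borel_measurable_divide borel_measurable_indicator, auto)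
  also have "\<dots> = (\<integral>\<^sup>+z. (\<integral>\<^sup>+x. ennreal ((\<phi> (x + z) - \<phi> x)\<^sup>2) \<partial>lborel) * ennreal (indicator ?B z / ?m) \<partial>lborel)"
    by (rule factor) (use m in simp)
  also have "\<dots> \<le> (\<integral>\<^sup>+z. (ennreal (h\<^sup>2) * ?D) * ennreal (indicator ?B z / ?m) \<partial>lborel)"
  proof (rule nn_integral_mono)
    fix z :: "real^'n"
    show "(\<integral>\<^sup>+x. ennreal ((\<phi> (x + z) - \<phi> x)\<^sup>2) \<partial>lborel) * ennreal (indicator ?B z / ?m)
        \<le> (ennreal (h\<^sup>2) * ?D) * ennreal (indicator ?B z / ?m)"
    proof (cases "z \<in> ?B")
      case True
      then have "ennreal ((norm z)\<^sup>2) \<le> ennreal (h\<^sup>2)" by (intro ennreal_leI power_mono) auto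
      then have "ennreal ((norm z)\<^sup>2) * ?D \<le> ennreal (h\<^sup>2) * ?D" by (rule mult_right_mono) simp
      with translation_estimate[OF \<phi>] have "(\<integral>\<^sup>+x. ennreal ((\<phi> (x + z) - \<phi> x)\<^sup>2) \<partial>lborel) \<le> ennreal (h\<^sup>2) * ?D"
        by (rule order_trans)
      then show ?thesis by (rule mult_right_mono) simp
    qed simp
  qed
  also have "\<dots> = (ennreal (h\<^sup>2) * ?D) * (\<integral>\<^sup>+z. ennreal (indicator ?B z / ?m) \<partial>lborel)"
    by (intro nn_integral_cmult measurable_compose[OF _ measurable_ennreal] borel_measurable_divide
        borel_measurable_indicator) auto
  also have "(\<integral>\<^sup>+z. ennreal (indicator ?B z / ?m) \<partial>lborel) = 1"
  proof -
    have "(\<integral>\<^sup>+z. ennreal (indicator ?B z / ?m) \<partial>lborel) = (\<integral>\<^sup>+z. ennreal (1 / ?m) * indicator ?B z \<partial>lborel)"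
      by (intro nn_integral_cong) (simp split: split_indicator)
    also have "\<dots> = ennreal (1 / ?m) * emeasure lborel ?B" by (rule nn_integral_cmult_indicator) simp
    also have "emeasure lborel ?B = ennreal ?m" using fin by (intro emeasure_eq_ennreal_measure) auto
    also have "ennreal (1 / ?m) * ennreal ?m = 1" using m by (simp add: ennreal_mult[symmetric])
    finally show ?thesis .
  qed
  finally show ?thesis by simp
qed

section \<open>Sobolev functions as elements of a Hilbert space\<close>

definition l2_on :: "'a::euclidean_space set \<Rightarrow> ('a \<Rightarrow> 'b::euclidean_space) \<Rightarrow> ('a, 'b) l2" where
  "l2_on \<Omega> u = l2_of (\<lambda>x. indicator \<Omega> x *\<^sub>R u x)"

lemma AE_lebesgue_on_iff:
  "\<Omega> \<in> sets lebesgue \<Longrightarrow> (AE x in lebesgue_on \<Omega>. P x) \<longleftrightarrow> (AE x in lebesgue. x \<in> \<Omega> \<longrightarrow> P x)"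
  by (rule AE_restrict_space_iff) simp

lemma integral_lebesgue_on_eq:
  fixes f :: "'a::euclidean_space \<Rightarrow> 'b::{banach, second_countable_topology}"
  assumes "\<Omega> \<in> sets lebesgue"
  shows "(LINT x|lebesgue_on \<Omega>. f x) = (LINT x|lebesgue. indicator \<Omega> x *\<^sub>R f x)"
  using assms by (intro integral_restrict_space) simp

lemma space_L2_iff:
  fixes u :: "'a::euclidean_space \<Rightarrow> 'b::euclidean_space"
  assumes "\<Omega> \<in> sets lebesgue"
  shows "u \<in> space_L2 \<Omega> \<longleftrightarrow> square_integrable (\<lambda>x. indicator \<Omega> x *\<^sub>R u x)"
proof -
  have "(\<lambda>x. indicator \<Omega> x *\<^sub>R (norm (u x))\<^sup>2) = (\<lambda>x. (norm (indicator \<Omega> x *\<^sub>R u x))\<^sup>2)"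
    by (auto simp: indicator_def fun_eq_iff)
  then show ?thesis
    using assms by (simp add: space_L2_def square_integrable_def borel_measurable_restrict_space_iff
      integrable_restrict_space)
qed

context
  fixes \<Omega> :: "'a::euclidean_space set"
  assumes meas: "\<Omega> \<in> sets lebesgue"
begin

lemma space_L2_add:
  fixes u v :: "'a \<Rightarrow> 'b::euclidean_space"
  assumes "u \<in> space_L2 \<Omega>" "v \<in> space_L2 \<Omega>" shows "(\<lambda>x. u x + v x) \<in> space_L2 \<Omega>"
  using square_integrable_add[OF assms[unfolded space_L2_iff[OF meas]]]
  by (simp add: space_L2_iff[OF meas] scaleR_add_right)

lemma space_L2_diff:
  fixes u v :: "'a \<Rightarrow> 'b::euclidean_space"
  assumes "u \<in> space_L2 \<Omega>" "v \<in> space_L2 \<Omega>" shows "(\<lambda>x. u x - v x) \<in> space_L2 \<Omega>"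
  using square_integrable_diff[OF assms[unfolded space_L2_iff[OF meas]]]
  by (simp add: space_L2_iff[OF meas] scaleR_diff_right)

lemma space_L2_scaleR:
  fixes u :: "'a \<Rightarrow> 'b::euclidean_space"
  assumes "u \<in> space_L2 \<Omega>" shows "(\<lambda>x. c *\<^sub>R u x) \<in> space_L2 \<Omega>"
  using square_integrable_scaleR[OF assms[unfolded space_L2_iff[OF meas]], of c]
  by (simp add: space_L2_iff[OF meas] mult.commute)

lemma l2_on_add:
  fixes u v :: "'a \<Rightarrow> 'b::euclidean_space"
  assumes "u \<in> space_L2 \<Omega>" "v \<in> space_L2 \<Omega>" shows "l2_on \<Omega> (\<lambda>x. u x + v x) = l2_on \<Omega> u + l2_on \<Omega> v"
  using l2_of_add[OF assms[unfolded space_L2_iff[OF meas]]]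
  by (simp add: l2_on_def scaleR_add_right)

lemma l2_on_diff:
  fixes u v :: "'a \<Rightarrow> 'b::euclidean_space"
  assumes "u \<in> space_L2 \<Omega>" "v \<in> space_L2 \<Omega>" shows "l2_on \<Omega> (\<lambda>x. u x - v x) = l2_on \<Omega> u - l2_on \<Omega> v"
  using l2_of_diff[OF assms[unfolded space_L2_iff[OF meas]]]
  by (simp add: l2_on_def scaleR_diff_right)

lemma l2_on_scaleR:
  fixes u :: "'a \<Rightarrow> 'b::euclidean_space"
  assumes "u \<in> space_L2 \<Omega>" shows "l2_on \<Omega> (\<lambda>x. c *\<^sub>R u x) = c *\<^sub>R l2_on \<Omega> u"
  using l2_of_scaleR[OF assms[unfolded space_L2_iff[OF meas]], of c]
  by (simp add: l2_on_def mult.commute)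

lemma l2_on_eq_iff:
  fixes u v :: "'a \<Rightarrow> 'b::euclidean_space"
  assumes "u \<in> space_L2 \<Omega>" "v \<in> space_L2 \<Omega>"
  shows "l2_on \<Omega> u = l2_on \<Omega> v \<longleftrightarrow> (AE x in lebesgue_on \<Omega>. u x = v x)"
proof -
  have "l2_on \<Omega> u = l2_on \<Omega> v \<longleftrightarrow> (AE x in lebesgue. indicator \<Omega> x *\<^sub>R u x = indicator \<Omega> x *\<^sub>R v x)"
    unfolding l2_on_def by (rule l2_of_eq_iff[OF assms[unfolded space_L2_iff[OF meas]]])
  also have "\<dots> \<longleftrightarrow> (AE x in lebesgue. x \<in> \<Omega> \<longrightarrow> u x = v x)"
    by (intro AE_cong) (auto simp: indicator_def)
  finally show ?thesis by (simp add: AE_lebesgue_on_iff[OF meas])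
qed

lemma integrable_inner_space_L2:
  fixes u v :: "'a \<Rightarrow> 'b::euclidean_space"
  assumes "u \<in> space_L2 \<Omega>" "v \<in> space_L2 \<Omega>"
  shows "integrable (lebesgue_on \<Omega>) (\<lambda>x. u x \<bullet> v x)"
  using assms unfolding space_L2_def by (intro integrable_inner_of_squares) auto

lemma inner_l2_on:
  fixes u v :: "'a \<Rightarrow> 'b::euclidean_space"
  assumes "u \<in> space_L2 \<Omega>" "v \<in> space_L2 \<Omega>"
  shows "l2_on \<Omega> u \<bullet> l2_on \<Omega> v = (LINT x|lebesgue_on \<Omega>. u x \<bullet> v x)"
proof -
  have "l2_on \<Omega> u \<bullet> l2_on \<Omega> v = (LINT x|lebesgue. (indicator \<Omega> x *\<^sub>R u x) \<bullet> (indicator \<Omega> x *\<^sub>R v x))"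
    unfolding l2_on_def by (rule inner_l2_of[OF assms[unfolded space_L2_iff[OF meas]]])
  also have "\<dots> = (LINT x|lebesgue. indicator \<Omega> x *\<^sub>R (u x \<bullet> v x))"
    by (intro Bochner_Integration.integral_cong) (auto simp: indicator_def)
  finally show ?thesis by (simp only: integral_lebesgue_on_eq[OF meas])
qed

lemma norm_l2_on:
  fixes u :: "'a \<Rightarrow> 'b::euclidean_space"
  assumes "u \<in> space_L2 \<Omega>"
  shows "(norm (l2_on \<Omega> u))\<^sup>2 = (LINT x|lebesgue_on \<Omega>. (norm (u x))\<^sup>2)"
  using assms by (simp add: power2_norm_eq_inner inner_l2_on)

text \<open>Multiplying a representative of the limit by the indicator of \<open>\<Omega>\<close>
  cannot increase its distance to functions that vanish outside \<open>\<Omega>\<close>. The result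
  is therefore also a limit of the sequence, and limits are unique.\<close>

lemma l2_on_surj:
  fixes U :: "('a, 'b::euclidean_space) l2"
  assumes "\<And>k. \<phi> k \<in> space_L2 \<Omega>" "(\<lambda>k. l2_on \<Omega> (\<phi> k)) \<longlonglongrightarrow> U"
  obtains u where "u \<in> space_L2 \<Omega>" "l2_on \<Omega> u = U"
proof -
  obtain f where f: "square_integrable f" "U = l2_of f" by (rule l2_cases)
  have [measurable]: "f \<in> borel_measurable lebesgue" "\<Omega> \<in> sets lebesgue"
    using f(1) meas by (auto simp: square_integrable_def)
  have fO: "f \<in> space_L2 \<Omega>"
    unfolding space_L2_iff[OF meas] square_integrable_def
  proof (intro conjI)
    have "integrable lebesgue (\<lambda>x. indicator \<Omega> x *\<^sub>R (norm (f x))\<^sup>2)"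
      using f(1) meas by (intro integrable_mult_indicator) (auto simp: square_integrable_def)
    moreover have "(\<lambda>x. indicator \<Omega> x *\<^sub>R (norm (f x))\<^sup>2) = (\<lambda>x. (norm (indicator \<Omega> x *\<^sub>R f x))\<^sup>2)"
      by (auto simp: indicator_def fun_eq_iff)
    ultimately show "integrable lebesgue (\<lambda>x. (norm (indicator \<Omega> x *\<^sub>R f x))\<^sup>2)" by simp
  qed measurable
  have "norm (l2_on \<Omega> (\<phi> k) - l2_on \<Omega> f) \<le> norm (l2_on \<Omega> (\<phi> k) - U)" for k
  proof (rule power2_le_imp_le)
    let ?a = "\<lambda>x. indicator \<Omega> x *\<^sub>R \<phi> k x" and ?b = "\<lambda>x. indicator \<Omega> x *\<^sub>R f x"
    have a: "square_integrable ?a" and b: "square_integrable ?b"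
      using assms(1)[of k] fO by (simp_all add: space_L2_iff[OF meas])
    have "(norm (l2_on \<Omega> (\<phi> k) - l2_on \<Omega> f))\<^sup>2 = (LINT x|lebesgue. (norm (?a x - ?b x))\<^sup>2)"
      unfolding l2_on_def l2_of_diff[OF a b, symmetric] by (rule norm_l2_of[OF square_integrable_diff[OF a b]])
    also have "\<dots> \<le> (LINT x|lebesgue. (norm (?a x - f x))\<^sup>2)"
    proof (rule integral_mono)
      show "integrable lebesgue (\<lambda>x. (norm (?a x - ?b x))\<^sup>2)"
        using square_integrable_diff[OF a b] by (simp add: square_integrable_def)
      show "integrable lebesgue (\<lambda>x. (norm (?a x - f x))\<^sup>2)"
        using square_integrable_diff[OF a f(1)] by (simp add: square_integrable_def)
    qed (auto simp: indicator_def)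
    also have "\<dots> = (norm (l2_on \<Omega> (\<phi> k) - U))\<^sup>2"
      unfolding l2_on_def f(2) l2_of_diff[OF a f(1), symmetric]
      by (rule norm_l2_of[OF square_integrable_diff[OF a f(1)], symmetric])
    finally show "(norm (l2_on \<Omega> (\<phi> k) - l2_on \<Omega> f))\<^sup>2 \<le> (norm (l2_on \<Omega> (\<phi> k) - U))\<^sup>2" .
  qed simp
  moreover have "(\<lambda>k. norm (l2_on \<Omega> (\<phi> k) - U)) \<longlonglongrightarrow> 0"
    using assms(2) by (intro tendsto_norm_zero LIM_zero)
  ultimately have "(\<lambda>k. l2_on \<Omega> (\<phi> k) - l2_on \<Omega> f) \<longlonglongrightarrow> 0"
    by (intro Lim_null_comparison[where f = "\<lambda>k. l2_on \<Omega> (\<phi> k) - l2_on \<Omega> f" and g = "\<lambda>k. norm (l2_on \<Omega> (\<phi> k) - U)"]) simp_all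
  then have "(\<lambda>k. l2_on \<Omega> (\<phi> k)) \<longlonglongrightarrow> l2_on \<Omega> f" by (rule LIM_zero_cancel)
  then have "l2_on \<Omega> f = U" using assms(2) by (rule LIMSEQ_unique)
  then show ?thesis using that fO by blast
qed

end

section \<open>Weak gradients and Sobolev spaces on a bounded open set\<close>

locale bounded_open_set =
  fixes \<Omega> :: "(real^'n::finite) set"
  assumes bounded_domain: "bounded \<Omega>" and open_domain: "open \<Omega>"
begin

abbreviation \<mu> :: "(real^'n) measure" where "\<mu> \<equiv> lebesgue_on \<Omega>"

lemma domain_borel [measurable]: "\<Omega> \<in> sets borel"
  using open_domain by simp

lemma domain_lebesgue [measurable]: "\<Omega> \<in> sets lebesgue"
  by (intro sets_completionI_sets) simp

lemma finite_measure_domain: "finite_measure \<mu>"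
proof
  have "emeasure lborel \<Omega> < \<infinity>" using bounded_domain by (rule emeasure_bounded_finite)
  then show "emeasure \<mu> (space \<mu>) \<noteq> \<infinity>"
    by (simp add: emeasure_restrict_space)
qed

sublocale domain: finite_measure "\<mu>"
  by (rule finite_measure_domain)

lemma space_L2_integrable:
  fixes u :: "real^'n \<Rightarrow> 'b::euclidean_space"
  assumes "u \<in> space_L2 \<Omega>" shows "integrable \<mu> u"
proof (rule Bochner_Integration.integrable_bound)
  show "integrable \<mu> (\<lambda>x. 1 + (norm (u x))\<^sup>2)"
    using assms by (auto simp: space_L2_def)
  have "norm a \<le> 1 + (norm a)\<^sup>2" for a :: 'b
    using sum_squares_bound[of "norm a" 1] norm_ge_zero[of a] unfolding power_one mult_1_right by linarith
  then show "AE x in \<mu>. norm (u x) \<le> norm (1 + (norm (u x))\<^sup>2)" by simp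
qed (use assms in \<open>simp add: space_L2_def\<close>)

lemma space_L2_bounded:
  assumes [measurable]: "u \<in> borel_measurable \<mu>" and b: "AE x in \<mu>. norm (u x) \<le> C"
  shows "u \<in> space_L2 \<Omega>"
  unfolding space_L2_def
proof (intro CollectI conjI assms Bochner_Integration.integrable_bound[OF domain.integrable_const[of "C\<^sup>2"]])
  show "AE x in \<mu>. norm ((norm (u x))\<^sup>2) \<le> norm (C\<^sup>2)"
    using b by eventually_elim (simp add: power_mono)
qed measurable

lemma borel_measurable_domain:
  fixes h :: "real^'n \<Rightarrow> 'b::real_normed_vector"
  assumes "h \<in> borel_measurable borel" shows "h \<in> borel_measurable \<mu>"
  using assms by (intro measurable_restrict_space1 measurable_completion) simp

lemma integral_domain_eq_lborel:
  fixes h :: "real^'n \<Rightarrow> real"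
  assumes "h \<in> borel_measurable borel" "\<And>x. x \<notin> \<Omega> \<Longrightarrow> h x = 0"
  shows "(LINT x|\<mu>. h x) = (LINT x|lborel. h x)"
proof -
  have "(\<lambda>x. indicator \<Omega> x *\<^sub>R h x) = h" using assms(2) by (auto simp: indicator_def fun_eq_iff)
  then have "(LINT x|\<mu>. h x) = (LINT x|lebesgue. h x)"
    by (simp add: integral_lebesgue_on_eq)
  also have "\<dots> = (LINT x|lborel. h x)" using assms(1) by (intro integral_completion) simp
  finally show ?thesis .
qed

lemma test_function_outside: "\<phi> \<in> test_functions \<Omega> \<Longrightarrow> x \<notin> \<Omega> \<Longrightarrow> \<phi> x = 0"
  by (rule test_functionsE) auto

lemma test_function_L2: 
  assumes "\<phi> \<in> test_functions \<Omega>" shows "\<phi> \<in> space_L2 \<Omega>"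
proof -
  obtain C where "\<And>x. \<bar>\<phi> x\<bar> \<le> C" using test_functions_bounded[OF assms] by metis
  then show ?thesis
    using test_functions_borel[OF assms] by (intro space_L2_bounded[of _ C] borel_measurable_domain) auto
qed

lemma classical_gradient_L2:
  assumes "\<phi> \<in> test_functions \<Omega>" shows "classical_gradient \<phi> \<in> space_L2 \<Omega>"
proof -
  obtain C where "\<And>x. norm (classical_gradient \<phi> x) \<le> C"
    using classical_gradient_bounded[OF assms] by metis
  then show ?thesis
    by (intro space_L2_bounded[of _ C] borel_measurable_domain borel_measurable_continuous_onI
        continuous_on_classical_gradient test_functions_smooth[OF assms]) auto
qed

lemma is_weak_gradient_classical:
  assumes \<phi>: "\<phi> \<in> test_functions \<Omega>" shows "is_weak_gradient \<Omega> \<phi> (classical_gradient \<phi>)"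
  unfolding is_weak_gradient_def
proof (intro ballI allI)
  fix \<psi> i assume \<psi>: "\<psi> \<in> test_functions \<Omega>"
  have "(LINT x|\<mu>. \<phi> x * partial_derivative i \<psi> x) = (LINT x|lborel. \<phi> x * partial_derivative i \<psi> x)"
    using \<phi> test_functions_partial_derivative[OF \<psi>]
    by (intro integral_domain_eq_lborel borel_measurable_times test_functions_borel) (auto simp: test_function_outside)
  also have "\<dots> = - (LINT x|lborel. partial_derivative i \<phi> x * \<psi> x)"
    by (rule integration_by_parts[OF \<phi> \<psi>])
  also have "(LINT x|lborel. partial_derivative i \<phi> x * \<psi> x) = (LINT x|\<mu>. partial_derivative i \<phi> x * \<psi> x)"
    using \<psi> test_functions_partial_derivative[OF \<phi>]
    by (intro integral_domain_eq_lborel[symmetric] borel_measurable_times) (auto simp: test_function_outside intro: test_functions_borel)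
  finally show "(LINT x|\<mu>. \<phi> x * partial_derivative i \<psi> x)
      = - (LINT x|\<mu>. classical_gradient \<phi> x $ i * \<psi> x)" by simp
qed

text \<open>The fundamental lemma of the calculus of variations. Box bumps give vanishing integrals
  over all small boxes, a Dynkin argument extends this to Borel subsets of a box, and countably many
  boxes cover \<open>\<Omega>\<close>.\<close>

lemma fundamental_lemma:
  fixes g :: "real^'n \<Rightarrow> real"
  assumes g: "integrable \<mu> g"
    and orth: "\<And>\<psi>. \<psi> \<in> test_functions \<Omega> \<Longrightarrow> (LINT x|\<mu>. g x * \<psi> x) = 0"
  shows "AE x in \<mu>. g x = 0"
proof -
  define G where "G x = indicator \<Omega> x * g x" for x
  have Gl: "integrable lebesgue G"
    using g by (simp add: integrable_restrict_space G_def[abs_def])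
  \<comment> \<open>\<open>g\<close> is only Lebesgue measurable; a Borel representative is needed
    because boxes generate the Borel sets.\<close>
  then obtain G' where G'[measurable]: "G' \<in> borel_measurable lborel" and eq: "AE x in lborel. G x = G' x"
    using completion_ex_borel_measurable_real[of G lborel] borel_measurable_integrable by blast
  have eql: "AE x in lebesgue. G x = G' x" using eq by (rule AE_completion)
  have "integrable lebesgue G'"
    using Gl eql G' by (subst integrable_cong_AE[where g = G]) (auto intro: measurable_completion borel_measurable_integrable)
  then have iG': "integrable lborel G'" using integrable_completion[OF G'] by simp
  have box0: "(LINT x|lborel. indicator (box a b) x *\<^sub>R G' x) = 0" if ab: "cbox a b \<subseteq> \<Omega>" for a b
  proof -
    have [measurable]: "g \<in> borel_measurable \<mu>" using g by simp
    have [measurable]: "box_bump a b k \<in> borel_measurable \<mu>" for k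
      by (rule borel_measurable_domain[OF test_functions_borel[OF box_bump_test_function[OF ab]]])
    have [measurable]: "(indicator (box a b) :: _ \<Rightarrow> real) \<in> borel_measurable \<mu>"
      by (intro borel_measurable_domain borel_measurable_indicator) simp
    have "(\<lambda>k. LINT x|\<mu>. g x * box_bump a b k x) \<longlonglongrightarrow> (LINT x|\<mu>. g x * indicator (box a b) x)"
    proof (rule integral_dominated_convergence[where w = "\<lambda>x. \<bar>g x\<bar>"])
      show "AE x in \<mu>. (\<lambda>k. g x * box_bump a b k x) \<longlonglongrightarrow> g x * indicator (box a b) x"
        by (intro AE_I2 tendsto_mult_left box_bump_tendsto)
      show "AE x in \<mu>. norm (g x * box_bump a b k x) \<le> \<bar>g x\<bar>" for k
        using box_bump_bounds[of a b k] by (intro AE_I2) (simp add: abs_mult mult_left_le)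
    qed (use g in simp_all)
    moreover have "(LINT x|\<mu>. g x * box_bump a b k x) = 0" for k
      by (rule orth[OF box_bump_test_function[OF ab]])
    ultimately have "(LINT x|\<mu>. g x * indicator (box a b) x) = 0"
      by (simp add: LIMSEQ_const_iff)
    then have "(LINT x|lebesgue. indicator (box a b) x *\<^sub>R G x) = 0"
      by (simp add: integral_lebesgue_on_eq G_def mult_ac)
    also have "(LINT x|lebesgue. indicator (box a b) x *\<^sub>R G x) = (LINT x|lebesgue. indicator (box a b) x *\<^sub>R G' x)"
    proof (rule integral_cong_AE)
      show "AE x in lebesgue. indicator (box a b) x *\<^sub>R G x = indicator (box a b) x *\<^sub>R G' x"
        using eql by eventually_elim simp
      have [measurable]: "G \<in> borel_measurable lebesgue" "G' \<in> borel_measurable lebesgue"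
        using Gl G' by (auto intro: measurable_completion)
      have [measurable]: "box a b \<in> sets lebesgue" by (intro sets_completionI_sets) simp
      show "(\<lambda>x. indicator (box a b) x *\<^sub>R G x) \<in> borel_measurable lebesgue"
        "(\<lambda>x. indicator (box a b) x *\<^sub>R G' x) \<in> borel_measurable lebesgue" by measurable
    qed
    also have "\<dots> = (LINT x|lborel. indicator (box a b) x *\<^sub>R G' x)"
      by (rule integral_completion) measurable
    finally show ?thesis .
  qed
  have set0: "(LINT x:A|lborel. indicator (box a b) x *\<^sub>R G' x) = 0"
    if ab: "cbox a b \<subseteq> \<Omega>" and A: "A \<in> sets borel" for a b A
  proof -
    define H where "H x = indicator (box a b) x *\<^sub>R G' x" for x
    have iH: "integrable lborel H" unfolding H_def by (intro integrable_mult_indicator iG') simp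
    have sH: "set_integrable lborel B H" if "B \<in> sets borel" for B
      unfolding set_integrable_def using iH that by (intro integrable_mult_indicator) auto
    have stable: "Int_stable (range (\<lambda>(a, b). box a b :: (real^'n) set))"
      by (auto simp: Int_stable_def box_Int_box)
    have "A \<in> sigma_sets UNIV (range (\<lambda>(a, b). box a b :: (real^'n) set))"
      using A by (simp add: borel_eq_box)
    \<comment> \<open>Boxes are stable under intersection and generate the Borel sets, so it
      suffices to treat boxes, complements and disjoint unions.\<close>
    then show ?thesis unfolding H_def[symmetric]
    proof (rule sigma_sets_induct_disjoint[OF stable, rotated])
      show "range (\<lambda>(a, b). box a b :: (real^'n) set) \<subseteq> Pow UNIV" by simp
    next
      fix B assume "B \<in> range (\<lambda>(a, b). box a b :: (real^'n) set)"
      then obtain c d where B: "B = box c d" by auto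
      obtain a' b' where ab': "box a b \<inter> box c d = box a' b'" by (auto simp: box_Int_box)
      show "(LINT x:B|lborel. H x) = 0"
      proof (cases "box a' b' = {}")
        case True
        then have "indicator B x *\<^sub>R H x = 0" for x
          using ab' by (auto simp: H_def B indicator_def)
        then show ?thesis unfolding set_lebesgue_integral_def by (simp only: integral_zero)
      next
        case False
        \<comment> \<open>Nonemptiness enters here: it makes \<open>cbox a' b'\<close> the closure
          of \<open>box a' b'\<close>, which keeps it inside \<open>\<Omega>\<close>.\<close>
        have "cbox a' b' \<subseteq> cbox a b"
          using False ab' closure_mono[of "box a' b'" "box a b"] by (metis Int_lower1 closure_box inf.orderE inf_bot_right)
        then have "(LINT x|lborel. indicator (box a' b') x *\<^sub>R G' x) = 0" using ab by (intro box0) auto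
        moreover have "(LINT x:B|lborel. H x) = (LINT x|lborel. indicator (box a' b') x *\<^sub>R G' x)"
          unfolding set_lebesgue_integral_def ab'[symmetric] H_def B
          by (intro Bochner_Integration.integral_cong) (auto simp: indicator_def)
        ultimately show ?thesis by simp
      qed
    next
      show "(LINT x:{}|lborel. H x) = 0" by (simp add: set_lebesgue_integral_def)
    next
      fix B assume compl: "B \<in> sigma_sets UNIV (range (\<lambda>(a, b). box a b :: (real^'n) set))" "(LINT x:B|lborel. H x) = 0"
      then have B: "B \<in> sets borel" by (simp add: borel_eq_box)
      have "(LINT x:(UNIV - B)|lborel. H x) = (LINT x|lborel. H x - indicator B x *\<^sub>R H x)"
        unfolding set_lebesgue_integral_def
        by (intro Bochner_Integration.integral_cong) (auto simp: indicator_def)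
      also have "\<dots> = (LINT x|lborel. H x) - (LINT x:B|lborel. H x)"
        unfolding set_lebesgue_integral_def using sH[OF B] iH
        by (intro Bochner_Integration.integral_diff) (auto simp: set_integrable_def)
      also have "\<dots> = 0" using compl box0[OF ab] by (simp add: H_def)
      finally show "(LINT x:(UNIV - B)|lborel. H x) = 0" .
    next
      fix B :: "nat \<Rightarrow> (real^'n) set"
      assume union: "disjoint_family B" "range B \<subseteq> sigma_sets UNIV (range (\<lambda>(a, b). box a b :: (real^'n) set))"
        "\<And>i. (LINT x:B i|lborel. H x) = 0"
      then have B: "B i \<in> sets borel" for i by (auto simp: borel_eq_box)
      have "(LINT x:(\<Union>i. B i)|lborel. H x) = (\<Sum>i. (LINT x:(B i)|lborel. H x))"
        using union(1) B by (intro lebesgue_integral_countable_add sH) (auto simp: disjoint_family_on_def)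
      then show "(LINT x:(\<Union>i. B i)|lborel. H x) = 0" using union by simp
    qed
  qed
  have boxAE: "AE x in lborel. x \<in> box a b \<longrightarrow> G' x = 0" if ab: "cbox a b \<subseteq> \<Omega>" for a b
  proof -
    have "AE x in lborel. indicator (box a b) x *\<^sub>R G' x = 0"
    proof (rule sigma_finite_measure.density_zero[OF sigma_finite_lborel])
      show "integrable lborel (\<lambda>x. indicator (box a b) x *\<^sub>R G' x)"
        by (intro integrable_mult_indicator iG') simp
      show "(LINT x:A|lborel. indicator (box a b) x *\<^sub>R G' x) = 0" if "A \<in> sets lborel" for A
        using set0[OF ab] that by simp
    qed
    then show ?thesis by eventually_elim auto
  qed
  define \<F> where "\<F> = {box a b |a b. cbox a b \<subseteq> \<Omega>}"
  \<comment> \<open>Countability of the cover is what lets the exceptional null sets be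
    united.\<close>
  obtain \<F>' where F': "\<F>' \<subseteq> \<F>" "countable \<F>'" "\<Union>\<F>' = \<Union>\<F>"
    by (rule Lindelof[of \<F>]) (auto simp: \<F>_def)
  have "\<Omega> \<subseteq> \<Union>\<F>"
  proof
    fix x assume "x \<in> \<Omega>"
    then obtain a b where "cbox a b \<subseteq> \<Omega>" "x \<in> box a b" by (rule open_contains_cbox[OF open_domain])
    then show "x \<in> \<Union>\<F>" by (auto simp: \<F>_def)
  qed
  moreover have "AE x in lborel. \<forall>B\<in>\<F>'. x \<in> B \<longrightarrow> G' x = 0"
    using F' boxAE by (subst AE_ball_countable) (auto simp: \<F>_def)
  ultimately have "AE x in lborel. x \<in> \<Omega> \<longrightarrow> G' x = 0"
    using F'(3) by (elim AE_mp) (auto intro!: AE_I2)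
  then have "AE x in lebesgue. x \<in> \<Omega> \<longrightarrow> G' x = 0" by (rule AE_completion)
  with eql have "AE x in lebesgue. x \<in> \<Omega> \<longrightarrow> g x = 0"
    by eventually_elim (auto simp: G_def)
  then show ?thesis by (simp add: AE_lebesgue_on_iff)
qed

text \<open>The inner product of a vector field with this function is the integral of its
  \<open>i\<close>-th component against \<open>\<psi>\<close>, which expresses weak derivatives as
  L2 pairings.\<close>

lemma test_function_axis_L2:
  assumes "\<psi> \<in> test_functions \<Omega>" shows "(\<lambda>x. \<psi> x *\<^sub>R axis i 1 :: real^'n) \<in> space_L2 \<Omega>"
proof -
  obtain C where "\<And>x. \<bar>\<psi> x\<bar> \<le> C" using test_functions_bounded[OF assms] by metis
  then show ?thesis
    using test_functions_borel[OF assms]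
    by (intro space_L2_bounded[of _ C] borel_measurable_domain borel_measurable_scaleR) auto
qed

lemma weak_gradient_AE_unique:
  assumes "is_weak_gradient \<Omega> u G" "is_weak_gradient \<Omega> u G'" and L2: "G \<in> space_L2 \<Omega>" "G' \<in> space_L2 \<Omega>"
  shows "AE x in \<mu>. G x = G' x"
proof -
  have "AE x in \<mu>. \<forall>i\<in>UNIV. G x $ i - G' x $ i = 0"
  proof (subst AE_ball_countable, simp, intro ballI)
    fix i :: 'n
    have i: "integrable \<mu> (\<lambda>x. H x $ i)" if "H \<in> space_L2 \<Omega>" for H :: "real^'n \<Rightarrow> real^'n"
      by (rule integrable_bounded_linear[OF bounded_linear_vec_nth space_L2_integrable[OF that]])
    have i\<psi>: "integrable \<mu> (\<lambda>x. H x $ i * \<psi> x)"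
      if "H \<in> space_L2 \<Omega>" "\<psi> \<in> test_functions \<Omega>" for H :: "real^'n \<Rightarrow> real^'n" and \<psi>
      using integrable_inner_space_L2[OF domain_lebesgue that(1) test_function_axis_L2[OF that(2), of i]]
      by (simp add: inner_axis mult.commute)
    show "AE x in \<mu>. G x $ i - G' x $ i = 0"
    proof (rule fundamental_lemma)
      show "integrable \<mu> (\<lambda>x. G x $ i - G' x $ i)"
        using i L2 by (intro Bochner_Integration.integrable_diff)
      fix \<psi> assume \<psi>: "\<psi> \<in> test_functions \<Omega>"
      have "(LINT x|\<mu>. G x $ i * \<psi> x) = (LINT x|\<mu>. G' x $ i * \<psi> x)"
        using assms(1)[unfolded is_weak_gradient_def, rule_format, OF \<psi>, of i]
          assms(2)[unfolded is_weak_gradient_def, rule_format, OF \<psi>, of i] by linarith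
      then show "(LINT x|\<mu>. (G x $ i - G' x $ i) * \<psi> x) = 0"
        using i\<psi>[OF L2(1) \<psi>] i\<psi>[OF L2(2) \<psi>] by (simp add: left_diff_distrib)
    qed
  qed
  then show ?thesis by eventually_elim (simp add: vec_eq_iff)
qed

lemma W12_L2: "u \<in> W12 \<Omega> \<Longrightarrow> u \<in> space_L2 \<Omega>"
  by (simp add: W12_def)

lemma weak_gradient_props:
  assumes "u \<in> W12 \<Omega>"
  shows "weak_gradient \<Omega> u \<in> space_L2 \<Omega>" "is_weak_gradient \<Omega> u (weak_gradient \<Omega> u)"
proof -
  have "\<exists>G. G \<in> space_L2 \<Omega> \<and> is_weak_gradient \<Omega> u G" using assms by (auto simp: W12_def)
  from someI_ex[OF this] show "weak_gradient \<Omega> u \<in> space_L2 \<Omega>" "is_weak_gradient \<Omega> u (weak_gradient \<Omega> u)"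
    by (simp_all add: weak_gradient_def)
qed

text \<open>The way to compute with \<open>weak_gradient\<close>, which is an arbitrary choice: an
  explicit candidate is exhibited, and the chosen representative has the same class.\<close>

lemma weak_gradient_eqI:
  assumes "u \<in> space_L2 \<Omega>" "G \<in> space_L2 \<Omega>" "is_weak_gradient \<Omega> u G"
  shows "u \<in> W12 \<Omega>" "AE x in \<mu>. weak_gradient \<Omega> u x = G x" "l2_on \<Omega> (weak_gradient \<Omega> u) = l2_on \<Omega> G"
proof -
  show W: "u \<in> W12 \<Omega>" using assms by (auto simp: W12_def)
  show A: "AE x in \<mu>. weak_gradient \<Omega> u x = G x"
    by (rule weak_gradient_AE_unique[OF weak_gradient_props(2)[OF W] assms(3) weak_gradient_props(1)[OF W] assms(2)])
  then show "l2_on \<Omega> (weak_gradient \<Omega> u) = l2_on \<Omega> G"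
    using l2_on_eq_iff[OF domain_lebesgue weak_gradient_props(1)[OF W] assms(2)] by simp
qed

text \<open>Pairing \<open>u\<close> with its weak gradient embeds \<^term>\<open>W12 \<Omega>\<close> isometrically into a Hilbert space.\<close>

definition jet :: "(real^'n \<Rightarrow> real) \<Rightarrow> (real^'n, real) l2 \<times> (real^'n, real^'n) l2" where
  "jet u = (l2_on \<Omega> u, l2_on \<Omega> (weak_gradient \<Omega> u))"

lemma jet_eqI:
  assumes "u \<in> space_L2 \<Omega>" "G \<in> space_L2 \<Omega>" "is_weak_gradient \<Omega> u G"
  shows "jet u = (l2_on \<Omega> u, l2_on \<Omega> G)"
  using weak_gradient_eqI[OF assms] by (simp add: jet_def)

lemma weak_gradient_test_integrable:
  assumes "u \<in> space_L2 \<Omega>" "G \<in> space_L2 \<Omega>" "\<psi> \<in> test_functions \<Omega>"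
  shows "integrable \<mu> (\<lambda>x. u x * partial_derivative i \<psi> x)"
    "integrable \<mu> (\<lambda>x. (G x :: real^'n) $ i * \<psi> x)"
  using integrable_inner_space_L2[OF domain_lebesgue assms(1) test_function_L2[OF test_functions_partial_derivative[OF assms(3)]]]
    integrable_inner_space_L2[OF domain_lebesgue assms(2) test_function_axis_L2[OF assms(3), of i]]
  by (auto simp: inner_axis mult.commute)

lemma W12_add:
  assumes u: "u \<in> W12 \<Omega>" and v: "v \<in> W12 \<Omega>"
  shows "(\<lambda>x. u x + v x) \<in> W12 \<Omega>" "jet (\<lambda>x. u x + v x) = jet u + jet v"
    "AE x in \<mu>. weak_gradient \<Omega> (\<lambda>x. u x + v x) x = weak_gradient \<Omega> u x + weak_gradient \<Omega> v x"
proof -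
  note L2 = W12_L2[OF u] W12_L2[OF v] weak_gradient_props(1)[OF u] weak_gradient_props(1)[OF v]
  have w: "is_weak_gradient \<Omega> (\<lambda>x. u x + v x) (\<lambda>x. weak_gradient \<Omega> u x + weak_gradient \<Omega> v x)"
    unfolding is_weak_gradient_def
  proof (intro ballI allI)
    fix \<psi> i assume \<psi>: "\<psi> \<in> test_functions \<Omega>"
    show "(LINT x|\<mu>. (u x + v x) * partial_derivative i \<psi> x)
        = - (LINT x|\<mu>. (weak_gradient \<Omega> u x + weak_gradient \<Omega> v x) $ i * \<psi> x)"
      using weak_gradient_test_integrable[OF L2(1,3) \<psi>, of i] weak_gradient_test_integrable[OF L2(2,4) \<psi>, of i]
        weak_gradient_props(2)[OF u] weak_gradient_props(2)[OF v] \<psi>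
      by (simp add: distrib_right is_weak_gradient_def)
  qed
  note * = space_L2_add[OF domain_lebesgue L2(1,2)] space_L2_add[OF domain_lebesgue L2(3,4)] w
  show "(\<lambda>x. u x + v x) \<in> W12 \<Omega>" by (rule weak_gradient_eqI(1)[OF *])
  show "AE x in \<mu>. weak_gradient \<Omega> (\<lambda>x. u x + v x) x = weak_gradient \<Omega> u x + weak_gradient \<Omega> v x"
    by (rule weak_gradient_eqI(2)[OF *])
  show "jet (\<lambda>x. u x + v x) = jet u + jet v"
    unfolding jet_eqI[OF *] using L2 by (simp add: jet_def l2_on_add[OF domain_lebesgue])
qed

lemma W12_scale:
  assumes u: "u \<in> W12 \<Omega>"
  shows "(\<lambda>x. c * u x) \<in> W12 \<Omega>" "jet (\<lambda>x. c * u x) = c *\<^sub>R jet u"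
proof -
  note L2 = W12_L2[OF u] weak_gradient_props(1)[OF u]
  have w: "is_weak_gradient \<Omega> (\<lambda>x. c * u x) (\<lambda>x. c *\<^sub>R weak_gradient \<Omega> u x)"
    using weak_gradient_props(2)[OF u] by (simp add: is_weak_gradient_def mult.assoc)
  have "(\<lambda>x. c * u x) \<in> space_L2 \<Omega>" using space_L2_scaleR[OF domain_lebesgue L2(1), of c] by simp
  note * = this space_L2_scaleR[OF domain_lebesgue L2(2), of c] w
  show "(\<lambda>x. c * u x) \<in> W12 \<Omega>" by (rule weak_gradient_eqI(1)[OF *])
  show "jet (\<lambda>x. c * u x) = c *\<^sub>R jet u"
    unfolding jet_eqI[OF *] using l2_on_scaleR[OF domain_lebesgue L2(1), of c] l2_on_scaleR[OF domain_lebesgue L2(2), of c]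
    by (simp add: jet_def)
qed

lemma W12_diff:
  assumes u: "u \<in> W12 \<Omega>" and v: "v \<in> W12 \<Omega>"
  shows "(\<lambda>x. u x - v x) \<in> W12 \<Omega>" "jet (\<lambda>x. u x - v x) = jet u - jet v"
  using W12_add[OF u W12_scale(1)[OF v, of "-1"]] W12_scale(2)[OF v, of "-1"] by simp_all

lemma norm_W12_eq:
  assumes "u \<in> W12 \<Omega>" shows "norm_W12 \<Omega> u = norm (jet u)"
  using norm_l2_on[OF domain_lebesgue W12_L2[OF assms]] norm_l2_on[OF domain_lebesgue weak_gradient_props(1)[OF assms]]
  by (simp add: norm_W12_def jet_def norm_prod_def)

lemma test_function_W12:
  assumes "\<phi> \<in> test_functions \<Omega>"
  shows "\<phi> \<in> W12 \<Omega>" "jet \<phi> = (l2_on \<Omega> \<phi>, l2_on \<Omega> (classical_gradient \<phi>))"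
  using weak_gradient_eqI(1) jet_eqI test_function_L2 classical_gradient_L2 is_weak_gradient_classical assms
  by blast+

text \<open>The image of \<open>W012\<close> under \<open>jet\<close>, by \<open>W012_iff\<close>
  and \<open>sobolev_jets_surj\<close>. As a closed subspace of a Hilbert space it admits the Riesz
  and Lax-Milgram theorems and weak compactness.\<close>

definition sobolev_jets :: "((real^'n, real) l2 \<times> (real^'n, real^'n) l2) set" where
  "sobolev_jets = closure (jet ` test_functions \<Omega>)"

lemma W012_iff: "u \<in> W012 \<Omega> \<longleftrightarrow> u \<in> W12 \<Omega> \<and> jet u \<in> sobolev_jets"
proof -
  have "norm_W12 \<Omega> (\<lambda>x. \<phi> x - u x) = norm (jet \<phi> - jet u)"
    if "u \<in> W12 \<Omega>" "\<phi> \<in> test_functions \<Omega>" for \<phi>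
    using W12_diff[OF test_function_W12(1)[OF that(2)] that(1)] by (simp add: norm_W12_eq)
  then have "u \<in> W012 \<Omega> \<longleftrightarrow> u \<in> W12 \<Omega> \<and>
      (\<exists>\<phi>::nat \<Rightarrow> _. (\<forall>k. \<phi> k \<in> test_functions \<Omega>) \<and> (\<lambda>k. norm (jet (\<phi> k) - jet u)) \<longlonglongrightarrow> 0)"
    unfolding W012_def by (auto cong: conj_cong)
  also have "\<dots> \<longleftrightarrow> u \<in> W12 \<Omega> \<and>
      (\<exists>\<phi>::nat \<Rightarrow> _. (\<forall>k. \<phi> k \<in> test_functions \<Omega>) \<and> (\<lambda>k. jet (\<phi> k)) \<longlonglongrightarrow> jet u)"
    by (simp add: tendsto_norm_zero_iff LIM_zero_iff)
  also have "\<dots> \<longleftrightarrow> u \<in> W12 \<Omega> \<and> jet u \<in> sobolev_jets"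
  proof -
    have "(\<exists>\<phi>::nat \<Rightarrow> _. (\<forall>k. \<phi> k \<in> test_functions \<Omega>) \<and> (\<lambda>k. jet (\<phi> k)) \<longlonglongrightarrow> s) \<longleftrightarrow> s \<in> sobolev_jets" for s
    proof
      assume "s \<in> sobolev_jets"
      then obtain S where S: "\<And>n::nat. S n \<in> jet ` test_functions \<Omega>" "S \<longlonglongrightarrow> s"
        unfolding sobolev_jets_def closure_sequential by blast
      then have "\<forall>n. \<exists>\<phi>. \<phi> \<in> test_functions \<Omega> \<and> S n = jet \<phi>" by blast
      then obtain \<phi> where \<phi>: "\<And>n. \<phi> n \<in> test_functions \<Omega>" "\<And>n. S n = jet (\<phi> n)" by metis
      have "S = (\<lambda>n. jet (\<phi> n))" by (rule ext) (rule \<phi>(2))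
      then show "\<exists>\<phi>::nat \<Rightarrow> _. (\<forall>k. \<phi> k \<in> test_functions \<Omega>) \<and> (\<lambda>k. jet (\<phi> k)) \<longlonglongrightarrow> s"
        using S(2) \<phi>(1) by blast
    next
      assume "\<exists>\<phi>::nat \<Rightarrow> _. (\<forall>k. \<phi> k \<in> test_functions \<Omega>) \<and> (\<lambda>k. jet (\<phi> k)) \<longlonglongrightarrow> s"
      then obtain \<phi> where \<phi>: "\<And>k::nat. \<phi> k \<in> test_functions \<Omega>" "(\<lambda>k. jet (\<phi> k)) \<longlonglongrightarrow> s" by blast
      show "s \<in> sobolev_jets" unfolding sobolev_jets_def closure_sequential
        by (intro exI[of _ "\<lambda>k. jet (\<phi> k)"] conjI allI imageI \<phi>)
    qed
    then show ?thesis by simp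
  qed
  finally show ?thesis .
qed

lemma subspace_sobolev_jets: "subspace sobolev_jets"
  unfolding sobolev_jets_def
proof (rule subspace_closure, rule subspaceI)
  have "jet (\<lambda>x. 0 * 0) = 0 *\<^sub>R jet (\<lambda>_. 0)"
    by (rule W12_scale(2)[OF test_function_W12(1)[OF test_functions_zero]])
  then show "0 \<in> jet ` test_functions \<Omega>" using test_functions_zero by (auto intro!: image_eqI)
  show "s + t \<in> jet ` test_functions \<Omega>" if st: "s \<in> jet ` test_functions \<Omega>" "t \<in> jet ` test_functions \<Omega>" for s t
  proof -
    obtain \<phi> \<psi> where p: "\<phi> \<in> test_functions \<Omega>" "s = jet \<phi>" "\<psi> \<in> test_functions \<Omega>" "t = jet \<psi>" using st by blast
    then show ?thesis using W12_add(2)[OF test_function_W12(1)[OF p(1)] test_function_W12(1)[OF p(3)]] test_functions_add[OF p(1,3)]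
      by (intro image_eqI[of _ _ "\<lambda>x. \<phi> x + \<psi> x"]) auto
  qed
  show "c *\<^sub>R s \<in> jet ` test_functions \<Omega>" if st: "s \<in> jet ` test_functions \<Omega>" for c s
  proof -
    obtain \<phi> where p: "\<phi> \<in> test_functions \<Omega>" "s = jet \<phi>" using st by blast
    then show ?thesis using W12_scale(2)[OF test_function_W12(1)[OF p(1)], of c] test_functions_scale[OF p(1), of c]
      by (intro image_eqI[of _ _ "\<lambda>x. c * \<phi> x"]) auto
  qed
qed

lemma complete_sobolev_jets: "complete sobolev_jets"
  by (simp add: sobolev_jets_def complete_eq_closed)

text \<open>Weak differentiation is a closed operation: the identity that defines a weak gradient
  equates pairings with fixed L2 functions, so it survives when both components converge.\<close>

lemma sobolev_jets_surj:
  assumes "s \<in> sobolev_jets" obtains u where "u \<in> W012 \<Omega>" "jet u = s"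
proof -
  obtain S where S: "\<And>n::nat. S n \<in> jet ` test_functions \<Omega>" "S \<longlonglongrightarrow> s"
    using assms unfolding sobolev_jets_def closure_sequential by blast
  then have "\<forall>n. \<exists>\<phi>. \<phi> \<in> test_functions \<Omega> \<and> S n = jet \<phi>" by blast
  then obtain \<phi> where \<phi>: "\<And>n. \<phi> n \<in> test_functions \<Omega>" "\<And>n. S n = jet (\<phi> n)" by metis
  have lim1: "(\<lambda>n. l2_on \<Omega> (\<phi> n)) \<longlonglongrightarrow> fst s"
    using tendsto_fst[OF S(2)] by (simp add: \<phi>(2) test_function_W12(2)[OF \<phi>(1)])
  have lim2: "(\<lambda>n. l2_on \<Omega> (classical_gradient (\<phi> n))) \<longlonglongrightarrow> snd s"
    using tendsto_snd[OF S(2)] by (simp add: \<phi>(2) test_function_W12(2)[OF \<phi>(1)])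
  obtain u where u: "u \<in> space_L2 \<Omega>" "l2_on \<Omega> u = fst s"
    using l2_on_surj[OF domain_lebesgue test_function_L2[OF \<phi>(1)] lim1] by blast
  obtain G where G: "G \<in> space_L2 \<Omega>" "l2_on \<Omega> G = snd s"
    using l2_on_surj[OF domain_lebesgue classical_gradient_L2[OF \<phi>(1)] lim2] by blast
  have "is_weak_gradient \<Omega> u G"
    unfolding is_weak_gradient_def
  proof (intro ballI allI)
    fix \<psi> i assume \<psi>: "\<psi> \<in> test_functions \<Omega>"
    let ?d = "partial_derivative i \<psi>" and ?e = "\<lambda>x. \<psi> x *\<^sub>R axis i 1 :: real^'n"
    have d: "?d \<in> space_L2 \<Omega>" by (intro test_function_L2 test_functions_partial_derivative \<psi>)
    have e: "?e \<in> space_L2 \<Omega>" by (rule test_function_axis_L2[OF \<psi>])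
    have "(\<lambda>n. l2_on \<Omega> (\<phi> n) \<bullet> l2_on \<Omega> ?d) \<longlonglongrightarrow> l2_on \<Omega> u \<bullet> l2_on \<Omega> ?d"
      unfolding u(2) by (intro tendsto_inner lim1 tendsto_const)
    moreover have "(\<lambda>n. - (l2_on \<Omega> (classical_gradient (\<phi> n)) \<bullet> l2_on \<Omega> ?e)) \<longlonglongrightarrow> - (l2_on \<Omega> G \<bullet> l2_on \<Omega> ?e)"
      unfolding G(2) by (intro tendsto_minus tendsto_inner lim2 tendsto_const)
    moreover have "l2_on \<Omega> (\<phi> n) \<bullet> l2_on \<Omega> ?d = - (l2_on \<Omega> (classical_gradient (\<phi> n)) \<bullet> l2_on \<Omega> ?e)" for n
    proof -
      have "l2_on \<Omega> (\<phi> n) \<bullet> l2_on \<Omega> ?d = (LINT x|\<mu>. \<phi> n x * ?d x)"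
        using inner_l2_on[OF domain_lebesgue test_function_L2[OF \<phi>(1)] d] by simp
      also have "\<dots> = - (LINT x|\<mu>. classical_gradient (\<phi> n) x $ i * \<psi> x)"
        using is_weak_gradient_classical[OF \<phi>(1)] \<psi> unfolding is_weak_gradient_def by blast
      also have "(LINT x|\<mu>. classical_gradient (\<phi> n) x $ i * \<psi> x)
          = l2_on \<Omega> (classical_gradient (\<phi> n)) \<bullet> l2_on \<Omega> ?e"
        using inner_l2_on[OF domain_lebesgue classical_gradient_L2[OF \<phi>(1)] e]
        by (simp add: inner_axis mult.commute)
      finally show ?thesis .
    qed
    ultimately have "l2_on \<Omega> u \<bullet> l2_on \<Omega> ?d = - (l2_on \<Omega> G \<bullet> l2_on \<Omega> ?e)"
      using LIMSEQ_unique by simp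
    then show "(LINT x|\<mu>. u x * ?d x) = - (LINT x|\<mu>. G x $ i * \<psi> x)"
      using inner_l2_on[OF domain_lebesgue u(1) d] inner_l2_on[OF domain_lebesgue G(1) e]
      by (simp add: inner_axis mult.commute)
  qed
  note * = u(1) G(1) this
  have "jet u = s" using jet_eqI[OF *] u(2) G(2) by simp
  then show ?thesis using that weak_gradient_eqI(1)[OF *] assms by (auto simp: W012_iff)
qed

lemma W012_W12: "u \<in> W012 \<Omega> \<Longrightarrow> u \<in> W12 \<Omega>" and W012_jet: "u \<in> W012 \<Omega> \<Longrightarrow> jet u \<in> sobolev_jets"
  by (simp_all add: W012_iff)

lemma W012_add: "u \<in> W012 \<Omega> \<Longrightarrow> v \<in> W012 \<Omega> \<Longrightarrow> (\<lambda>x. u x + v x) \<in> W012 \<Omega>"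
  by (simp add: W012_iff W12_add subspace_add[OF subspace_sobolev_jets])

lemma W012_scale: "u \<in> W012 \<Omega> \<Longrightarrow> (\<lambda>x. c * u x) \<in> W012 \<Omega>"
  by (simp add: W012_iff W12_scale subspace_scale[OF subspace_sobolev_jets])

lemma W012_diff: "u \<in> W012 \<Omega> \<Longrightarrow> v \<in> W012 \<Omega> \<Longrightarrow> (\<lambda>x. u x - v x) \<in> W012 \<Omega>"
  by (simp add: W012_iff W12_diff subspace_diff[OF subspace_sobolev_jets])

lemma test_function_W012: "\<phi> \<in> test_functions \<Omega> \<Longrightarrow> \<phi> \<in> W012 \<Omega>"
  unfolding W012_iff sobolev_jets_def
  by (intro conjI test_function_W12(1) subsetD[OF closure_subset imageI])

end

section \<open>Compact embedding, truncation and duality\<close>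

context bounded_open_set
begin

section \<open>The Poincare inequality\<close>

lemma nn_integral_l2_on:
  fixes u :: "real^'n \<Rightarrow> 'b::euclidean_space"
  assumes "u \<in> borel_measurable borel" "u \<in> space_L2 \<Omega>" "\<And>x. x \<notin> \<Omega> \<Longrightarrow> u x = 0"
  shows "(\<integral>\<^sup>+x. ennreal ((norm (u x))\<^sup>2) \<partial>lborel) = ennreal ((norm (l2_on \<Omega> u))\<^sup>2)"
proof -
  have "(\<lambda>x. indicator \<Omega> x *\<^sub>R u x) = u" using assms(3) by (auto simp: indicator_def fun_eq_iff)
  then have "square_integrable u" "l2_on \<Omega> u = l2_of u"
    using assms(2) by (simp_all add: space_L2_iff[OF domain_lebesgue] l2_on_def)
  then show ?thesis using nn_integral_l2_of[of u] by (simp add: nn_integral_completion)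
qed

lemma classical_gradient_outside:
  "\<phi> \<in> test_functions \<Omega> \<Longrightarrow> x \<notin> \<Omega> \<Longrightarrow> classical_gradient \<phi> x = 0"
  using test_function_outside[OF test_functions_partial_derivative] by (simp add: vec_eq_iff)

lemma nn_integral_test_function:
  assumes \<phi>: "\<phi> \<in> test_functions \<Omega>"
  shows "(\<integral>\<^sup>+x. ennreal ((\<phi> x)\<^sup>2) \<partial>lborel) = ennreal ((norm (fst (jet \<phi>)))\<^sup>2)"
    and "(\<integral>\<^sup>+x. ennreal ((norm (classical_gradient \<phi> x))\<^sup>2) \<partial>lborel) = ennreal ((norm (snd (jet \<phi>)))\<^sup>2)"
proof -
  show "(\<integral>\<^sup>+x. ennreal ((\<phi> x)\<^sup>2) \<partial>lborel) = ennreal ((norm (fst (jet \<phi>)))\<^sup>2)"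
    using nn_integral_l2_on[OF test_functions_borel[OF \<phi>] test_function_L2[OF \<phi>] test_function_outside[OF \<phi>]]
    by (simp add: test_function_W12(2)[OF \<phi>])
  show "(\<integral>\<^sup>+x. ennreal ((norm (classical_gradient \<phi> x))\<^sup>2) \<partial>lborel) = ennreal ((norm (snd (jet \<phi>)))\<^sup>2)"
    using nn_integral_l2_on[OF borel_measurable_continuous_onI[OF continuous_on_classical_gradient[OF test_functions_smooth[OF \<phi>]]]
        classical_gradient_L2[OF \<phi>] classical_gradient_outside[OF \<phi>]]
    by (simp add: test_function_W12(2)[OF \<phi>])
qed

text \<open>The inequality defines a closed set of pairs, so it extends from test functions to the
  closure of their jets.\<close>

lemma poincare:
  obtains P where "P > 0" "\<And>s. s \<in> sobolev_jets \<Longrightarrow> (norm (fst s))\<^sup>2 \<le> P * (norm (snd s))\<^sup>2"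
proof -
  obtain P where P: "P > 0" "\<And>\<phi>. \<phi> \<in> test_functions \<Omega> \<Longrightarrow>
      (\<integral>\<^sup>+x. ennreal ((\<phi> x)\<^sup>2) \<partial>lborel) \<le> ennreal P * (\<integral>\<^sup>+x. ennreal ((norm (classical_gradient \<phi> x))\<^sup>2) \<partial>lborel)"
    using poincare_test_functions[OF bounded_domain] by metis
  have "(norm (fst s))\<^sup>2 \<le> P * (norm (snd s))\<^sup>2" if "s \<in> sobolev_jets" for s
  proof -
    have "closed {s :: (real^'n, real) l2 \<times> (real^'n, real^'n) l2. (norm (fst s))\<^sup>2 \<le> P * (norm (snd s))\<^sup>2}"
      by (intro closed_Collect_le continuous_intros)
    moreover have "jet ` test_functions \<Omega> \<subseteq> {s. (norm (fst s))\<^sup>2 \<le> P * (norm (snd s))\<^sup>2}"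
    proof
      fix s assume "s \<in> jet ` test_functions \<Omega>"
      then obtain \<phi> where "\<phi> \<in> test_functions \<Omega>" "s = jet \<phi>" by blast
      from P(2)[OF this(1)] have "ennreal ((norm (fst (jet \<phi>)))\<^sup>2) \<le> ennreal (P * (norm (snd (jet \<phi>)))\<^sup>2)"
        using P(1) nn_integral_test_function[OF \<open>\<phi> \<in> test_functions \<Omega>\<close>] by (simp add: ennreal_mult)
      then have "(norm (fst (jet \<phi>)))\<^sup>2 \<le> P * (norm (snd (jet \<phi>)))\<^sup>2"
        using P(1) by (subst (asm) ennreal_le_iff) auto
      then show "s \<in> {s. (norm (fst s))\<^sup>2 \<le> P * (norm (snd s))\<^sup>2}" using \<open>s = jet \<phi>\<close> by simp
    qed
    ultimately have "sobolev_jets \<subseteq> {s. (norm (fst s))\<^sup>2 \<le> P * (norm (snd s))\<^sup>2}"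
      unfolding sobolev_jets_def by (intro closure_minimal)
    then show ?thesis using that by auto
  qed
  then show ?thesis using that P(1) by blast
qed

lemma sobolev_jets_zeroI:
  assumes "s \<in> sobolev_jets" "snd s = 0" shows "s = 0"
proof -
  obtain P where "(norm (fst s))\<^sup>2 \<le> P * (norm (snd s))\<^sup>2" using poincare assms(1) by metis
  then show ?thesis using assms(2) by (simp add: prod_eq_iff)
qed

section \<open>Compactness of the embedding into L2\<close>

text \<open>Each function is compared with its means \<open>K n\<close> over balls of a fixed radius
  \<open>h\<close>. The deviation is small uniformly in \<open>n\<close> by the gradient bound. The
  means tend to 0 pointwise by \<open>weak\<close> and are uniformly bounded by Jensen, so dominated
  convergence on the bounded set \<open>\<Omega>\<close> removes them.\<close>

lemma weakly_null_test_functions_tendsto_0: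
  assumes \<phi>: "\<And>n. \<phi> n \<in> test_functions \<Omega>" and bnd: "\<And>n. norm (jet (\<phi> n)) \<le> C"
    and weak: "\<And>B. B \<in> range (\<lambda>(x, h). ball x h) \<Longrightarrow> (\<lambda>n. LINT x|lborel. \<phi> n x * indicator B x) \<longlonglongrightarrow> 0"
  shows "(\<lambda>n. fst (jet (\<phi> n))) \<longlonglongrightarrow> 0"
proof -
  have C: "C \<ge> 0" using bnd[of 0] norm_ge_zero order_trans by blast
  have bnd2: "(norm (fst (jet (\<phi> n))))\<^sup>2 \<le> C\<^sup>2" "(norm (snd (jet (\<phi> n))))\<^sup>2 \<le> C\<^sup>2" for n
    using order_trans[OF norm_fst_le[of "fst (jet (\<phi> n))" "snd (jet (\<phi> n))", unfolded prod.collapse] bnd]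
      order_trans[OF norm_snd_le[of "snd (jet (\<phi> n))" "fst (jet (\<phi> n))", unfolded prod.collapse] bnd]
    by (auto intro!: power_mono)
  have "(\<lambda>n. (norm (fst (jet (\<phi> n))))\<^sup>2) \<longlonglongrightarrow> 0"
  proof (rule LIMSEQ_I)
    fix r :: real assume r: "r > 0"
    \<comment> \<open>Chosen so that the deviation from the means contributes at most
      \<open>r / 2\<close>, as stated in \<open>hC\<close>; \<open>C^2 + 1\<close> keeps the divisor
      positive.\<close>
    define h where "h = sqrt (r / (4 * (C\<^sup>2 + 1)))"
    have Cp: "C\<^sup>2 + 1 > 0" by (simp add: add_nonneg_pos)
    have h: "h > 0" "h\<^sup>2 = r / (4 * (C\<^sup>2 + 1))" using r Cp by (auto simp: h_def)
    have hC: "2 * (h\<^sup>2 * C\<^sup>2) \<le> r / 2"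
    proof -
      have "h\<^sup>2 * C\<^sup>2 \<le> h\<^sup>2 * (C\<^sup>2 + 1)" by (intro mult_left_mono) auto
      also have "\<dots> = r / 4" unfolding h(2) using Cp by (simp add: field_simps)
      finally show ?thesis by simp
    qed
    define m where "m = measure lborel (ball (0::real^'n) h)"
    have m: "m > 0" using h(1) by (simp add: m_def content_ball_pos)
    define K where "K n x = (LINT y|lborel. \<phi> n y * indicator (ball x h) y) / m" for n x
    have [measurable]: "\<phi> n \<in> borel_measurable borel" for n using \<phi> by (rule test_functions_borel)
    have [measurable]: "K n \<in> borel_measurable borel" for n
    proof -
      \<comment> \<open>Writing the indicator of the ball through \<open>dist x y\<close> exhibits
        the integrand as jointly measurable in \<open>x\<close> and \<open>y\<close>.\<close>
      have "(\<lambda>x. LINT y|lborel. \<phi> n y * (if dist x y < h then 1 else 0)) \<in> borel_measurable borel" by measurable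
      also have "(\<lambda>x. LINT y|lborel. \<phi> n y * (if dist x y < h then 1 else 0)) = (\<lambda>x. m * K n x)"
        using m by (auto simp: K_def indicator_def intro!: ext Bochner_Integration.integral_cong)
      finally have "(\<lambda>x. m * K n x / m) \<in> borel_measurable borel" by measurable
      then show ?thesis using m by simp
    qed
    have Kbound: "(K n x)\<^sup>2 \<le> C\<^sup>2 / m" for n x
    proof -
      obtain D where D: "\<And>x. \<bar>\<phi> n x\<bar> \<le> D" using test_functions_bounded[OF \<phi>] by metis
      have mx: "measure lborel (ball x h) = m" using h(1) unfolding m_def by (simp add: content_ball)
      have int2: "integrable lborel (\<lambda>y. (\<phi> n y)\<^sup>2)"
        using test_functions_integrable[OF test_functions_mult[OF \<phi> test_functions_smooth[OF \<phi>]], of n n]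
        by (simp add: power2_eq_square)
      have "(K n x)\<^sup>2 \<le> (LINT y|lborel. (\<phi> n y)\<^sup>2 * indicator (ball x h) y) / m"
        unfolding K_def mx[symmetric]
        by (rule square_mean_le[where C = D]) (use D m mx in auto)
      also have "\<dots> \<le> (LINT y|lborel. (\<phi> n y)\<^sup>2) / m"
      proof (intro divide_right_mono integral_mono int2)
        show "integrable lborel (\<lambda>y. (\<phi> n y)\<^sup>2 * indicator (ball x h) y)"
          using integrable_mult_indicator[OF _ int2, of "ball x h"] by (simp add: mult.commute)
      qed (use m in \<open>auto simp: indicator_def\<close>)
      also have "(LINT y|lborel. (\<phi> n y)\<^sup>2) = (norm (fst (jet (\<phi> n))))\<^sup>2"
      proof -
        have "ennreal (LINT y|lborel. (\<phi> n y)\<^sup>2) = ennreal ((norm (fst (jet (\<phi> n))))\<^sup>2)"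
          using nn_integral_test_function(1)[OF \<phi>, of n] nn_integral_eq_integral[OF int2] by simp
        then show ?thesis by (subst (asm) ennreal_inj) auto
      qed
      finally show ?thesis using bnd2(1)[of n] m by (meson divide_right_mono less_imp_le order_trans)
    qed
    have "(\<lambda>n. LINT x|lborel. (K n x)\<^sup>2 * indicator \<Omega> x) \<longlonglongrightarrow> (LINT x::real^'n|lborel. (0::real))"
    proof (rule integral_dominated_convergence[where w = "\<lambda>x. C\<^sup>2 / m * indicator \<Omega> x"])
      show "integrable lborel (\<lambda>x. C\<^sup>2 / m * indicator \<Omega> x)"
        using emeasure_bounded_finite[OF bounded_domain]
        by (intro integrable_mult_right integrable_real_indicator) auto
      show "AE x in lborel. (\<lambda>n. (K n x)\<^sup>2 * indicator \<Omega> x) \<longlonglongrightarrow> 0"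
      proof (rule AE_I2)
        fix x
        have "(\<lambda>n. K n x) \<longlonglongrightarrow> 0 / m"
          unfolding K_def using m by (intro tendsto_divide weak tendsto_const) auto
        then have "(\<lambda>n. (K n x)\<^sup>2 * indicator \<Omega> x) \<longlonglongrightarrow> (0 / m)\<^sup>2 * indicator \<Omega> x"
          by (intro tendsto_intros)
        then show "(\<lambda>n. (K n x)\<^sup>2 * indicator \<Omega> x) \<longlonglongrightarrow> 0" by simp
      qed
      show "AE x in lborel. norm ((K n x)\<^sup>2 * indicator \<Omega> x) \<le> C\<^sup>2 / m * indicator \<Omega> x" for n
        using Kbound[of n] by (intro AE_I2) (auto simp: indicator_def)
    qed measurable
    \<comment> \<open>Doubled, \<open>r / 8\<close> adds at most \<open>r / 4\<close> to the
      \<open>r / 2\<close> from \<open>hC\<close>.\<close>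
    then obtain N where N: "\<And>n. n \<ge> N \<Longrightarrow> (LINT x|lborel. (K n x)\<^sup>2 * indicator \<Omega> x) < r / 8"
      using LIMSEQ_D[of "\<lambda>n. LINT x|lborel. (K n x)\<^sup>2 * indicator \<Omega> x" 0 "r / 8"] r
      by (force simp: abs_less_iff)
    have "(norm (fst (jet (\<phi> n))))\<^sup>2 < r" if n: "n \<ge> N" for n
    proof -
      have intK: "integrable lborel (\<lambda>x. (K n x)\<^sup>2 * indicator \<Omega> x)"
      proof (rule Bochner_Integration.integrable_bound)
        show "integrable lborel (\<lambda>x. C\<^sup>2 / m * indicator \<Omega> x)"
          using emeasure_bounded_finite[OF bounded_domain]
          by (intro integrable_mult_right integrable_real_indicator) auto
        show "AE x in lborel. norm ((K n x)\<^sup>2 * indicator \<Omega> x) \<le> norm (C\<^sup>2 / m * indicator \<Omega> x)"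
          using Kbound[of n] m by (intro AE_I2) (auto simp: indicator_def)
      qed measurable
      have "ennreal ((norm (fst (jet (\<phi> n))))\<^sup>2) = (\<integral>\<^sup>+x. ennreal ((\<phi> n x)\<^sup>2) \<partial>lborel)"
        by (rule nn_integral_test_function(1)[OF \<phi>, symmetric])
      also have "\<dots> \<le> (\<integral>\<^sup>+x. ennreal 2 * ennreal ((K n x - \<phi> n x)\<^sup>2) + ennreal 2 * ennreal ((K n x)\<^sup>2 * indicator \<Omega> x) \<partial>lborel)"
      proof (rule nn_integral_mono)
        fix x
        have "(\<phi> n x)\<^sup>2 \<le> 2 * (K n x - \<phi> n x)\<^sup>2 + 2 * ((K n x)\<^sup>2 * indicator \<Omega> x)"
        proof (cases "x \<in> \<Omega>")
          case True
          have "0 \<le> (2 * K n x - \<phi> n x)\<^sup>2" by simp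
          then show ?thesis using True by (simp add: power2_eq_square algebra_simps)
        qed (simp add: test_function_outside[OF \<phi>])
        then have "ennreal ((\<phi> n x)\<^sup>2) \<le> ennreal (2 * (K n x - \<phi> n x)\<^sup>2 + 2 * ((K n x)\<^sup>2 * indicator \<Omega> x))"
          by (rule ennreal_leI)
        also have "\<dots> = ennreal (2 * (K n x - \<phi> n x)\<^sup>2) + ennreal (2 * ((K n x)\<^sup>2 * indicator \<Omega> x))"
          by (rule ennreal_plus) simp_all
        also have "\<dots> = ennreal 2 * ennreal ((K n x - \<phi> n x)\<^sup>2) + ennreal 2 * ennreal ((K n x)\<^sup>2 * indicator \<Omega> x)"
          by (intro arg_cong2[where f = "(+)"] ennreal_mult) simp_all
        finally show "ennreal ((\<phi> n x)\<^sup>2) \<le> ennreal 2 * ennreal ((K n x - \<phi> n x)\<^sup>2) + ennreal 2 * ennreal ((K n x)\<^sup>2 * indicator \<Omega> x)" .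
      qed
      also have "\<dots> = ennreal 2 * (\<integral>\<^sup>+x. ennreal ((K n x - \<phi> n x)\<^sup>2) \<partial>lborel) + ennreal 2 * (\<integral>\<^sup>+x. ennreal ((K n x)\<^sup>2 * indicator \<Omega> x) \<partial>lborel)"
        by (subst nn_integral_add) (auto simp: nn_integral_cmult)
      also have "(\<integral>\<^sup>+x. ennreal ((K n x)\<^sup>2 * indicator \<Omega> x) \<partial>lborel) = ennreal (LINT x|lborel. (K n x)\<^sup>2 * indicator \<Omega> x)"
        by (intro nn_integral_eq_integral intK) simp
      also have "(\<integral>\<^sup>+x. ennreal ((K n x - \<phi> n x)\<^sup>2) \<partial>lborel) \<le> ennreal (h\<^sup>2) * ennreal (C\<^sup>2)"
      proof -
        have "(\<integral>\<^sup>+x. ennreal ((K n x - \<phi> n x)\<^sup>2) \<partial>lborel)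
            \<le> ennreal (h\<^sup>2) * (\<integral>\<^sup>+x. ennreal ((norm (classical_gradient (\<phi> n) x))\<^sup>2) \<partial>lborel)"
          unfolding K_def m_def by (rule ball_mean_estimate[OF \<phi> h(1)])
        also have "\<dots> \<le> ennreal (h\<^sup>2) * ennreal (C\<^sup>2)"
          unfolding nn_integral_test_function(2)[OF \<phi>] by (intro mult_left_mono ennreal_leI bnd2) auto
        finally show ?thesis .
      qed
      finally have "ennreal ((norm (fst (jet (\<phi> n))))\<^sup>2)
          \<le> ennreal 2 * (ennreal (h\<^sup>2) * ennreal (C\<^sup>2)) + ennreal 2 * ennreal (LINT x|lborel. (K n x)\<^sup>2 * indicator \<Omega> x)"
        by (simp add: mult_left_mono add_mono)
      also have "\<dots> = ennreal (2 * (h\<^sup>2 * C\<^sup>2)) + ennreal (2 * (LINT x|lborel. (K n x)\<^sup>2 * indicator \<Omega> x))"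
        by (intro arg_cong2[where f = "(+)"]) (simp_all add: ennreal_mult)
      also have "\<dots> = ennreal (2 * (h\<^sup>2 * C\<^sup>2) + 2 * (LINT x|lborel. (K n x)\<^sup>2 * indicator \<Omega> x))"
        by (rule ennreal_plus[symmetric]) simp_all
      finally have "(norm (fst (jet (\<phi> n))))\<^sup>2 \<le> 2 * (h\<^sup>2 * C\<^sup>2) + 2 * (LINT x|lborel. (K n x)\<^sup>2 * indicator \<Omega> x)"
        by (subst (asm) ennreal_le_iff) auto
      then show ?thesis using N[OF n] hC r by argo
    qed
    then show "\<exists>N. \<forall>n\<ge>N. norm ((norm (fst (jet (\<phi> n))))\<^sup>2 - 0) < r" by auto
  qed
  then have "(\<lambda>n. sqrt ((norm (fst (jet (\<phi> n))))\<^sup>2)) \<longlonglongrightarrow> sqrt 0" by (rule tendsto_real_sqrt)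
  then show ?thesis by (simp add: tendsto_norm_zero_iff)
qed

text \<open>Approximating \<open>s n - l\<close> by the jet of a test function with error below
  \<open>1 / (n + 1)\<close> changes neither weak nor strong limits, which reduces the claim to
  weakly null sequences of test functions.\<close>

lemma rellich:
  assumes s: "\<And>n. s n \<in> sobolev_jets" and bnd: "\<And>n. norm (s n) \<le> C"
    and weak: "\<And>y. (\<lambda>n. s n \<bullet> y) \<longlonglongrightarrow> l \<bullet> y" and l: "l \<in> sobolev_jets"
  shows "(\<lambda>n. fst (s n)) \<longlonglongrightarrow> fst l"
proof -
  have "\<exists>\<phi>. \<phi> \<in> test_functions \<Omega> \<and> norm (jet \<phi> - (s n - l)) < 1 / real (Suc n)" for n
  proof -
    have "s n - l \<in> closure (jet ` test_functions \<Omega>)"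
      using subspace_diff[OF subspace_sobolev_jets s l] by (simp add: sobolev_jets_def)
    then show ?thesis unfolding closure_approachable
      by (auto simp: dist_norm dest!: spec[of _ "1 / real (Suc n)"])
  qed
  then obtain \<phi> where \<phi>: "\<And>n. \<phi> n \<in> test_functions \<Omega>" "\<And>n. norm (jet (\<phi> n) - (s n - l)) < 1 / real (Suc n)"
    by metis
  have err0: "(\<lambda>n. jet (\<phi> n) - (s n - l)) \<longlonglongrightarrow> 0"
  proof (rule Lim_null_comparison[OF always_eventually[OF allI]])
    show "norm (jet (\<phi> n) - (s n - l)) \<le> 1 / real (Suc n)" for n using \<phi>(2) by (rule less_imp_le)
    show "(\<lambda>n. 1 / real (Suc n)) \<longlonglongrightarrow> 0" by (rule LIMSEQ_Suc[OF lim_1_over_n])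
  qed
  have weak0: "(\<lambda>n. jet (\<phi> n) \<bullet> y) \<longlonglongrightarrow> 0" for y
  proof -
    have "(\<lambda>n. (jet (\<phi> n) - (s n - l)) \<bullet> y + (s n \<bullet> y - l \<bullet> y)) \<longlonglongrightarrow> 0 \<bullet> y + (l \<bullet> y - l \<bullet> y)"
      by (intro tendsto_intros err0 weak)
    then show ?thesis by (simp add: inner_diff_left)
  qed
  have "(\<lambda>n. fst (jet (\<phi> n))) \<longlonglongrightarrow> 0"
  proof (rule weakly_null_test_functions_tendsto_0[OF \<phi>(1)])
    show "norm (jet (\<phi> n)) \<le> 1 + (C + norm l)" for n
    proof -
      have "norm (jet (\<phi> n)) \<le> norm (jet (\<phi> n) - (s n - l)) + norm (s n - l)"
        using norm_triangle_ineq[of "jet (\<phi> n) - (s n - l)" "s n - l"] by simp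
      moreover have "norm (s n - l) \<le> C + norm l" using norm_triangle_ineq4[of "s n" l] bnd[of n] by simp
      moreover have "1 / real (Suc n) \<le> 1" by simp
      ultimately show ?thesis using \<phi>(2)[of n] by linarith
    qed
    fix B assume "B \<in> range (\<lambda>(x :: real^'n, h). ball x h)"
    then obtain x h where B: "B = ball x h" by auto
    have [measurable]: "B \<in> sets borel" by (simp add: B)
    have BL2: "(indicator B :: real^'n \<Rightarrow> real) \<in> space_L2 \<Omega>"
      by (rule space_L2_bounded[where C = 1]) (auto intro: borel_measurable_domain simp: indicator_def)
    have "jet (\<phi> n) \<bullet> (l2_on \<Omega> (indicator B), 0) = (LINT x|lborel. \<phi> n x * indicator B x)" for n
    proof -
      have "jet (\<phi> n) \<bullet> (l2_on \<Omega> (indicator B), 0) = (LINT x|\<mu>. \<phi> n x * indicator B x)"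
        using inner_l2_on[OF domain_lebesgue test_function_L2[OF \<phi>(1)] BL2] by (simp add: jet_def inner_prod_def)
      also have "\<dots> = (LINT x|lborel. \<phi> n x * indicator B x)"
        using test_functions_borel[OF \<phi>(1)] test_function_outside[OF \<phi>(1)]
        by (intro integral_domain_eq_lborel) auto
      finally show ?thesis .
    qed
    then show "(\<lambda>n. LINT x|lborel. \<phi> n x * indicator B x) \<longlonglongrightarrow> 0"
      using weak0[of "(l2_on \<Omega> (indicator B), 0)"] by simp
  qed
  moreover have "(\<lambda>n. fst (jet (\<phi> n) - (s n - l))) \<longlonglongrightarrow> 0"
    using tendsto_fst[OF err0] by simp
  ultimately have "(\<lambda>n. fst (jet (\<phi> n)) - fst (jet (\<phi> n) - (s n - l)) + fst l) \<longlonglongrightarrow> 0 - 0 + fst l"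
    by (intro tendsto_add tendsto_diff tendsto_const)
  then show ?thesis by simp
qed

section \<open>Truncation of Sobolev functions\<close>

text \<open>Membership of the pair in \<open>sobolev_jets\<close> only yields some function with
  this jet. It agrees with \<open>u\<close> almost everywhere, and the gradient identity is
  transferred to the given representative \<open>u\<close>.\<close>

lemma W012_of_jet:
  assumes u: "u \<in> space_L2 \<Omega>" and G: "G \<in> space_L2 \<Omega>" and J: "(l2_on \<Omega> u, l2_on \<Omega> G) \<in> sobolev_jets"
  shows "u \<in> W012 \<Omega>" "jet u = (l2_on \<Omega> u, l2_on \<Omega> G)" "AE x in \<mu>. weak_gradient \<Omega> u x = G x"
proof -
  obtain v where v: "v \<in> W012 \<Omega>" "jet v = (l2_on \<Omega> u, l2_on \<Omega> G)" using J by (rule sobolev_jets_surj)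
  note vW = W012_W12[OF v(1)]
  have eq: "AE x in \<mu>. v x = u x" "AE x in \<mu>. weak_gradient \<Omega> v x = G x"
    using v(2) l2_on_eq_iff[OF domain_lebesgue W12_L2[OF vW] u]
      l2_on_eq_iff[OF domain_lebesgue weak_gradient_props(1)[OF vW] G]
    by (auto simp: jet_def)
  have "is_weak_gradient \<Omega> u G"
    unfolding is_weak_gradient_def
  proof (intro ballI allI)
    fix \<psi> i assume \<psi>: "\<psi> \<in> test_functions \<Omega>"
    have "(LINT x|\<mu>. u x * partial_derivative i \<psi> x) = (LINT x|\<mu>. v x * partial_derivative i \<psi> x)"
      using weak_gradient_test_integrable(1)[OF u G \<psi>, of i]
        weak_gradient_test_integrable(1)[OF W12_L2[OF vW] G \<psi>, of i] eq(1)
      by (intro integral_cong_AE) auto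
    also have "\<dots> = - (LINT x|\<mu>. weak_gradient \<Omega> v x $ i * \<psi> x)"
      using weak_gradient_props(2)[OF vW] \<psi> unfolding is_weak_gradient_def by simp
    also have "(LINT x|\<mu>. weak_gradient \<Omega> v x $ i * \<psi> x) = (LINT x|\<mu>. G x $ i * \<psi> x)"
      using weak_gradient_test_integrable(2)[OF u G \<psi>, of i]
        weak_gradient_test_integrable(2)[OF u weak_gradient_props(1)[OF vW] \<psi>, of i] eq(2)
      by (intro integral_cong_AE) auto
    finally show "(LINT x|\<mu>. u x * partial_derivative i \<psi> x) = - (LINT x|\<mu>. G x $ i * \<psi> x)" .
  qed
  note * = u G this
  show jet: "jet u = (l2_on \<Omega> u, l2_on \<Omega> G)" by (rule jet_eqI[OF *])
  show "AE x in \<mu>. weak_gradient \<Omega> u x = G x" by (rule weak_gradient_eqI(2)[OF *])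
  show "u \<in> W012 \<Omega>" unfolding W012_iff using weak_gradient_eqI(1)[OF *] J jet by simp
qed

lemma norm_l2_on_le:
  fixes u :: "real^'n \<Rightarrow> 'b::euclidean_space" and v :: "real^'n \<Rightarrow> 'c::euclidean_space"
  assumes "u \<in> space_L2 \<Omega>" "v \<in> space_L2 \<Omega>" "c \<ge> 0"
    and "AE x in \<mu>. norm (u x) \<le> c * norm (v x)"
  shows "norm (l2_on \<Omega> u) \<le> c * norm (l2_on \<Omega> v)"
proof (rule power2_le_imp_le)
  have "(norm (l2_on \<Omega> u))\<^sup>2 \<le> (LINT x|\<mu>. c\<^sup>2 * (norm (v x))\<^sup>2)"
    unfolding norm_l2_on[OF domain_lebesgue assms(1)]
  proof (rule integral_mono_AE)
    show "AE x in \<mu>. (norm (u x))\<^sup>2 \<le> c\<^sup>2 * (norm (v x))\<^sup>2"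
      using assms(4) by eventually_elim (simp add: power_mono flip: power_mult_distrib)
  qed (use assms in \<open>auto simp: space_L2_def\<close>)
  also have "\<dots> = (c * norm (l2_on \<Omega> v))\<^sup>2"
    by (simp add: norm_l2_on[OF domain_lebesgue assms(2)] power_mult_distrib)
  finally show "(norm (l2_on \<Omega> u))\<^sup>2 \<le> (c * norm (l2_on \<Omega> v))\<^sup>2" .
qed (use assms in simp)

lemma space_L2_dominated:
  fixes u :: "real^'n \<Rightarrow> 'b::euclidean_space" and v :: "real^'n \<Rightarrow> 'c::euclidean_space"
  assumes "u \<in> borel_measurable \<mu>" "v \<in> space_L2 \<Omega>"
    and "AE x in \<mu>. norm (u x) \<le> c * norm (v x)"
  shows "u \<in> space_L2 \<Omega>"
  unfolding space_L2_def
proof (intro CollectI conjI assms(1))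
  have [measurable]: "u \<in> borel_measurable \<mu>" by fact
  show "integrable \<mu> (\<lambda>x. (norm (u x))\<^sup>2)"
  proof (rule Bochner_Integration.integrable_bound)
    show "integrable \<mu> (\<lambda>x. c\<^sup>2 * (norm (v x))\<^sup>2)"
      using assms(2) by (simp add: space_L2_def)
    show "AE x in \<mu>. norm ((norm (u x))\<^sup>2) \<le> norm (c\<^sup>2 * (norm (v x))\<^sup>2)"
      using assms(3) by eventually_elim (simp add: power_mono flip: power_mult_distrib)
  qed measurable
qed

lemma l2_on_AE_subsequence:
  fixes u :: "nat \<Rightarrow> real^'n \<Rightarrow> 'b::euclidean_space"
  assumes "\<And>n. u n \<in> space_L2 \<Omega>" "v \<in> space_L2 \<Omega>" "(\<lambda>n. l2_on \<Omega> (u n)) \<longlonglongrightarrow> l2_on \<Omega> v"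
  obtains r :: "nat \<Rightarrow> nat" where "strict_mono r" "AE x in \<mu>. (\<lambda>n. u (r n) x) \<longlonglongrightarrow> v x"
proof -
  obtain r :: "nat \<Rightarrow> nat" where r: "strict_mono r"
    "AE x in lebesgue. (\<lambda>n. indicator \<Omega> x *\<^sub>R u (r n) x) \<longlonglongrightarrow> indicator \<Omega> x *\<^sub>R v x"
    using assms AE_convergent_subsequence_l2[of "\<lambda>n x. indicator \<Omega> x *\<^sub>R u n x" "\<lambda>x. indicator \<Omega> x *\<^sub>R v x"]
    by (auto simp: space_L2_iff[OF domain_lebesgue] l2_on_def)
  have "AE x in \<mu>. (\<lambda>n. u (r n) x) \<longlonglongrightarrow> v x"
    unfolding AE_lebesgue_on_iff[OF domain_lebesgue]
    using r(2) by eventually_elim auto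
  then show ?thesis using that r(1) by blast
qed

text \<open>The chain rule holds for test functions, and truncated test functions are test
  functions. The values converge by the Lipschitz bound, the gradients by the splitting into
  \<open>e1\<close> and \<open>e2\<close>, and \<open>sobolev_jets\<close> is closed.\<close>

lemma truncated_W012:
  assumes u: "u \<in> W012 \<Omega>" and q: "q \<ge> 0"
  shows "(\<lambda>x. truncated q (u x)) \<in> W012 \<Omega>"
    and "AE x in \<mu>. weak_gradient \<Omega> (\<lambda>x. truncated q (u x)) x = truncated_deriv q (u x) *\<^sub>R weak_gradient \<Omega> u x"
proof -
  let ?T = "truncated q" and ?T' = "truncated_deriv q" and ?G = "weak_gradient \<Omega> u"
  note uW = W012_W12[OF u]
  have uL2: "u \<in> space_L2 \<Omega>" and GL2: "?G \<in> space_L2 \<Omega>"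
    using uW by (auto simp: W12_L2 weak_gradient_props)
  have [measurable]: "u \<in> borel_measurable \<mu>" "?G \<in> borel_measurable \<mu>"
    using uL2 GL2 by (auto simp: space_L2_def)
  have [measurable]: "?T \<in> borel_measurable borel" "?T' \<in> borel_measurable borel"
    by (intro borel_measurable_continuous_onI continuous_on_truncated continuous_on_truncated_deriv)+
  obtain S where S: "\<And>n::nat. S n \<in> jet ` test_functions \<Omega>" "S \<longlonglongrightarrow> jet u"
    using W012_jet[OF u] unfolding sobolev_jets_def closure_sequential by blast
  then have "\<forall>n. \<exists>\<phi>. \<phi> \<in> test_functions \<Omega> \<and> S n = jet \<phi>" by blast
  then obtain \<phi>0 where \<phi>0: "\<And>n. \<phi>0 n \<in> test_functions \<Omega>" "\<And>n. S n = jet (\<phi>0 n)" by metis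
  have lim0: "(\<lambda>n. l2_on \<Omega> (\<phi>0 n)) \<longlonglongrightarrow> l2_on \<Omega> u"
    using tendsto_fst[OF S(2)] by (simp add: \<phi>0(2) jet_def)
  \<comment> \<open>The factor \<open>truncated_deriv q\<close> in the gradient is handled by
    dominated convergence, which asks for convergence almost everywhere.\<close>
  obtain r :: "nat \<Rightarrow> nat" where r: "strict_mono r" "AE x in \<mu>. (\<lambda>n. \<phi>0 (r n) x) \<longlonglongrightarrow> u x"
    by (rule l2_on_AE_subsequence[OF test_function_L2[OF \<phi>0(1)] uL2 lim0])
  define \<phi> where "\<phi> n = \<phi>0 (r n)" for n
  have \<phi>: "\<phi> n \<in> test_functions \<Omega>" for n by (simp add: \<phi>_def \<phi>0)
  have ae: "AE x in \<mu>. (\<lambda>n. \<phi> n x) \<longlonglongrightarrow> u x" using r(2) by (simp add: \<phi>_def)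
  have "(S \<circ> r) \<longlonglongrightarrow> jet u" using LIMSEQ_subseq_LIMSEQ[OF S(2) r(1)] .
  then have J: "(\<lambda>n. jet (\<phi> n)) \<longlonglongrightarrow> jet u" by (simp add: o_def \<phi>_def \<phi>0(2))
  note \<phi>L2 = test_function_L2[OF \<phi>] and gL2 = classical_gradient_L2[OF \<phi>]
  have [measurable]: "\<phi> n \<in> borel_measurable \<mu>" "classical_gradient (\<phi> n) \<in> borel_measurable \<mu>" for n
    using \<phi>L2 gL2 by (auto simp: space_L2_def)
  have lim1: "(\<lambda>n. l2_on \<Omega> (\<phi> n) - l2_on \<Omega> u) \<longlonglongrightarrow> 0"
    using tendsto_fst[OF J] by (intro LIM_zero) (simp add: jet_def)
  have lim2: "(\<lambda>n. l2_on \<Omega> (classical_gradient (\<phi> n)) - l2_on \<Omega> ?G) \<longlonglongrightarrow> 0"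
    using tendsto_snd[OF J] test_function_W12(2)[OF \<phi>] by (intro LIM_zero) (simp add: jet_def)
  have T\<phi>: "(\<lambda>x. ?T (\<phi> n x)) \<in> test_functions \<Omega>" for n by (rule test_functions_truncated[OF \<phi> q])
  have grad: "classical_gradient (\<lambda>x. ?T (\<phi> n x)) = (\<lambda>x. ?T' (\<phi> n x) *\<^sub>R classical_gradient (\<phi> n) x)" for n
    using partial_derivative_compose(1)[OF smooth_differentiable[OF test_functions_smooth[OF \<phi>]] has_real_derivative_truncated]
    by (intro ext) (simp add: vec_eq_iff)
  have TuL2: "(\<lambda>x. ?T (u x)) \<in> space_L2 \<Omega>"
    by (rule space_L2_bounded[where C = 1]) (auto simp: abs_truncated_le)
  have T'b: "norm (?T' t *\<^sub>R g) \<le> 4 * norm g" for t and g :: "real^'n"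
    using truncated_deriv_nonneg[of q t] truncated_deriv_le[of q t] by (simp add: mult_right_mono)
  have TGL2: "(\<lambda>x. ?T' (u x) *\<^sub>R ?G x) \<in> space_L2 \<Omega>"
    by (rule space_L2_dominated[OF _ GL2, where c = 4]) (use T'b in auto)
  have cT: "(\<lambda>n. l2_on \<Omega> (\<lambda>x. ?T (\<phi> n x)) - l2_on \<Omega> (\<lambda>x. ?T (u x))) \<longlonglongrightarrow> 0"
  proof (rule Lim_null_comparison[OF always_eventually[OF allI]])
    fix n
    show "norm (l2_on \<Omega> (\<lambda>x. ?T (\<phi> n x)) - l2_on \<Omega> (\<lambda>x. ?T (u x))) \<le> 4 * norm (l2_on \<Omega> (\<phi> n) - l2_on \<Omega> u)"
      unfolding l2_on_diff[OF domain_lebesgue test_function_L2[OF T\<phi>] TuL2, symmetric] l2_on_diff[OF domain_lebesgue \<phi>L2 uL2, symmetric]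
      by (intro norm_l2_on_le space_L2_diff domain_lebesgue test_function_L2[OF T\<phi>] TuL2 \<phi>L2 uL2)
         (auto simp: truncated_lipschitz)
    show "(\<lambda>n. 4 * norm (l2_on \<Omega> (\<phi> n) - l2_on \<Omega> u)) \<longlonglongrightarrow> 0"
      by (intro tendsto_mult_right_zero tendsto_norm_zero lim1)
  qed
  \<comment> \<open>The gradient error is split in two: \<open>e1\<close> is small since the
    gradients converge and the factor is at most 4, while \<open>e2\<close> has the fixed gradient
    of \<open>u\<close> and a factor that tends to 0 almost everywhere.\<close>
  define e1 where "e1 n x = ?T' (\<phi> n x) *\<^sub>R (classical_gradient (\<phi> n) x - ?G x)" for n x
  define e2 where "e2 n x = (?T' (\<phi> n x) - ?T' (u x)) *\<^sub>R ?G x" for n x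
  have e1L2: "e1 n \<in> space_L2 \<Omega>" for n
    unfolding e1_def by (rule space_L2_dominated[OF _ space_L2_diff[OF domain_lebesgue gL2 GL2], where c = 4]) (use T'b in auto)
  have e2b: "norm (e2 n x) \<le> 4 * norm (?G x)" for n x
  proof -
    have "\<bar>?T' (\<phi> n x) - ?T' (u x)\<bar> \<le> 4"
      using truncated_deriv_nonneg[of q "\<phi> n x"] truncated_deriv_le[of q "\<phi> n x"]
        truncated_deriv_nonneg[of q "u x"] truncated_deriv_le[of q "u x"] by linarith
    then show ?thesis by (simp add: e2_def mult_right_mono)
  qed
  have e2L2: "e2 n \<in> space_L2 \<Omega>" for n
  proof (rule space_L2_dominated[OF _ GL2, where c = 4])
    show "e2 n \<in> borel_measurable \<mu>" unfolding e2_def by measurable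
  qed (use e2b in auto)
  have "(\<lambda>n. l2_on \<Omega> (e1 n)) \<longlonglongrightarrow> 0"
  proof (rule Lim_null_comparison[OF always_eventually[OF allI]])
    fix n
    show "norm (l2_on \<Omega> (e1 n)) \<le> 4 * norm (l2_on \<Omega> (classical_gradient (\<phi> n)) - l2_on \<Omega> ?G)"
      unfolding l2_on_diff[OF domain_lebesgue gL2 GL2, symmetric]
      using T'b by (intro norm_l2_on_le e1L2 space_L2_diff domain_lebesgue gL2 GL2) (auto simp: e1_def)
    show "(\<lambda>n. 4 * norm (l2_on \<Omega> (classical_gradient (\<phi> n)) - l2_on \<Omega> ?G)) \<longlonglongrightarrow> 0"
      by (intro tendsto_mult_right_zero tendsto_norm_zero lim2)
  qed
  moreover have "(\<lambda>n. l2_on \<Omega> (e2 n)) \<longlonglongrightarrow> 0"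
  proof -
    have "(\<lambda>n. LINT x|\<mu>. (norm (e2 n x))\<^sup>2) \<longlonglongrightarrow> (LINT x|\<mu>. (0::real))"
    proof (rule integral_dominated_convergence[where w = "\<lambda>x. 16 * (norm (?G x))\<^sup>2"])
      show "integrable \<mu> (\<lambda>x. 16 * (norm (?G x))\<^sup>2)" using GL2 by (simp add: space_L2_def)
      show "AE x in \<mu>. (\<lambda>n. (norm (e2 n x))\<^sup>2) \<longlonglongrightarrow> 0"
        using ae
      proof eventually_elim
        case (elim x)
        have "isCont ?T' (u x)" using continuous_on_truncated_deriv[of UNIV q] by (simp add: continuous_on_eq_continuous_at)
        then have "(\<lambda>n. ?T' (\<phi> n x)) \<longlonglongrightarrow> ?T' (u x)" using elim by (rule isCont_tendsto_compose)
        then have "(\<lambda>n. (norm ((?T' (\<phi> n x) - ?T' (u x)) *\<^sub>R ?G x))\<^sup>2) \<longlonglongrightarrow> (norm ((?T' (u x) - ?T' (u x)) *\<^sub>R ?G x))\<^sup>2"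
          by (intro tendsto_intros)
        then show ?case by (simp add: e2_def)
      qed
      show "AE x in \<mu>. norm ((norm (e2 n x))\<^sup>2) \<le> 16 * (norm (?G x))\<^sup>2" for n
        using power_mono[OF e2b norm_ge_zero, of n _ 2] by (intro AE_I2) (simp add: power_mult_distrib)
    qed (use e2L2 in \<open>auto simp: space_L2_def\<close>)
    then have "(\<lambda>n. sqrt ((norm (l2_on \<Omega> (e2 n)))\<^sup>2)) \<longlonglongrightarrow> sqrt 0"
      by (intro tendsto_real_sqrt) (simp add: norm_l2_on[OF domain_lebesgue e2L2])
    then show ?thesis by (simp add: tendsto_norm_zero_iff)
  qed
  ultimately have "(\<lambda>n. l2_on \<Omega> (e1 n) + l2_on \<Omega> (e2 n) + l2_on \<Omega> (\<lambda>x. ?T' (u x) *\<^sub>R ?G x)) \<longlonglongrightarrow> 0 + 0 + l2_on \<Omega> (\<lambda>x. ?T' (u x) *\<^sub>R ?G x)"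
    by (intro tendsto_add tendsto_const)
  moreover have "l2_on \<Omega> (e1 n) + l2_on \<Omega> (e2 n) + l2_on \<Omega> (\<lambda>x. ?T' (u x) *\<^sub>R ?G x) = l2_on \<Omega> (classical_gradient (\<lambda>x. ?T (\<phi> n x)))" for n
  proof -
    have "(\<lambda>x. e1 n x + e2 n x + ?T' (u x) *\<^sub>R ?G x) = classical_gradient (\<lambda>x. ?T (\<phi> n x))"
      by (simp add: grad e1_def e2_def fun_eq_iff algebra_simps)
    then show ?thesis
      using l2_on_add[OF domain_lebesgue e1L2[of n] e2L2[of n]]
        l2_on_add[OF domain_lebesgue space_L2_add[OF domain_lebesgue e1L2[of n] e2L2[of n]] TGL2] by simp
  qed
  ultimately have "(\<lambda>n. l2_on \<Omega> (classical_gradient (\<lambda>x. ?T (\<phi> n x)))) \<longlonglongrightarrow> l2_on \<Omega> (\<lambda>x. ?T' (u x) *\<^sub>R ?G x)" by simp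
  then have "(\<lambda>n. jet (\<lambda>x. ?T (\<phi> n x))) \<longlonglongrightarrow> (l2_on \<Omega> (\<lambda>x. ?T (u x)), l2_on \<Omega> (\<lambda>x. ?T' (u x) *\<^sub>R ?G x))"
    unfolding test_function_W12(2)[OF T\<phi>] by (intro tendsto_Pair LIM_zero_cancel[OF cT])
  moreover have "jet (\<lambda>x. ?T (\<phi> n x)) \<in> sobolev_jets" for n
    by (rule W012_jet[OF test_function_W012[OF T\<phi>]])
  moreover have "closed sobolev_jets" by (simp add: sobolev_jets_def)
  ultimately have "(l2_on \<Omega> (\<lambda>x. ?T (u x)), l2_on \<Omega> (\<lambda>x. ?T' (u x) *\<^sub>R ?G x)) \<in> sobolev_jets"
    by (metis (no_types) closed_sequentially)
  from W012_of_jet(1,3)[OF TuL2 TGL2 this]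
  show "(\<lambda>x. ?T (u x)) \<in> W012 \<Omega>" 
    "AE x in \<mu>. weak_gradient \<Omega> (\<lambda>x. ?T (u x)) x = ?T' (u x) *\<^sub>R ?G x" .
qed

section \<open>Duality and weak convergence\<close>

text \<open>Boundedness forces an element of the dual to agree on functions with equal jets, so it
  factors through \<open>jet\<close> and the Riesz theorem on \<open>sobolev_jets\<close> represents
  it. Weak convergence in \<open>W012\<close> thereby becomes weak convergence of jets.\<close>

lemma W012_dual_iff:
  "g \<in> W012_dual \<Omega> \<longleftrightarrow> (\<exists>p. \<forall>u\<in>W012 \<Omega>. g u = p \<bullet> jet u)"
proof
  assume g: "g \<in> W012_dual \<Omega>"
  have add: "g (\<lambda>x. u x + v x) = g u + g v" if "u \<in> W012 \<Omega>" "v \<in> W012 \<Omega>" for u v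
    using g that by (simp add: W012_dual_def)
  have scale: "g (\<lambda>x. c * u x) = c * g u" if "u \<in> W012 \<Omega>" for c u
    using g that by (simp add: W012_dual_def)
  obtain C where "\<forall>u\<in>W012 \<Omega>. \<bar>g u\<bar> \<le> C * norm_W12 \<Omega> u"
    using g unfolding W012_dual_def by blast
  then have C: "\<And>u. u \<in> W012 \<Omega> \<Longrightarrow> \<bar>g u\<bar> \<le> C * norm (jet u)"
    using norm_W12_eq[OF W012_W12] by metis
  have wd: "g u = g v" if uv: "u \<in> W012 \<Omega>" "v \<in> W012 \<Omega>" "jet u = jet v" for u v
  proof -
    have "g (\<lambda>x. u x + (-1) * v x) = g u + (-1) * g v"
      using add[OF uv(1) W012_scale[OF uv(2)]] scale[OF uv(2)] by metis
    moreover have "\<bar>g (\<lambda>x. u x - v x)\<bar> \<le> C * norm (jet (\<lambda>x. u x - v x))"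
      by (rule C[OF W012_diff[OF uv(1,2)]])
    ultimately show ?thesis using uv by (simp add: W12_diff W012_W12)
  qed
  define F where "F s = g (SOME u. u \<in> W012 \<Omega> \<and> jet u = s)" for s
  have F: "F (jet u) = g u" if "u \<in> W012 \<Omega>" for u
  proof -
    have "(SOME v. v \<in> W012 \<Omega> \<and> jet v = jet u) \<in> W012 \<Omega> \<and> jet (SOME v. v \<in> W012 \<Omega> \<and> jet v = jet u) = jet u"
      by (rule someI[of _ u]) (simp add: that)
    then show ?thesis unfolding F_def using wd that by blast
  qed
  have "bounded_functional_on sobolev_jets F"
    unfolding bounded_functional_on_def
  proof (intro conjI ballI allI exI)
    show "F (s + t) = F s + F t" if st: "s \<in> sobolev_jets" "t \<in> sobolev_jets" for s t
    proof -
      obtain u where "u \<in> W012 \<Omega>" "jet u = s" by (rule sobolev_jets_surj[OF st(1)])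
      moreover obtain v where "v \<in> W012 \<Omega>" "jet v = t" by (rule sobolev_jets_surj[OF st(2)])
      ultimately show ?thesis using F[OF W012_add[of u v]] F[of u] F[of v] add[of u v] W12_add(2)[of u v] W012_W12 by simp
    qed
    show "F (c *\<^sub>R s) = c * F s" if s: "s \<in> sobolev_jets" for c s
    proof -
      obtain u where "u \<in> W012 \<Omega>" "jet u = s" by (rule sobolev_jets_surj[OF s])
      then show ?thesis using F[OF W012_scale[of u c]] F[of u] scale[of u c] W12_scale(2)[of u c] W012_W12 by simp
    qed
    show "\<bar>F s\<bar> \<le> C * norm s" if s: "s \<in> sobolev_jets" for s
    proof -
      obtain u where "u \<in> W012 \<Omega>" "jet u = s" by (rule sobolev_jets_surj[OF s])
      then show ?thesis using F[of u] C[of u] by simp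
    qed
  qed
  then obtain p where "\<And>s. s \<in> sobolev_jets \<Longrightarrow> F s = p \<bullet> s"
    using riesz_representation_on[OF subspace_sobolev_jets complete_sobolev_jets] by blast
  then show "\<exists>p. \<forall>u\<in>W012 \<Omega>. g u = p \<bullet> jet u" using F W012_jet by metis
next
  assume "\<exists>p. \<forall>u\<in>W012 \<Omega>. g u = p \<bullet> jet u"
  then obtain p where p: "\<And>u. u \<in> W012 \<Omega> \<Longrightarrow> g u = p \<bullet> jet u" by blast
  show "g \<in> W012_dual \<Omega>"
    unfolding W012_dual_def
  proof (intro CollectI conjI ballI allI exI)
    fix u v assume uv: "u \<in> W012 \<Omega>" "v \<in> W012 \<Omega>"
    show "g (\<lambda>x. u x + v x) = g u + g v"
      using uv by (simp add: p W012_add W12_add(2) W012_W12 inner_add_right)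
  next
    fix c u assume u: "u \<in> W012 \<Omega>"
    show "g (\<lambda>x. c * u x) = c * g u"
      using u by (simp add: p W012_scale W12_scale(2) W012_W12)
    show "\<bar>g u\<bar> \<le> norm p * norm_W12 \<Omega> u"
      using u by (simp add: p norm_W12_eq W012_W12 Cauchy_Schwarz_ineq2)
  qed
qed

lemma weakly_converges_W012_iff:
  assumes "\<And>n. u n \<in> W012 \<Omega>" "u0 \<in> W012 \<Omega>"
  shows "weakly_converges_W012 \<Omega> u u0 \<longleftrightarrow> (\<forall>p. (\<lambda>n. jet (u n) \<bullet> p) \<longlonglongrightarrow> jet u0 \<bullet> p)"
proof
  assume L: "weakly_converges_W012 \<Omega> u u0"
  show "\<forall>p. (\<lambda>n. jet (u n) \<bullet> p) \<longlonglongrightarrow> jet u0 \<bullet> p"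
  proof
    fix p
    have "(\<lambda>u. p \<bullet> jet u) \<in> W012_dual \<Omega>" unfolding W012_dual_iff by blast
    then show "(\<lambda>n. jet (u n) \<bullet> p) \<longlonglongrightarrow> jet u0 \<bullet> p"
      using L by (auto simp: weakly_converges_W012_def inner_commute[of p])
  qed
next
  assume R: "\<forall>p. (\<lambda>n. jet (u n) \<bullet> p) \<longlonglongrightarrow> jet u0 \<bullet> p"
  show "weakly_converges_W012 \<Omega> u u0"
    unfolding weakly_converges_W012_def
  proof (intro conjI allI ballI assms)
    fix g assume "g \<in> W012_dual \<Omega>"
    then obtain p where "\<And>u. u \<in> W012 \<Omega> \<Longrightarrow> g u = p \<bullet> jet u" by (auto simp: W012_dual_iff)
    then have "g (u n) = jet (u n) \<bullet> p" "g u0 = jet u0 \<bullet> p" for n using assms by (simp_all only: inner_commute)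
    then show "(\<lambda>n. g (u n)) \<longlonglongrightarrow> g u0" using R[rule_format, of p] by (simp only:)
  qed
qed

end

section \<open>Energy forms and equi-integrability of weakly convergent sequences\<close>

lemma norm_matrix_vector_mult_le:
  fixes A :: "real^'n::finite^'m::finite"
  shows "norm (A *v x) \<le> norm A * norm x"
proof -
  have "norm (A *v x) = L2_set (\<lambda>i. norm ((A *v x) $ i)) UNIV" by (simp add: norm_vec_def)
  also have "\<dots> \<le> L2_set (\<lambda>i. norm (A $ i) * norm x) UNIV"
    by (intro L2_set_mono) (auto simp: matrix_vector_mul_component Cauchy_Schwarz_ineq2)
  also have "\<dots> = norm A * norm x" by (simp add: norm_vec_def L2_set_left_distrib)
  finally show ?thesis .
qed

lemma bounded_bilinear_matrix_vector_mult:
  "bounded_bilinear ((*v) :: real^'n::finite^'m::finite \<Rightarrow> real^'n \<Rightarrow> real^'m)"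
proof
  show "(A + B) *v x = A *v x + B *v x" for A B :: "real^'n^'m" and x
    by (rule matrix_vector_mult_add_rdistrib)
  show "A *v (x + y) = A *v x + A *v y" for A :: "real^'n^'m" and x y
    by (rule matrix_vector_right_distrib)
  show "(r *\<^sub>R A) *v x = r *\<^sub>R (A *v x)" for r and A :: "real^'n^'m" and x
    by (simp add: vec_eq_iff matrix_vector_mul_component)
  show "A *v (r *\<^sub>R x) = r *\<^sub>R (A *v x)" for r and A :: "real^'n^'m" and x
    by (simp add: vec_eq_iff matrix_vector_mul_component)
  show "\<exists>K. \<forall>(A :: real^'n^'m) x. norm (A *v x) \<le> norm A * norm x * K"
    using norm_matrix_vector_mult_le by (intro exI[of _ 1]) auto
qed

lemma borel_measurable_matrix_vector_mult:
  fixes M :: "'a \<Rightarrow> real^'n::finite^'m::finite"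
  assumes "M \<in> borel_measurable N" "G \<in> borel_measurable N"
  shows "(\<lambda>x. M x *v G x) \<in> borel_measurable N"
  using assms
  by (rule borel_measurable_continuous_Pair)
     (intro bounded_bilinear.continuous_on[OF bounded_bilinear_matrix_vector_mult] continuous_on_fst continuous_on_snd continuous_on_id)

lemma LIMSEQ_subsequence_principle:
  fixes X :: "nat \<Rightarrow> 'a::metric_space"
  assumes "\<And>r :: nat \<Rightarrow> nat. strict_mono r \<Longrightarrow> \<exists>s. strict_mono s \<and> (\<lambda>n. X (r (s n))) \<longlonglongrightarrow> l"
  shows "X \<longlonglongrightarrow> l"
proof (rule ccontr)
  assume "\<not> X \<longlonglongrightarrow> l"
  then obtain e where e: "e > 0" "\<forall>N. \<exists>n\<ge>N. dist (X n) l \<ge> e"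
    unfolding lim_sequentially by (auto simp: not_less)
  then have inf: "infinite {n. dist (X n) l \<ge> e}"
    by (auto simp: infinite_nat_iff_unbounded_le)
  define r where "r = enumerate {n. dist (X n) l \<ge> e}"
  have r: "strict_mono r" "dist (X (r n)) l \<ge> e" for n
    using strict_mono_enumerate[OF inf] enumerate_in_set[OF inf, of n] by (auto simp: r_def)
  obtain s where s: "strict_mono s" "(\<lambda>n. X (r (s n))) \<longlonglongrightarrow> l" using assms[OF r(1)] by blast
  then obtain N where "dist (X (r (s N))) l < e" using e(1) unfolding lim_sequentially by blast
  then show False using r(2)[of "s N"] by simp
qed

context bounded_open_set
begin

section \<open>The energy as a bilinear form on pairs\<close>

lemma square_integrable_L2:
  fixes f :: "real^'n \<Rightarrow> 'b::euclidean_space"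
  assumes f: "square_integrable f"
  shows "f \<in> space_L2 \<Omega>" "norm (l2_on \<Omega> f) \<le> norm (l2_of f)"
proof -
  have [measurable]: "f \<in> borel_measurable lebesgue" using f by (simp add: square_integrable_def)
  have i: "integrable lebesgue (\<lambda>x. indicator \<Omega> x *\<^sub>R (norm (f x))\<^sup>2)"
    using f by (intro integrable_mult_indicator) (auto simp: square_integrable_def)
  moreover have eq: "(\<lambda>x. indicator \<Omega> x *\<^sub>R (norm (f x))\<^sup>2) = (\<lambda>x. (norm (indicator \<Omega> x *\<^sub>R f x))\<^sup>2)"
    by (auto simp: indicator_def fun_eq_iff)
  ultimately have s: "square_integrable (\<lambda>x. indicator \<Omega> x *\<^sub>R f x)"
    by (simp add: square_integrable_def)
  then show "f \<in> space_L2 \<Omega>" by (simp add: space_L2_iff)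
  show "norm (l2_on \<Omega> f) \<le> norm (l2_of f)"
  proof (rule power2_le_imp_le)
    show "(norm (l2_on \<Omega> f))\<^sup>2 \<le> (norm (l2_of f))\<^sup>2"
      unfolding l2_on_def norm_l2_of[OF s] norm_l2_of[OF f]
      using s f by (intro integral_mono) (auto simp: square_integrable_def indicator_def)
  qed simp
qed

text \<open>Multiplication by a matrix function acts on functions rather than on classes, so a
  representative is chosen. The choice is linear only almost everywhere, as \<open>l2_rep_AE\<close>
  records.\<close>

definition l2_rep :: "(real^'n, 'b::euclidean_space) l2 \<Rightarrow> real^'n \<Rightarrow> 'b" where
  "l2_rep F = (SOME f. square_integrable f \<and> l2_of f = F)"

lemma l2_rep: "square_integrable (l2_rep F)" "l2_of (l2_rep F) = F"
proof -
  have "\<exists>f. square_integrable f \<and> l2_of f = F" using l2_cases[of F] by metis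
  from someI_ex[OF this] show "square_integrable (l2_rep F)" "l2_of (l2_rep F) = F"
    by (simp_all add: l2_rep_def)
qed

lemma l2_rep_AE:
  "AE x in \<mu>. l2_rep (F + G) x = l2_rep F x + l2_rep G x"
  "AE x in \<mu>. l2_rep (c *\<^sub>R F) x = c *\<^sub>R l2_rep F x"
  "f \<in> space_L2 \<Omega> \<Longrightarrow> AE x in \<mu>. l2_rep (l2_on \<Omega> f) x = f x"
proof -
  have "AE x in lebesgue. l2_rep (F + G) x = l2_rep F x + l2_rep G x"
    using l2_of_eq_iff[OF l2_rep(1)[of "F + G"] square_integrable_add[OF l2_rep(1) l2_rep(1)], of F G]
    by (simp add: l2_rep l2_of_add)
  then show "AE x in \<mu>. l2_rep (F + G) x = l2_rep F x + l2_rep G x"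
    unfolding AE_lebesgue_on_iff[OF domain_lebesgue] by eventually_elim simp
  have "AE x in lebesgue. l2_rep (c *\<^sub>R F) x = c *\<^sub>R l2_rep F x"
    using l2_of_eq_iff[OF l2_rep(1)[of "c *\<^sub>R F"] square_integrable_scaleR[OF l2_rep(1)], of c F]
    by (simp add: l2_rep l2_of_scaleR)
  then show "AE x in \<mu>. l2_rep (c *\<^sub>R F) x = c *\<^sub>R l2_rep F x"
    unfolding AE_lebesgue_on_iff[OF domain_lebesgue] by eventually_elim simp
  assume f: "f \<in> space_L2 \<Omega>"
  have "AE x in lebesgue. l2_rep (l2_on \<Omega> f) x = indicator \<Omega> x *\<^sub>R f x"
    using l2_of_eq_iff[OF l2_rep(1)[of "l2_on \<Omega> f"] f[unfolded space_L2_iff[OF domain_lebesgue]]]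
    by (simp add: l2_rep l2_on_def)
  then show "AE x in \<mu>. l2_rep (l2_on \<Omega> f) x = f x"
    unfolding AE_lebesgue_on_iff[OF domain_lebesgue] by eventually_elim auto
qed

lemma l2_rep_L2: "l2_rep F \<in> space_L2 \<Omega>" "norm (l2_on \<Omega> (l2_rep F)) \<le> norm F"
  using square_integrable_L2[OF l2_rep(1)[of F]] by (simp_all add: l2_rep)

definition matrix_l2 :: "(real^'n \<Rightarrow> real^'n^'n) \<Rightarrow> (real^'n, real^'n) l2 \<Rightarrow> (real^'n, real^'n) l2" where
  "matrix_l2 M F = l2_on \<Omega> (\<lambda>x. M x *v l2_rep F x)"

text \<open>Extends \<open>energy_form\<close> from Sobolev functions to all pairs, where it is a
  bounded bilinear form in the sense that \<open>lax_milgram_on\<close> requires. The lemma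
  \<open>energy_jet\<close> is the link between the two.\<close>

definition energy :: "(real^'n \<Rightarrow> real^'n^'n) \<Rightarrow> (real^'n, real) l2 \<times> (real^'n, real^'n) l2 \<Rightarrow>
    (real^'n, real) l2 \<times> (real^'n, real^'n) l2 \<Rightarrow> real" where
  "energy M s t = matrix_l2 M (snd s) \<bullet> snd t"

lemma matrix_vector_L2:
  assumes M: "M \<in> borel_measurable \<mu>" "AE x in \<mu>. norm (M x) \<le> C"
    and G: "G \<in> space_L2 \<Omega>"
  shows "(\<lambda>x. (M x :: real^'n^'n) *v G x) \<in> space_L2 \<Omega>" "AE x in \<mu>. norm (M x *v G x) \<le> C * norm (G x)"
proof -
  show b: "AE x in \<mu>. norm (M x *v G x) \<le> C * norm (G x)"
    using M(2) by eventually_elim (meson mult_right_mono norm_ge_zero norm_matrix_vector_mult_le order_trans)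
  show "(\<lambda>x. M x *v G x) \<in> space_L2 \<Omega>"
    by (rule space_L2_dominated[OF borel_measurable_matrix_vector_mult[OF M(1)] G b])
       (use G in \<open>simp add: space_L2_def\<close>)
qed

context
  fixes M :: "real^'n \<Rightarrow> real^'n^'n" and C :: real
  assumes M: "M \<in> borel_measurable \<mu>" "AE x in \<mu>. norm (M x) \<le> C" and C: "C \<ge> 0"
begin

lemma norm_matrix_l2: "norm (matrix_l2 M F) \<le> C * norm F"
proof -
  have "norm (matrix_l2 M F) \<le> C * norm (l2_on \<Omega> (l2_rep F))"
    unfolding matrix_l2_def
    by (rule norm_l2_on_le[OF matrix_vector_L2(1)[OF M l2_rep_L2(1)] l2_rep_L2(1) C matrix_vector_L2(2)[OF M l2_rep_L2(1)]])
  also have "\<dots> \<le> C * norm F" using C l2_rep_L2(2) by (rule mult_left_mono[rotated])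
  finally show ?thesis .
qed

lemma matrix_l2_linear:
  "matrix_l2 M (F + G) = matrix_l2 M F + matrix_l2 M G" "matrix_l2 M (c *\<^sub>R F) = c *\<^sub>R matrix_l2 M F"
proof -
  note L2 = matrix_vector_L2(1)[OF M l2_rep_L2(1)]
  have "matrix_l2 M (F + G) = l2_on \<Omega> (\<lambda>x. M x *v l2_rep F x + M x *v l2_rep G x)"
    unfolding matrix_l2_def l2_on_eq_iff[OF domain_lebesgue L2 space_L2_add[OF domain_lebesgue L2 L2]]
    using l2_rep_AE(1)[of F G] by eventually_elim (simp add: matrix_vector_right_distrib)
  then show "matrix_l2 M (F + G) = matrix_l2 M F + matrix_l2 M G"
    by (simp add: matrix_l2_def l2_on_add[OF domain_lebesgue L2 L2])
  have "matrix_l2 M (c *\<^sub>R F) = l2_on \<Omega> (\<lambda>x. c *\<^sub>R (M x *v l2_rep F x))"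
    unfolding matrix_l2_def l2_on_eq_iff[OF domain_lebesgue L2 space_L2_scaleR[OF domain_lebesgue L2]]
    using l2_rep_AE(2)[of c F]
    by eventually_elim (simp add: bounded_bilinear.scaleR_right[OF bounded_bilinear_matrix_vector_mult])
  then show "matrix_l2 M (c *\<^sub>R F) = c *\<^sub>R matrix_l2 M F"
    by (simp add: matrix_l2_def l2_on_scaleR[OF domain_lebesgue L2])
qed

lemma abs_energy_le: "\<bar>energy M s t\<bar> \<le> C * norm (snd s) * norm (snd t)"
  unfolding energy_def
  by (rule order_trans[OF Cauchy_Schwarz_ineq2]) (intro mult_right_mono norm_matrix_l2 norm_ge_zero)

lemma bounded_bilinear_energy: "bounded_bilinear (energy M)"
proof
  show "energy M (s + s') t = energy M s t + energy M s' t" for s s' t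
    by (simp add: energy_def matrix_l2_linear inner_add_left)
  show "energy M s (t + t') = energy M s t + energy M s t'" for s t t'
    by (simp add: energy_def inner_add_right)
  show "energy M (r *\<^sub>R s) t = r *\<^sub>R energy M s t" for r s t
    by (simp add: energy_def matrix_l2_linear)
  show "energy M s (r *\<^sub>R t) = r *\<^sub>R energy M s t" for r s t
    by (simp add: energy_def)
  show "\<exists>K. \<forall>s t. norm (energy M s t) \<le> norm s * norm t * K"
  proof (intro exI allI)
    fix s t :: "(real^'n, real) l2 \<times> (real^'n, real^'n) l2"
    have s: "norm (snd s) \<le> norm s" and t: "norm (snd t) \<le> norm t"
      using norm_snd_le[of "snd s" "fst s"] norm_snd_le[of "snd t" "fst t"] by simp_all
    have "norm (energy M s t) \<le> C * (norm (snd s) * norm (snd t))"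
      using abs_energy_le[of s t] by (simp add: mult.assoc)
    also have "\<dots> \<le> C * (norm s * norm t)"
      using s t C by (intro mult_left_mono mult_mono) auto
    finally show "norm (energy M s t) \<le> norm s * norm t * C" by (simp add: mult.commute)
  qed
qed

lemma energy_jet:
  assumes u: "u \<in> W12 \<Omega>" and v: "v \<in> W12 \<Omega>"
  shows "energy M (jet u) (jet v) = energy_form \<Omega> M u v"
proof -
  note gu = weak_gradient_props(1)[OF u] and gv = weak_gradient_props(1)[OF v]
  have "matrix_l2 M (l2_on \<Omega> (weak_gradient \<Omega> u)) = l2_on \<Omega> (\<lambda>x. M x *v weak_gradient \<Omega> u x)"
    unfolding matrix_l2_def l2_on_eq_iff[OF domain_lebesgue matrix_vector_L2(1)[OF M l2_rep_L2(1)] matrix_vector_L2(1)[OF M gu]]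
    using l2_rep_AE(3)[OF gu] by eventually_elim simp
  then show ?thesis
    using inner_l2_on[OF domain_lebesgue matrix_vector_L2(1)[OF M gu] gv]
    by (simp add: energy_def jet_def energy_form_def)
qed

lemma energy_form_integrable:
  assumes u: "u \<in> W12 \<Omega>" and v: "v \<in> W12 \<Omega>"
  shows "integrable \<mu> (\<lambda>x. (M x *v weak_gradient \<Omega> u x) \<bullet> weak_gradient \<Omega> v x)"
  by (rule integrable_inner_space_L2[OF domain_lebesgue matrix_vector_L2(1)[OF M weak_gradient_props(1)[OF u]] weak_gradient_props(1)[OF v]])

context
  fixes c :: real
  assumes ell: "AE x in \<mu>. \<forall>\<xi>. c * (norm \<xi>)\<^sup>2 \<le> (M x *v \<xi>) \<bullet> \<xi>" and c: "c > 0"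
begin

text \<open>Ellipticity controls the gradient component; the Poincare inequality upgrades this to
  the full norm in \<open>coercive_constant\<close>.\<close>

lemma energy_coercive:
  assumes "s \<in> sobolev_jets" shows "c * (norm (snd s))\<^sup>2 \<le> energy M s s"
proof -
  obtain u where u: "u \<in> W012 \<Omega>" "jet u = s" by (rule sobolev_jets_surj[OF assms])
  note uW = W012_W12[OF u(1)] 
  note gu = weak_gradient_props(1)[OF uW]
  have "c * (norm (snd s))\<^sup>2 = (LINT x|\<mu>. c * (norm (weak_gradient \<Omega> u x))\<^sup>2)"
    using norm_l2_on[OF domain_lebesgue gu] by (simp add: u(2)[symmetric] jet_def)
  also have "\<dots> \<le> energy_form \<Omega> M u u"
    unfolding energy_form_def
    using gu ell by (intro integral_mono_AE energy_form_integrable uW) (auto simp: space_L2_def elim: AE_mp)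
  finally show ?thesis using energy_jet[OF uW uW] u(2) by simp
qed

text \<open>The gradient of \<open>v\<close> is \<open>t\<close> times that of \<open>u\<close> with
  \<open>0 \<le> t \<le> 4\<close>, so \<open>t\<close> times the ellipticity bound dominates
  \<open>c / 4\<close> times the squared gradient of \<open>v\<close>. Both orders of the arguments
  are recorded, since the form is not symmetric and the second order serves the adjoint
  problem.\<close>

lemma energy_truncated:
  assumes u: "u \<in> W012 \<Omega>" and q: "q \<ge> 0"
  defines "v \<equiv> \<lambda>x. truncated q (u x)"
  shows "c / 4 * (norm (snd (jet v)))\<^sup>2 \<le> energy_form \<Omega> M u v" "c / 4 * (norm (snd (jet v)))\<^sup>2 \<le> energy_form \<Omega> M v u"
proof -
  have v: "v \<in> W012 \<Omega>" and grad: "AE x in \<mu>. weak_gradient \<Omega> v x = truncated_deriv q (u x) *\<^sub>R weak_gradient \<Omega> u x"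
    using truncated_W012[OF u q] by (simp_all add: v_def)
  note uW = W012_W12[OF u] and vW = W012_W12[OF v]
  note gv = weak_gradient_props(1)[OF vW]
  have bound: "AE x in \<mu>. c / 4 * (norm (weak_gradient \<Omega> v x))\<^sup>2 \<le> (M x *v weak_gradient \<Omega> u x) \<bullet> weak_gradient \<Omega> v x
      \<and> c / 4 * (norm (weak_gradient \<Omega> v x))\<^sup>2 \<le> (M x *v weak_gradient \<Omega> v x) \<bullet> weak_gradient \<Omega> u x"
    using grad ell
  proof eventually_elim
    case (elim x)
    let ?t = "truncated_deriv q (u x)" and ?g = "weak_gradient \<Omega> u x"
    have t: "0 \<le> ?t" "?t \<le> 4" by (rule truncated_deriv_nonneg, rule truncated_deriv_le)
    have "c / 4 * (norm (?t *\<^sub>R ?g))\<^sup>2 = ?t * ((?t / 4) * (c * (norm ?g)\<^sup>2))"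
      using t by (simp add: power_mult_distrib power2_eq_square)
    also have "\<dots> \<le> ?t * (1 * (c * (norm ?g)\<^sup>2))"
      using t c by (intro mult_left_mono mult_right_mono) auto
    also have "\<dots> \<le> ?t * ((M x *v ?g) \<bullet> ?g)"
      using elim(2) t by (intro mult_left_mono) auto
    finally have "c / 4 * (norm (?t *\<^sub>R ?g))\<^sup>2 \<le> ?t * ((M x *v ?g) \<bullet> ?g)" .
    then show ?case
      unfolding elim(1) by (simp add: bounded_bilinear.scaleR_right[OF bounded_bilinear_matrix_vector_mult])
  qed
  have "c / 4 * (norm (snd (jet v)))\<^sup>2 = (LINT x|\<mu>. c / 4 * (norm (weak_gradient \<Omega> v x))\<^sup>2)"
    using norm_l2_on[OF domain_lebesgue gv] by (simp add: jet_def)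
  moreover have "(LINT x|\<mu>. c / 4 * (norm (weak_gradient \<Omega> v x))\<^sup>2) \<le> energy_form \<Omega> M u v"
    unfolding energy_form_def using gv bound
    by (intro integral_mono_AE energy_form_integrable uW vW) (auto simp: space_L2_def elim: AE_mp)
  moreover have "(LINT x|\<mu>. c / 4 * (norm (weak_gradient \<Omega> v x))\<^sup>2) \<le> energy_form \<Omega> M v u"
    unfolding energy_form_def using gv bound
    by (intro integral_mono_AE energy_form_integrable uW vW) (auto simp: space_L2_def elim: AE_mp)
  ultimately show "c / 4 * (norm (snd (jet v)))\<^sup>2 \<le> energy_form \<Omega> M u v" "c / 4 * (norm (snd (jet v)))\<^sup>2 \<le> energy_form \<Omega> M v u"
    by (simp_all only:)
qed

text \<open>The weak maximum principle: the sign forces the truncation to have zero gradient, hence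
  to vanish by Poincare, and it vanishes exactly where the bound holds. The two alternatives belong
  to the equation and to its adjoint.\<close>

lemma AE_bounded_of_energy_truncated:
  assumes u: "u \<in> W012 \<Omega>" and q: "q \<ge> 0"
    and "energy_form \<Omega> M u (\<lambda>x. truncated q (u x)) \<le> 0 \<or> energy_form \<Omega> M (\<lambda>x. truncated q (u x)) u \<le> 0"
  shows "AE x in \<mu>. \<bar>u x\<bar> \<le> q"
proof -
  define v where "v x = truncated q (u x)" for x
  have v: "v \<in> W012 \<Omega>" using truncated_W012[OF u q] by (simp add: v_def[abs_def])
  have "c / 4 * (norm (snd (jet v)))\<^sup>2 \<le> 0"
    using energy_truncated[OF u q] assms(3) by (auto simp: v_def[abs_def])
  then have "snd (jet v) = 0" using c by (simp add: mult_le_0_iff)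
  then have "jet v = 0" using W012_jet[OF v] by (rule sobolev_jets_zeroI[rotated])
  then have "l2_on \<Omega> v = l2_on \<Omega> (\<lambda>x. 0 * v x)"
    using l2_on_scaleR[OF domain_lebesgue W12_L2[OF W012_W12[OF v]], of 0] by (simp add: jet_def prod_eq_iff)
  then have "AE x in \<mu>. v x = 0"
    using l2_on_eq_iff[OF domain_lebesgue W12_L2[OF W012_W12[OF v]] W12_L2[OF W012_W12[OF W012_scale[OF v, of 0]]]] by simp
  then show ?thesis by eventually_elim (use truncated_eq_0_iff[OF q] in \<open>auto simp: v_def\<close>)
qed

end

end

section \<open>Equi-integrability\<close>

text \<open>The argument of Vitali-Hahn-Saks. The unit ball of essentially bounded functions is
  complete in the L2 metric and is covered by the closed sets \<open>FF {N..}\<close> because every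
  single sequence of integrals tends to 0. By Baire one of them contains a relative ball, and
  modifying its centre on a set of small measure stays inside this ball.\<close>

lemma weakly_null_L1_uniform:
  assumes b: "\<And>n. integrable \<mu> (b n)"
    and weak: "\<And>h. h \<in> space_Linf \<Omega> \<Longrightarrow> (\<lambda>n. LINT x|\<mu>. b n x * h x) \<longlonglongrightarrow> (0::real)"
    and e: "e > 0"
  obtains \<delta> N where "\<delta> > 0" "\<And>n w E. n \<ge> N \<Longrightarrow> w \<in> borel_measurable \<mu> \<Longrightarrow>
    (AE x in \<mu>. \<bar>w x\<bar> \<le> 1) \<Longrightarrow> E \<in> sets \<mu> \<Longrightarrow> measure \<mu> E < \<delta> \<Longrightarrow>
    \<bar>LINT x|\<mu>. b n x * (w x * indicator E x)\<bar> \<le> e"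
proof -
  define UB where "UB = {h :: real^'n \<Rightarrow> real. h \<in> borel_measurable \<mu> \<and> (AE x in \<mu>. \<bar>h x\<bar> \<le> 1)}"
  \<comment> \<open>The bound is \<open>e / 2\<close> because two such integrals are subtracted at
    the end. The parameter \<open>P\<close> lets the whole unit ball appear as the case of the empty
    set.\<close>
  define FF where "FF P = {l2_on \<Omega> h |h. h \<in> UB \<and> (\<forall>n\<in>P. \<bar>LINT x|\<mu>. b n x * h x\<bar> \<le> e / 2)}" for P
  have UB_L2: "h \<in> space_L2 \<Omega>" if "h \<in> UB" for h
    using that by (intro space_L2_bounded[of _ 1]) (auto simp: UB_def)
  have UB_Linf: "h \<in> space_Linf \<Omega>" if "h \<in> UB" for h
    using that by (auto simp: UB_def space_Linf_def)
  have bmeas [measurable]: "b n \<in> borel_measurable \<mu>" for n using b[of n] by simp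
  have UB_int: "integrable \<mu> (\<lambda>x. b n x * h x)" if "h \<in> UB" for n h
  proof (rule Bochner_Integration.integrable_bound[OF b[of n]])
    have [measurable]: "h \<in> borel_measurable \<mu>" using that by (simp add: UB_def)
    show "(\<lambda>x. b n x * h x) \<in> borel_measurable \<mu>" by measurable
    have "AE x in \<mu>. \<bar>h x\<bar> \<le> 1" using that by (simp add: UB_def)
    then show "AE x in \<mu>. norm (b n x * h x) \<le> norm (b n x)"
      by eventually_elim (simp add: abs_mult mult_left_le)
  qed
  \<comment> \<open>A limit in L2 is a limit almost everywhere along a subsequence, so the bound 1
    persists and dominated convergence preserves the bounds on the integrals.\<close>
  have closed: "closed (FF P)" for P
    unfolding closed_sequential_limits
  proof (intro allI impI, elim conjE)
    fix F l assume F: "\<forall>n. F n \<in> FF P" and l: "F \<longlonglongrightarrow> l"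
    then have "\<forall>k. \<exists>h. h \<in> UB \<and> (\<forall>n\<in>P. \<bar>LINT x|\<mu>. b n x * h x\<bar> \<le> e / 2) \<and> F k = l2_on \<Omega> h"
      by (auto simp: FF_def)
    then obtain h where h: "\<And>k. h k \<in> UB" "\<And>k n. n \<in> P \<Longrightarrow> \<bar>LINT x|\<mu>. b n x * h k x\<bar> \<le> e / 2"
      "\<And>k. F k = l2_on \<Omega> (h k)" by metis
    have "F = (\<lambda>k. l2_on \<Omega> (h k))" by (rule ext) (rule h(3))
    with l have lim: "(\<lambda>k. l2_on \<Omega> (h k)) \<longlonglongrightarrow> l" by simp
    obtain g where g: "g \<in> space_L2 \<Omega>" "l2_on \<Omega> g = l"
      by (rule l2_on_surj[OF domain_lebesgue UB_L2[OF h(1)] lim])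
    obtain r :: "nat \<Rightarrow> nat" where r: "strict_mono r" "AE x in \<mu>. (\<lambda>k. h (r k) x) \<longlonglongrightarrow> g x"
      using l2_on_AE_subsequence[OF UB_L2[OF h(1)] g(1), of "\<lambda>k. k"] lim g(2) by auto
    have hb: "AE x in \<mu>. \<forall>k. \<bar>h k x\<bar> \<le> 1" using h(1) by (subst AE_all_countable) (simp add: UB_def)
    have [measurable]: "g \<in> borel_measurable \<mu>" "h k \<in> borel_measurable \<mu>" for k
      using g(1) h(1) by (auto simp: space_L2_def UB_def)
    have "AE x in \<mu>. \<bar>g x\<bar> \<le> 1"
      using r(2) hb by eventually_elim (rule LIMSEQ_le_const2[OF tendsto_rabs], auto)
    then have gUB: "g \<in> UB" by (simp add: UB_def)
    have "\<bar>LINT x|\<mu>. b n x * g x\<bar> \<le> e / 2" if "n \<in> P" for n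
    proof (rule LIMSEQ_le_const2[OF tendsto_rabs])
      show "(\<lambda>k. LINT x|\<mu>. b n x * h (r k) x) \<longlonglongrightarrow> (LINT x|\<mu>. b n x * g x)"
      proof (rule integral_dominated_convergence[where w = "\<lambda>x. \<bar>b n x\<bar>"])
        show "AE x in \<mu>. (\<lambda>k. b n x * h (r k) x) \<longlonglongrightarrow> b n x * g x"
          using r(2) by eventually_elim (rule tendsto_mult_left)
        show "AE x in \<mu>. norm (b n x * h (r k) x) \<le> \<bar>b n x\<bar>" for k
          using hb by eventually_elim (simp add: abs_mult mult_left_le)
      qed (use b in auto)
    qed (use h(2) that in auto)
    then show "l \<in> FF P" using g(2) gUB by (auto simp: FF_def)
  qed
  define X where "X = FF {}"
  have X: "X = {l2_on \<Omega> h |h. h \<in> UB}" by (auto simp: X_def FF_def)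
  have FX: "FF P \<subseteq> X" for P by (auto simp: FF_def X)
  have "(\<lambda>_. 0) \<in> UB" by (simp add: UB_def)
  then have Xne: "X \<noteq> {}" by (auto simp: X)
  have cm: "completely_metrizable_space (top_of_set X)"
    using closed[of "{}"] by (intro completely_metrizable_space_closedin completely_metrizable_space_euclidean) (simp add: X_def)
  have union: "\<Union>(range (\<lambda>N. FF {N..})) = X"
  proof
    show "X \<subseteq> \<Union>(range (\<lambda>N. FF {N..}))"
    proof
      fix F assume "F \<in> X"
      then obtain h where h: "h \<in> UB" "F = l2_on \<Omega> h" by (auto simp: X)
      obtain N where "\<And>n. n \<ge> N \<Longrightarrow> \<bar>LINT x|\<mu>. b n x * h x\<bar> < e / 2"
        using LIMSEQ_D[OF weak[OF UB_Linf[OF h(1)]], of "e / 2"] e by auto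
      then have "F \<in> FF {N..}" using h by (auto simp: FF_def intro!: less_imp_le)
      then show "F \<in> \<Union>(range (\<lambda>N. FF {N..}))" by blast
    qed
  qed (use FX in blast)
  have "\<exists>N. top_of_set X interior_of FF {N..} \<noteq> {}"
  proof (rule ccontr)
    assume "\<not> ?thesis"
    then have "top_of_set X interior_of \<Union>(range (\<lambda>N. FF {N..})) = {}"
      using closed_subset[OF FX closed] by (intro Baire_category_alt disjI1 cm) auto
    then show False using Xne interior_of_topspace[of "top_of_set X"] by (simp add: union)
  qed
  then obtain N p T where T: "openin (top_of_set X) T" "p \<in> T" "T \<subseteq> FF {N..}"
    unfolding interior_of_def by blast
  then obtain \<rho> where \<rho>: "\<rho> > 0" "ball p \<rho> \<inter> X \<subseteq> T"
    unfolding openin_contains_ball by blast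
  have "p \<in> X" using T(2,3) FX by blast
  then obtain h0 where h0: "h0 \<in> UB" "p = l2_on \<Omega> h0" by (auto simp: X)
  have [measurable]: "h0 \<in> borel_measurable \<mu>" using h0 by (simp add: UB_def)
  have h0b: "AE x in \<mu>. \<bar>h0 x\<bar> \<le> 1" using h0 by (simp add: UB_def)
  \<comment> \<open>Replacing \<open>h0\<close> on \<open>E\<close> by values bounded by 1 changes
    it there by at most 2, which costs at most \<open>4 * measure \<mu> E\<close> in squared norm;
    hence the threshold \<open>\<rho>^2 / 4\<close>.\<close>
  have key: "\<bar>LINT x|\<mu>. b n x * (w x * indicator E x)\<bar> \<le> e"
    if n: "n \<ge> N" and w[measurable]: "w \<in> borel_measurable \<mu>" and wb: "AE x in \<mu>. \<bar>w x\<bar> \<le> 1"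
      and E[measurable]: "E \<in> sets \<mu>" and ME: "measure \<mu> E < \<rho>\<^sup>2 / 4" for n w E
  proof -
    have pert: "\<bar>LINT x|\<mu>. b n x * (h0 x + (k x - h0 x) * indicator E x)\<bar> \<le> e / 2"
      "(\<lambda>x. h0 x + (k x - h0 x) * indicator E x) \<in> UB"
      if k[measurable]: "k \<in> borel_measurable \<mu>" and kb: "AE x in \<mu>. \<bar>k x\<bar> \<le> 1" for k
    proof -
      let ?h = "\<lambda>x. h0 x + (k x - h0 x) * indicator E x"
      have "AE x in \<mu>. \<bar>?h x\<bar> \<le> 1"
        using h0b kb by eventually_elim (simp add: indicator_def)
      then show hUB: "?h \<in> UB" by (simp add: UB_def)
      have "(norm (l2_on \<Omega> ?h - p))\<^sup>2 = (LINT x|\<mu>. (norm (?h x - h0 x))\<^sup>2)"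
        unfolding h0(2) l2_on_diff[OF domain_lebesgue UB_L2[OF hUB] UB_L2[OF h0(1)], symmetric]
        by (rule norm_l2_on[OF domain_lebesgue space_L2_diff[OF domain_lebesgue UB_L2[OF hUB] UB_L2[OF h0(1)]]])
      also have "\<dots> \<le> (LINT x|\<mu>. 4 * indicator E x)"
      proof (rule integral_mono_AE)
        show "integrable \<mu> (\<lambda>x. (norm (?h x - h0 x))\<^sup>2)"
          using space_L2_diff[OF domain_lebesgue UB_L2[OF hUB] UB_L2[OF h0(1)]] by (simp add: space_L2_def)
        show "integrable \<mu> (\<lambda>x. 4 * indicator E x :: real)"
          by (intro integrable_mult_right integrable_real_indicator) (auto simp: less_top[symmetric])
        show "AE x in \<mu>. (norm (?h x - h0 x))\<^sup>2 \<le> 4 * indicator E x"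
          using h0b kb
        proof eventually_elim
          case (elim x)
          then have "\<bar>k x - h0 x\<bar> \<le> \<bar>2\<bar>" by linarith
          then have "(k x - h0 x)\<^sup>2 \<le> 2\<^sup>2" by (simp only: abs_le_square_iff)
          then show ?case by (simp add: indicator_def)
        qed
      qed
      also have "\<dots> = 4 * measure \<mu> E"
        using sets.sets_into_space[OF E] by (simp add: Int_absorb2)
      finally have "(norm (l2_on \<Omega> ?h - p))\<^sup>2 < \<rho>\<^sup>2" using ME by simp
      then have "norm (l2_on \<Omega> ?h - p) < \<rho>" using \<rho>(1) by (intro power2_less_imp_less[of _ \<rho>]) auto
      then have "l2_on \<Omega> ?h \<in> FF {N..}"
        using \<rho>(2) T(3) hUB X by (auto simp: dist_norm norm_minus_commute subset_iff)
      then obtain h' where h': "h' \<in> UB" "\<bar>LINT x|\<mu>. b n x * h' x\<bar> \<le> e / 2" "l2_on \<Omega> ?h = l2_on \<Omega> h'"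
        using n unfolding FF_def by blast
      have ae: "AE x in \<mu>. ?h x = h' x"
        using l2_on_eq_iff[OF domain_lebesgue UB_L2[OF hUB] UB_L2[OF h'(1)]] h'(3) by simp
      have "(LINT x|\<mu>. b n x * ?h x) = (LINT x|\<mu>. b n x * h' x)"
      proof (rule integral_cong_AE)
        show "AE x in \<mu>. b n x * ?h x = b n x * h' x" using ae by eventually_elim simp
        show "(\<lambda>x. b n x * h' x) \<in> borel_measurable \<mu>" using UB_int[OF h'(1), of n] by simp
      qed measurable
      then show "\<bar>LINT x|\<mu>. b n x * ?h x\<bar> \<le> e / 2" using h'(2) by simp
    qed
    have p0: "(\<lambda>_. 0) \<in> borel_measurable \<mu>" "AE x in \<mu>. \<bar>0::real\<bar> \<le> 1" by auto
    \<comment> \<open>The two modifications of \<open>h0\<close> coincide off \<open>E\<close>, and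
      their difference is exactly \<open>w x * indicator E x\<close>.\<close>
    let ?h1 = "\<lambda>x. h0 x + (w x - h0 x) * indicator E x" and ?h2 = "\<lambda>x. h0 x + (0 - h0 x) * indicator E x"
    have "(LINT x|\<mu>. b n x * (w x * indicator E x)) = (LINT x|\<mu>. b n x * ?h1 x - b n x * ?h2 x)"
      by (intro Bochner_Integration.integral_cong) (auto simp: algebra_simps)
    also have "\<dots> = (LINT x|\<mu>. b n x * ?h1 x) - (LINT x|\<mu>. b n x * ?h2 x)"
      by (intro Bochner_Integration.integral_diff UB_int pert(2)[OF w wb] pert(2)[OF p0])
    finally show ?thesis using pert(1)[OF w wb] pert(1)[OF p0] by linarith
  qed
  show ?thesis by (rule that[of "\<rho>\<^sup>2 / 4" N]) (use \<rho>(1) key in auto)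
qed

end

section \<open>Limits of products and recovery sequences\<close>

context bounded_open_set
begin

lemma integrable_mult_bounded:
  fixes b w :: "real^'n \<Rightarrow> real"
  assumes b: "integrable \<mu> b" and [measurable]: "w \<in> borel_measurable \<mu>"
    and wb: "AE x in \<mu>. \<bar>w x\<bar> \<le> C"
  shows "integrable \<mu> (\<lambda>x. b x * w x)"
proof (rule Bochner_Integration.integrable_bound)
  have [measurable]: "b \<in> borel_measurable \<mu>" using b by simp
  show "integrable \<mu> (\<lambda>x. C * b x)" using b by simp
  show "(\<lambda>x. b x * w x) \<in> borel_measurable \<mu>" by measurable
  show "AE x in \<mu>. norm (b x * w x) \<le> norm (C * b x)"
    using wb
  proof eventually_elim
    case (elim x)
    then have "\<bar>b x\<bar> * \<bar>w x\<bar> \<le> \<bar>b x\<bar> * \<bar>C\<bar>" by (intro mult_left_mono) auto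
    then show ?case by (simp add: abs_mult mult.commute)
  qed
qed

text \<open>The domain is split at the level \<open>\<eta>\<close> of \<open>d n\<close>. Where
  \<open>d n\<close> exceeds it, the set is small by Chebyshev and equi-integrability applies;
  elsewhere the uniform L1 bound does.\<close>

lemma weakly_null_L1_product:
  assumes b: "\<And>n. integrable \<mu> (b n)" and K: "\<And>n. (LINT x|\<mu>. \<bar>b n x\<bar>) \<le> K"
    and weak: "\<And>h. h \<in> space_Linf \<Omega> \<Longrightarrow> (\<lambda>n. LINT x|\<mu>. b n x * h x) \<longlonglongrightarrow> (0::real)"
    and d[measurable]: "\<And>n. d n \<in> borel_measurable \<mu>" and db: "\<And>n. AE x in \<mu>. \<bar>d n x\<bar> \<le> C"
    and lim: "(\<lambda>n. norm (l2_on \<Omega> (d n))) \<longlonglongrightarrow> 0"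
  shows "(\<lambda>n. LINT x|\<mu>. b n x * d n x) \<longlonglongrightarrow> 0"
proof (rule LIMSEQ_I)
  fix e :: real assume e: "e > 0"
  have dL2: "d n \<in> space_L2 \<Omega>" for n using d db by (intro space_L2_bounded[of _ C]) auto
  have [measurable]: "b n \<in> borel_measurable \<mu>" for n using b[of n] by simp
  \<comment> \<open>Dividing by \<open>D\<close> brings \<open>d n\<close> below 1, as
    \<open>weakly_null_L1_uniform\<close> demands; the added 1 keeps \<open>D\<close>
    positive.\<close>
  define D where "D = \<bar>C\<bar> + 1"
  have D: "D > 0" by (simp add: D_def)
  \<comment> \<open>Makes the contribution of the set with small \<open>d n\<close> at most
    \<open>e / 3\<close>; the set \<open>E\<close> contributes another \<open>e / 3\<close>.\<close>
  define \<eta> where "\<eta> = e / (3 * (\<bar>K\<bar> + 1))"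
  have \<eta>: "\<eta> > 0" using e by (simp add: \<eta>_def)
  obtain \<delta> N where \<delta>: "\<delta> > 0" and unif: "\<And>n w E. n \<ge> N \<Longrightarrow> w \<in> borel_measurable \<mu> \<Longrightarrow>
    (AE x in \<mu>. \<bar>w x\<bar> \<le> 1) \<Longrightarrow> E \<in> sets \<mu> \<Longrightarrow> measure \<mu> E < \<delta> \<Longrightarrow>
    \<bar>LINT x|\<mu>. b n x * (w x * indicator E x)\<bar> \<le> e / (3 * D)"
    by (rule weakly_null_L1_uniform[OF b weak, of "e / (3 * D)"]) (use e D in auto)
  have "(\<lambda>n. (norm (l2_on \<Omega> (d n)))\<^sup>2) \<longlonglongrightarrow> 0\<^sup>2" by (intro tendsto_power lim)
  then obtain N' where N': "\<And>n. n \<ge> N' \<Longrightarrow> (norm (l2_on \<Omega> (d n)))\<^sup>2 < \<delta> * \<eta>\<^sup>2"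
    using LIMSEQ_D[of _ _ "\<delta> * \<eta>\<^sup>2"] \<delta> \<eta> by fastforce
  have "\<bar>LINT x|\<mu>. b n x * d n x\<bar> < e" if n: "n \<ge> max N N'" for n
  proof -
    define E where "E = {x \<in> space \<mu>. \<eta> < \<bar>d n x\<bar>}"
    have E[measurable]: "E \<in> sets \<mu>" unfolding E_def by measurable
    have iE: "integrable \<mu> (indicator E :: _ \<Rightarrow> real)"
      by (intro integrable_real_indicator) (auto simp: less_top[symmetric])
    have "\<eta>\<^sup>2 * measure \<mu> E = (LINT x|\<mu>. \<eta>\<^sup>2 * indicator E x)"
      using sets.sets_into_space[OF E] by (simp add: Int_absorb2)
    also have "\<dots> \<le> (LINT x|\<mu>. (norm (d n x))\<^sup>2)"
    proof (rule integral_mono)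
      show "\<eta>\<^sup>2 * indicator E x \<le> (norm (d n x))\<^sup>2" for x
        using \<eta> by (auto simp: E_def indicator_def abs_le_square_iff[symmetric])
    qed (use dL2[of n] iE in \<open>auto simp: space_L2_def\<close>)
    also have "\<dots> = (norm (l2_on \<Omega> (d n)))\<^sup>2" by (rule norm_l2_on[OF domain_lebesgue dL2, symmetric])
    also have "\<dots> < \<delta> * \<eta>\<^sup>2" using N' n by simp
    finally have ME: "measure \<mu> E < \<delta>" using \<eta> by (simp add: mult.commute)
    have w1: "(\<lambda>x. d n x / D) \<in> borel_measurable \<mu>" by measurable
    have w2: "AE x in \<mu>. \<bar>d n x / D\<bar> \<le> 1"
      using db[of n] by eventually_elim (use D in \<open>auto simp: D_def\<close>)
    have "\<bar>LINT x|\<mu>. b n x * (d n x / D * indicator E x)\<bar> \<le> e / (3 * D)"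
      using n by (intro unif w1 w2 E ME) auto
    moreover have "(LINT x|\<mu>. b n x * (d n x / D * indicator E x)) = (LINT x|\<mu>. b n x * (d n x * indicator E x)) / D"
      by simp
    ultimately have p1: "\<bar>LINT x|\<mu>. b n x * (d n x * indicator E x)\<bar> \<le> e / 3"
      using D by (simp add: field_simps)
    have i1: "integrable \<mu> (\<lambda>x. b n x * (d n x * indicator E x))"
      by (rule integrable_mult_bounded[OF b, of _ "\<bar>C\<bar>"], measurable)
         (use db[of n] in eventually_elim, auto simp: indicator_def)
    have i2: "integrable \<mu> (\<lambda>x. b n x * (d n x * (1 - indicator E x)))"
      by (rule integrable_mult_bounded[OF b, of _ "\<bar>C\<bar>"], measurable)
         (use db[of n] in eventually_elim, auto simp: indicator_def)
    have "\<bar>LINT x|\<mu>. b n x * (d n x * (1 - indicator E x))\<bar> \<le> (LINT x|\<mu>. \<bar>b n x * (d n x * (1 - indicator E x))\<bar>)"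
      by (rule integral_abs_bound)
    also have "\<dots> \<le> (LINT x|\<mu>. \<eta> * \<bar>b n x\<bar>)"
    proof (rule integral_mono)
      show "\<bar>b n x * (d n x * (1 - indicator E x))\<bar> \<le> \<eta> * \<bar>b n x\<bar>" if "x \<in> space \<mu>" for x
        using that \<eta> by (auto simp: E_def indicator_def abs_mult mult.commute[of "\<bar>b n x\<bar>"] intro!: mult_right_mono)
    qed (use b i2 in auto)
    also have "\<dots> \<le> \<eta> * \<bar>K\<bar>" using K[of n] \<eta> by (simp add: mult_left_mono)
    also have "\<dots> \<le> e / 3" unfolding \<eta>_def using e by (simp add: field_simps)
    finally have p2: "\<bar>LINT x|\<mu>. b n x * (d n x * (1 - indicator E x))\<bar> \<le> e / 3" .
    have "(LINT x|\<mu>. b n x * d n x)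
        = (LINT x|\<mu>. b n x * (d n x * indicator E x) + b n x * (d n x * (1 - indicator E x)))"
      by (intro Bochner_Integration.integral_cong) (auto simp: algebra_simps)
    also have "\<dots> = (LINT x|\<mu>. b n x * (d n x * indicator E x)) + (LINT x|\<mu>. b n x * (d n x * (1 - indicator E x)))"
      using i1 i2 by (rule Bochner_Integration.integral_add)
    finally show ?thesis using p1 p2 e by linarith
  qed
  then show "\<exists>N. \<forall>n\<ge>N. norm ((LINT x|\<mu>. b n x * d n x) - 0) < e"
    by (intro exI[of _ "max N N'"]) simp
qed

text \<open>A sequence that is bounded and converges in L2 converges almost everywhere along
  subsequences, and a multiple of \<open>b\<close> dominates; the subsequence principle restores the
  whole sequence.\<close>

lemma L1_product_limit:
  fixes b w0 :: "real^'n \<Rightarrow> real" and w :: "nat \<Rightarrow> real^'n \<Rightarrow> real"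
  assumes b: "integrable \<mu> b"
    and w[measurable]: "\<And>n. w n \<in> borel_measurable \<mu>" and wb: "\<And>n. AE x in \<mu>. \<bar>w n x\<bar> \<le> C"
    and w0: "w0 \<in> space_L2 \<Omega>" and lim: "(\<lambda>n. l2_on \<Omega> (w n)) \<longlonglongrightarrow> l2_on \<Omega> w0"
  shows "(\<lambda>n. LINT x|\<mu>. b x * w n x) \<longlonglongrightarrow> (LINT x|\<mu>. b x * w0 x)"
proof (rule LIMSEQ_subsequence_principle)
  fix r :: "nat \<Rightarrow> nat" assume r: "strict_mono r"
  have [measurable]: "b \<in> borel_measurable \<mu>" "w0 \<in> borel_measurable \<mu>"
    using b w0 by (auto simp: space_L2_def)
  have wL2: "w n \<in> space_L2 \<Omega>" for n using w wb by (intro space_L2_bounded[of _ C]) auto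
  have "(\<lambda>n. l2_on \<Omega> (w (r n))) \<longlonglongrightarrow> l2_on \<Omega> w0"
    using LIMSEQ_subseq_LIMSEQ[OF lim r] by (simp add: o_def)
  then obtain s :: "nat \<Rightarrow> nat" where s: "strict_mono s" "AE x in \<mu>. (\<lambda>n. w (r (s n)) x) \<longlonglongrightarrow> w0 x"
    using l2_on_AE_subsequence[OF wL2 w0, of "\<lambda>n. r n"] by blast
  have "(\<lambda>n. LINT x|\<mu>. b x * w (r (s n)) x) \<longlonglongrightarrow> (LINT x|\<mu>. b x * w0 x)"
  proof (rule integral_dominated_convergence[where w = "\<lambda>x. \<bar>C\<bar> * \<bar>b x\<bar>"])
    show "AE x in \<mu>. (\<lambda>n. b x * w (r (s n)) x) \<longlonglongrightarrow> b x * w0 x"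
      using s(2) by eventually_elim (rule tendsto_mult_left)
    show "AE x in \<mu>. norm (b x * w (r (s n)) x) \<le> \<bar>C\<bar> * \<bar>b x\<bar>" for n
      using wb[of "r (s n)"] by eventually_elim (simp add: abs_mult mult.commute[of "\<bar>b _\<bar>"] mult_right_mono)
  qed (use b in auto)
  then show "\<exists>s. strict_mono s \<and> (\<lambda>n. LINT x|\<mu>. b x * w (r (s n)) x) \<longlonglongrightarrow> (LINT x|\<mu>. b x * w0 x)"
    using s(1) by blast
qed

text \<open>Expanding \<open>(b n - b0) * (w n - w0)\<close> leaves one doubly small product,
  handled by equi-integrability, and two terms in which one factor is fixed.\<close>

lemma weak_L1_product_limit:
  fixes w0 :: "real^'n \<Rightarrow> real" and w :: "nat \<Rightarrow> real^'n \<Rightarrow> real"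
  assumes b: "weakly_converges_L1 \<Omega> b b0" and K: "\<And>n. (LINT x|\<mu>. \<bar>b n x\<bar>) \<le> K"
    and w[measurable]: "\<And>n. w n \<in> borel_measurable \<mu>" and wb: "\<And>n. AE x in \<mu>. \<bar>w n x\<bar> \<le> C"
    and w0[measurable]: "w0 \<in> borel_measurable \<mu>" and w0b: "AE x in \<mu>. \<bar>w0 x\<bar> \<le> C"
    and lim: "(\<lambda>n. l2_on \<Omega> (w n)) \<longlonglongrightarrow> l2_on \<Omega> w0"
  shows "(\<lambda>n. LINT x|\<mu>. b n x * w n x) \<longlonglongrightarrow> (LINT x|\<mu>. b0 x * w0 x)"
proof -
  have bi: "integrable \<mu> (b n)" and b0i: "integrable \<mu> b0" for n
    using b by (auto simp: weakly_converges_L1_def space_L1_def)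
  have bl: "(\<lambda>n. LINT x|\<mu>. b n x * h x) \<longlonglongrightarrow> (LINT x|\<mu>. b0 x * h x)" if "h \<in> space_Linf \<Omega>" for h
    using b that by (auto simp: weakly_converges_L1_def)
  have wL2: "w n \<in> space_L2 \<Omega>" "w0 \<in> space_L2 \<Omega>" for n
    using wb[of n] w0b by (auto intro!: space_L2_bounded[of _ C])
  have w0Linf: "w0 \<in> space_Linf \<Omega>" using w0b by (auto simp: space_Linf_def)
  have hint: "integrable \<mu> (\<lambda>x. b n x * h x)" "integrable \<mu> (\<lambda>x. b0 x * h x)"
    if "h \<in> space_Linf \<Omega>" for h n
    using that by (auto simp: space_Linf_def intro: integrable_mult_bounded[OF bi] integrable_mult_bounded[OF b0i])
  have "(\<lambda>n. LINT x|\<mu>. (b n x - b0 x) * (w n x - w0 x)) \<longlonglongrightarrow> 0"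
  proof (rule weakly_null_L1_product)
    show "integrable \<mu> (\<lambda>x. b n x - b0 x)" for n using bi b0i by simp
    show "(LINT x|\<mu>. \<bar>b n x - b0 x\<bar>) \<le> K + (LINT x|\<mu>. \<bar>b0 x\<bar>)" for n
    proof -
      have "(LINT x|\<mu>. \<bar>b n x - b0 x\<bar>) \<le> (LINT x|\<mu>. \<bar>b n x\<bar> + \<bar>b0 x\<bar>)"
        using bi b0i by (intro integral_mono) auto
      then show ?thesis using K[of n] bi[of n] b0i by simp
    qed
    show "(\<lambda>n. LINT x|\<mu>. (b n x - b0 x) * h x) \<longlonglongrightarrow> 0" if h: "h \<in> space_Linf \<Omega>" for h
      using LIM_zero[OF bl[OF h]] hint[OF h] by (simp add: left_diff_distrib)
    show "(\<lambda>x. w n x - w0 x) \<in> borel_measurable \<mu>" for n by measurable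
    show "AE x in \<mu>. \<bar>w n x - w0 x\<bar> \<le> 2 * C" for n
      using wb[of n] w0b by eventually_elim linarith
    show "(\<lambda>n. norm (l2_on \<Omega> (\<lambda>x. w n x - w0 x))) \<longlonglongrightarrow> 0"
      unfolding l2_on_diff[OF domain_lebesgue wL2] by (intro tendsto_norm_zero LIM_zero lim)
  qed
  moreover have "(\<lambda>n. (LINT x|\<mu>. b0 x * w n x)) \<longlonglongrightarrow> (LINT x|\<mu>. b0 x * w0 x)"
    by (rule L1_product_limit[OF b0i w wb wL2(2) lim])
  moreover have "(\<lambda>n. LINT x|\<mu>. b n x * w0 x) \<longlonglongrightarrow> (LINT x|\<mu>. b0 x * w0 x)"
    by (rule bl[OF w0Linf])
  ultimately have "(\<lambda>n. (LINT x|\<mu>. (b n x - b0 x) * (w n x - w0 x)) + (LINT x|\<mu>. b0 x * w n x)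
      + (LINT x|\<mu>. b n x * w0 x) - (LINT x|\<mu>. b0 x * w0 x))
      \<longlonglongrightarrow> 0 + (LINT x|\<mu>. b0 x * w0 x) + (LINT x|\<mu>. b0 x * w0 x) - (LINT x|\<mu>. b0 x * w0 x)"
    by (intro tendsto_intros)
  moreover have "(LINT x|\<mu>. (b n x - b0 x) * (w n x - w0 x)) + (LINT x|\<mu>. b0 x * w n x)
      + (LINT x|\<mu>. b n x * w0 x) - (LINT x|\<mu>. b0 x * w0 x) = (LINT x|\<mu>. b n x * w n x)" for n
  proof -
    have wn: "w n \<in> space_Linf \<Omega>" using wb[of n] by (auto simp: space_Linf_def)
    have "(LINT x|\<mu>. (b n x - b0 x) * (w n x - w0 x))
        = (LINT x|\<mu>. b n x * w n x - b0 x * w n x - b n x * w0 x + b0 x * w0 x)"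
      by (intro Bochner_Integration.integral_cong) (auto simp: algebra_simps)
    also have "\<dots> = (LINT x|\<mu>. b n x * w n x) - (LINT x|\<mu>. b0 x * w n x)
        - (LINT x|\<mu>. b n x * w0 x) + (LINT x|\<mu>. b0 x * w0 x)"
      using hint[OF wn] hint[OF w0Linf] by simp
    finally show ?thesis by simp
  qed
  ultimately show ?thesis by simp
qed

text \<open>Allows products such as \<open>u n\<close> times an adapted test function, or the square
  of \<open>u n\<close>, to serve as the bounded factor against \<open>a n\<close> in
  \<open>weak_L1_product_limit\<close>.\<close>

lemma l2_product_limit:
  fixes v w :: "nat \<Rightarrow> real^'n \<Rightarrow> real"
  assumes v: "\<And>n. v n \<in> borel_measurable \<mu>" "\<And>n. AE x in \<mu>. \<bar>v n x\<bar> \<le> A"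
    and v0: "v0 \<in> borel_measurable \<mu>" "AE x in \<mu>. \<bar>v0 x\<bar> \<le> A"
    and w: "\<And>n. w n \<in> borel_measurable \<mu>" "\<And>n. AE x in \<mu>. \<bar>w n x\<bar> \<le> B"
    and w0: "w0 \<in> borel_measurable \<mu>" "AE x in \<mu>. \<bar>w0 x\<bar> \<le> B"
    and lim: "(\<lambda>n. l2_on \<Omega> (v n)) \<longlonglongrightarrow> l2_on \<Omega> v0" "(\<lambda>n. l2_on \<Omega> (w n)) \<longlonglongrightarrow> l2_on \<Omega> w0"
    and A: "A \<ge> 0" and B: "B \<ge> 0"
  shows "(\<lambda>n. l2_on \<Omega> (\<lambda>x. v n x * w n x)) \<longlonglongrightarrow> l2_on \<Omega> (\<lambda>x. v0 x * w0 x)"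
    and "\<And>n. AE x in \<mu>. \<bar>v n x * w n x\<bar> \<le> A * B" and "AE x in \<mu>. \<bar>v0 x * w0 x\<bar> \<le> A * B"
proof -
  note [measurable] = v(1) v0(1) w(1) w0(1)
  show b: "AE x in \<mu>. \<bar>v n x * w n x\<bar> \<le> A * B" for n
    using v(2)[of n] w(2)[of n] by eventually_elim (use A in \<open>auto simp: abs_mult intro!: mult_mono\<close>)
  show b0: "AE x in \<mu>. \<bar>v0 x * w0 x\<bar> \<le> A * B"
    using v0(2) w0(2) by eventually_elim (use A in \<open>auto simp: abs_mult intro!: mult_mono\<close>)
  have L2: "v n \<in> space_L2 \<Omega>" "w n \<in> space_L2 \<Omega>" "v0 \<in> space_L2 \<Omega>" "w0 \<in> space_L2 \<Omega>"
    "(\<lambda>x. v n x * w n x) \<in> space_L2 \<Omega>" "(\<lambda>x. v0 x * w0 x) \<in> space_L2 \<Omega>" for n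
    using v(2)[of n] w(2)[of n] v0(2) w0(2) b[of n] b0 by (auto intro!: space_L2_bounded)
  note dv = space_L2_diff[OF domain_lebesgue L2(1) L2(3)] and dw = space_L2_diff[OF domain_lebesgue L2(2) L2(4)]
  have p1: "AE x in \<mu>. norm ((v n x - v0 x) * w n x) \<le> B * norm (v n x - v0 x)" for n
    using w(2)[of n] by eventually_elim (simp add: abs_mult mult.commute[of B] mult_left_mono)
  have p2: "AE x in \<mu>. norm (v0 x * (w n x - w0 x)) \<le> A * norm (w n x - w0 x)" for n
    using v0(2) by eventually_elim (simp add: abs_mult mult_right_mono)
  have m1: "(\<lambda>x. (v n x - v0 x) * w n x) \<in> space_L2 \<Omega>" for n
    by (rule space_L2_dominated[OF _ dv p1]) measurable
  have m2: "(\<lambda>x. v0 x * (w n x - w0 x)) \<in> space_L2 \<Omega>" for n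
    by (rule space_L2_dominated[OF _ dw p2]) measurable
  have "(\<lambda>n. l2_on \<Omega> (\<lambda>x. v n x * w n x) - l2_on \<Omega> (\<lambda>x. v0 x * w0 x)) \<longlonglongrightarrow> 0"
  proof (rule Lim_null_comparison[OF always_eventually[OF allI]])
    fix n
    have "l2_on \<Omega> (\<lambda>x. v n x * w n x) - l2_on \<Omega> (\<lambda>x. v0 x * w0 x) = l2_on \<Omega> (\<lambda>x. (v n x - v0 x) * w n x + v0 x * (w n x - w0 x))"
      unfolding l2_on_diff[OF domain_lebesgue L2(5,6), symmetric] by (simp add: algebra_simps)
    also have "\<dots> = l2_on \<Omega> (\<lambda>x. (v n x - v0 x) * w n x) + l2_on \<Omega> (\<lambda>x. v0 x * (w n x - w0 x))"
      by (rule l2_on_add[OF domain_lebesgue m1 m2])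
    also have "norm \<dots> \<le> B * norm (l2_on \<Omega> (\<lambda>x. v n x - v0 x)) + A * norm (l2_on \<Omega> (\<lambda>x. w n x - w0 x))"
      by (rule order_trans[OF norm_triangle_ineq])
         (intro add_mono norm_l2_on_le[OF m1 dv B p1] norm_l2_on_le[OF m2 dw A p2])
    finally show "norm (l2_on \<Omega> (\<lambda>x. v n x * w n x) - l2_on \<Omega> (\<lambda>x. v0 x * w0 x))
      \<le> B * norm (l2_on \<Omega> (v n) - l2_on \<Omega> v0) + A * norm (l2_on \<Omega> (w n) - l2_on \<Omega> w0)"
      by (simp only: l2_on_diff[OF domain_lebesgue] L2)
    show "(\<lambda>n. B * norm (l2_on \<Omega> (v n) - l2_on \<Omega> v0) + A * norm (l2_on \<Omega> (w n) - l2_on \<Omega> w0)) \<longlonglongrightarrow> 0"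
      by (intro tendsto_add_zero tendsto_mult_right_zero tendsto_norm_zero LIM_zero lim)
  qed
  then show "(\<lambda>n. l2_on \<Omega> (\<lambda>x. v n x * w n x)) \<longlonglongrightarrow> l2_on \<Omega> (\<lambda>x. v0 x * w0 x)" by (rule LIM_zero_cancel)
qed

text \<open>Weak convergence is tested with the indicator of the set where \<open>b0\<close> is
  negative.\<close>

lemma weakly_converges_L1_nonneg:
  assumes b: "weakly_converges_L1 \<Omega> b b0" and nn: "\<And>n. AE x in \<mu>. 0 \<le> b n x"
  shows "AE x in \<mu>. 0 \<le> b0 x"
proof -
  have b0i: "integrable \<mu> b0" using b by (auto simp: weakly_converges_L1_def space_L1_def)
  then have [measurable]: "b0 \<in> borel_measurable \<mu>" by simp
  define E where "E = {x \<in> space \<mu>. b0 x < 0}"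
  have E[measurable]: "E \<in> sets \<mu>" unfolding E_def by measurable
  have "(indicator E :: _ \<Rightarrow> real) \<in> space_Linf \<Omega>"
    unfolding space_Linf_def by (intro CollectI conjI exI[of _ 1] AE_I2) (auto simp: indicator_def)
  then have "(\<lambda>n. LINT x|\<mu>. b n x * indicator E x) \<longlonglongrightarrow> (LINT x|\<mu>. b0 x * indicator E x)"
    using b by (auto simp: weakly_converges_L1_def)
  moreover have "0 \<le> (LINT x|\<mu>. b n x * indicator E x)" for n
    using nn[of n] by (intro integral_nonneg_AE) (auto elim!: AE_mp simp: indicator_def)
  ultimately have ge: "0 \<le> (LINT x|\<mu>. b0 x * indicator E x)" by (intro LIMSEQ_le_const) auto
  have i: "integrable \<mu> (\<lambda>x. - (b0 x * indicator E x))"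
    using integrable_mult_indicator[OF E b0i] by (simp add: mult.commute)
  have "(LINT x|\<mu>. - (b0 x * indicator E x)) = 0"
  proof (rule antisym)
    show "(LINT x|\<mu>. - (b0 x * indicator E x)) \<le> 0" using ge by simp
    show "0 \<le> (LINT x|\<mu>. - (b0 x * indicator E x))"
      by (intro integral_nonneg_AE AE_I2) (auto simp: E_def indicator_def)
  qed
  then have "AE x in \<mu>. - (b0 x * indicator E x) = 0"
    by (subst (asm) integral_nonneg_eq_0_iff_AE[OF i]) (auto simp: E_def indicator_def)
  moreover have "AE x in \<mu>. x \<in> space \<mu>" by (rule AE_space)
  ultimately show ?thesis by eventually_elim (auto simp: E_def indicator_def split: if_splits)
qed

text \<open>The choice in \<open>weak_gradient\<close> may differ for two representatives of one
  class; the jet is unaffected by this.\<close>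

lemma jet_cong:
  assumes u: "u \<in> W12 \<Omega>" and v: "v \<in> W12 \<Omega>" and eq: "l2_on \<Omega> u = l2_on \<Omega> v"
  shows "jet u = jet v"
proof -
  have ae: "AE x in \<mu>. u x = v x"
    using l2_on_eq_iff[OF domain_lebesgue W12_L2[OF u] W12_L2[OF v]] eq by simp
  note gv = weak_gradient_props[OF v]
  have "is_weak_gradient \<Omega> u (weak_gradient \<Omega> v)"
    unfolding is_weak_gradient_def
  proof (intro ballI allI)
    fix \<psi> i assume \<psi>: "\<psi> \<in> test_functions \<Omega>"
    have "(LINT x|\<mu>. u x * partial_derivative i \<psi> x) = (LINT x|\<mu>. v x * partial_derivative i \<psi> x)"
      using weak_gradient_test_integrable(1)[OF W12_L2[OF u] gv(1) \<psi>, of i]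
        weak_gradient_test_integrable(1)[OF W12_L2[OF v] gv(1) \<psi>, of i] ae
      by (intro integral_cong_AE) auto
    then show "(LINT x|\<mu>. u x * partial_derivative i \<psi> x) = - (LINT x|\<mu>. weak_gradient \<Omega> v x $ i * \<psi> x)"
      using gv(2) \<psi> by (simp add: is_weak_gradient_def)
  qed
  from jet_eqI[OF W12_L2[OF u] gv(1) this] show ?thesis using eq by (simp add: jet_def)
qed

text \<open>Used to identify a weak limit of jets from the L2 limit of the functions alone.\<close>

lemma sobolev_jets_fst_eqD:
  assumes s: "s \<in> sobolev_jets" and t: "t \<in> sobolev_jets" and eq: "fst s = fst t"
  shows "s = t"
proof -
  obtain u where u: "u \<in> W012 \<Omega>" "jet u = s" by (rule sobolev_jets_surj[OF s])
  obtain v where v: "v \<in> W012 \<Omega>" "jet v = t" by (rule sobolev_jets_surj[OF t])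
  show ?thesis using jet_cong[OF W012_W12[OF u(1)] W012_W12[OF v(1)]] u v eq by (auto simp: jet_def)
qed

text \<open>The weak limit lies in the closed span of the sequence, hence in
  \<open>sobolev_jets\<close>, so that \<open>rellich\<close> applies to it.\<close>

lemma weak_compactness_sobolev_jets:
  fixes s :: "nat \<Rightarrow> (real^'n, real) l2 \<times> (real^'n, real^'n) l2"
  assumes s: "\<And>n. s n \<in> sobolev_jets" and bnd: "\<And>n. norm (s n) \<le> C"
  obtains r l where "strict_mono r" "l \<in> sobolev_jets" "\<And>y. (\<lambda>n. s (r n) \<bullet> y) \<longlonglongrightarrow> l \<bullet> y"
    "(\<lambda>n. fst (s (r n))) \<longlonglongrightarrow> fst l"
proof -
  obtain r l where r: "strict_mono r" "l \<in> closure (span (range s))" "\<And>y. (\<lambda>n. s (r n) \<bullet> y) \<longlonglongrightarrow> l \<bullet> y"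
    using bounded_imp_weakly_convergent_subsequence[of s C] bnd by blast
  have "closure (span (range s)) \<subseteq> sobolev_jets"
    using s subspace_sobolev_jets by (intro closure_minimal span_minimal) (auto simp: sobolev_jets_def)
  then have l: "l \<in> sobolev_jets" using r(2) by blast
  have "(\<lambda>n. fst (s (r n))) \<longlonglongrightarrow> fst l"
    by (rule rellich[OF s bnd r(3) l])
  then show ?thesis using that r(1,3) l by blast
qed

end

section \<open>Recovery sequences\<close>

text \<open>The limit matrix carries its own constants, because \<open>bounded_elliptic\<close>
  relates its bounds in no way to those of the sequence.\<close>

locale elliptic_G_sequence = bounded_open_set \<Omega> for \<Omega> :: "(real^'n::finite) set" +
  fixes M :: "nat \<Rightarrow> real^'n \<Rightarrow> real^'n^'n" and M0 :: "real^'n \<Rightarrow> real^'n^'n" and \<alpha> \<beta> \<alpha>0 \<beta>0 :: real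
  assumes M: "\<And>n. M n \<in> borel_measurable \<mu>" "\<And>n. AE x in \<mu>. norm (M n x) \<le> \<beta>"
    and M_ell: "\<And>n. AE x in \<mu>. \<forall>\<xi>. \<alpha> * (norm \<xi>)\<^sup>2 \<le> (M n x *v \<xi>) \<bullet> \<xi>"
    and \<alpha>: "\<alpha> > 0" and \<beta>: "\<beta> \<ge> 0"
    and M0: "M0 \<in> borel_measurable \<mu>" "AE x in \<mu>. norm (M0 x) \<le> \<beta>0"
    and M0_ell: "AE x in \<mu>. \<forall>\<xi>. \<alpha>0 * (norm \<xi>)\<^sup>2 \<le> (M0 x *v \<xi>) \<bullet> \<xi>"
    and \<alpha>0: "\<alpha>0 > 0" and \<beta>0: "\<beta>0 \<ge> 0"
    and G: "G_converges \<Omega> M M0"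
begin

lemma coercive_constant:
  obtains \<gamma> where "\<gamma> > 0" "\<And>n s. s \<in> sobolev_jets \<Longrightarrow> \<gamma> * (norm s)\<^sup>2 \<le> energy (M n) s s"
    "\<And>s. s \<in> sobolev_jets \<Longrightarrow> \<gamma> * (norm s)\<^sup>2 \<le> energy M0 s s"
proof -
  obtain P where P: "P > 0" "\<And>s. s \<in> sobolev_jets \<Longrightarrow> (norm (fst s))\<^sup>2 \<le> P * (norm (snd s))\<^sup>2"
    using poincare by metis
  define m where "m = min \<alpha> \<alpha>0"
  have m: "m > 0" "m \<le> \<alpha>" "m \<le> \<alpha>0" using \<alpha> \<alpha>0 by (auto simp: m_def)
  \<comment> \<open>By Poincare the full squared norm is at most \<open>1 + P\<close> times the
    squared gradient norm.\<close>
  define \<gamma> where "\<gamma> = m / (1 + P)"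
  have g: "\<gamma> > 0" using m P by (simp add: \<gamma>_def)
  have bound: "\<gamma> * (norm s)\<^sup>2 \<le> m * (norm (snd s))\<^sup>2" if "s \<in> sobolev_jets" for s
  proof -
    have "(norm s)\<^sup>2 = (norm (fst s))\<^sup>2 + (norm (snd s))\<^sup>2" by (simp add: norm_prod_def)
    also have "\<dots> \<le> (1 + P) * (norm (snd s))\<^sup>2" using P(2)[OF that] by (simp add: distrib_right)
    finally have "\<gamma> * (norm s)\<^sup>2 \<le> \<gamma> * ((1 + P) * (norm (snd s))\<^sup>2)" using g by (intro mult_left_mono) auto
    also have "\<dots> = m * (norm (snd s))\<^sup>2" using P(1) by (simp add: \<gamma>_def)
    finally show ?thesis .
  qed
  show ?thesis
  proof (rule that[OF g])
    fix n s assume s: "s \<in> sobolev_jets"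
    have "m * (norm (snd s))\<^sup>2 \<le> \<alpha> * (norm (snd s))\<^sup>2" "m * (norm (snd s))\<^sup>2 \<le> \<alpha>0 * (norm (snd s))\<^sup>2"
      using m by (auto intro: mult_right_mono)
    then show "\<gamma> * (norm s)\<^sup>2 \<le> energy (M n) s s" "\<gamma> * (norm s)\<^sup>2 \<le> energy M0 s s"
      using bound[OF s] energy_coercive[OF M \<beta> M_ell \<alpha> s] energy_coercive[OF M0 \<beta>0 M0_ell \<alpha>0 s]
      by (meson order_trans)+
  qed
qed

text \<open>G-convergence is applied to the fixed functional \<open>energy M0 v\<close>: for the
  limit matrix its solution is \<open>v\<close> itself, for \<open>M n\<close> it is
  \<open>V n\<close>. The weak convergence so obtained becomes strong in L2 by Rellich.\<close>

lemma recovery_sequence: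
  assumes v: "v \<in> sobolev_jets"
  obtains V where "\<And>n. V n \<in> sobolev_jets" "\<And>n t. t \<in> sobolev_jets \<Longrightarrow> energy (M n) (V n) t = energy M0 v t"
    "(\<lambda>n. fst (V n)) \<longlonglongrightarrow> fst v"
proof -
  obtain \<gamma> where \<gamma>: "\<gamma> > 0" "\<And>n s. s \<in> sobolev_jets \<Longrightarrow> \<gamma> * (norm s)\<^sup>2 \<le> energy (M n) s s"
    by (rule coercive_constant) blast
  have F: "bounded_functional_on sobolev_jets (energy M0 v)"
    by (intro bounded_linear_imp_bounded_functional_on
        bounded_bilinear.bounded_linear_right[OF bounded_bilinear_energy[OF M0 \<beta>0]])
  have "\<exists>V\<in>sobolev_jets. \<forall>t\<in>sobolev_jets. energy (M n) V t = energy M0 v t" for n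
    by (rule lax_milgram_on[OF subspace_sobolev_jets complete_sobolev_jets bounded_bilinear_energy[OF M \<beta>] \<gamma>(1,2) F])
  then obtain V where V: "\<And>n. V n \<in> sobolev_jets" "\<And>n t. t \<in> sobolev_jets \<Longrightarrow> energy (M n) (V n) t = energy M0 v t"
    by metis
  have "\<exists>w. w \<in> W012 \<Omega> \<and> jet w = V n" for n using sobolev_jets_surj[OF V(1)[of n]] by blast
  then obtain w where w: "\<And>n. w n \<in> W012 \<Omega>" "\<And>n. jet (w n) = V n" by metis
  obtain w0 where w0: "w0 \<in> W012 \<Omega>" "jet w0 = v" by (rule sobolev_jets_surj[OF v])
  define g where "g \<phi> = energy M0 v (jet \<phi>)" for \<phi>
  obtain p where "\<And>s. s \<in> sobolev_jets \<Longrightarrow> energy M0 v s = p \<bullet> s"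
    using riesz_representation_on[OF subspace_sobolev_jets complete_sobolev_jets F] by blast
  then have "g \<in> W012_dual \<Omega>" unfolding W012_dual_iff g_def using W012_jet by blast
  moreover have "solves_divergence_problem \<Omega> (M n) g (w n)" for n
    unfolding solves_divergence_problem_def g_def
    using w V(2) W012_jet energy_jet[OF M \<beta> W012_W12 W012_W12] by metis
  moreover have "solves_divergence_problem \<Omega> M0 g w0"
    unfolding solves_divergence_problem_def g_def
    using w0 energy_jet[OF M0 \<beta>0 W012_W12 W012_W12] by metis
  ultimately have "weakly_converges_W012 \<Omega> w w0" using G unfolding G_converges_def by blast
  then have weak: "(\<lambda>n. V n \<bullet> y) \<longlonglongrightarrow> v \<bullet> y" for y
    using weakly_converges_W012_iff[of w w0, OF w(1) w0(1)] unfolding w(2) w0(2) by blast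
  have "norm (V n) \<le> \<beta>0 * norm (snd v) / \<gamma>" for n
  proof -
    have "\<gamma> * (norm (V n))\<^sup>2 \<le> energy M0 v (V n)" using \<gamma>(2)[OF V(1), of n n] V(2)[OF V(1), of n n] by simp
    also have "\<dots> \<le> \<beta>0 * norm (snd v) * norm (snd (V n))" using abs_energy_le[OF M0 \<beta>0, of v "V n"] by simp
    also have "\<dots> \<le> \<beta>0 * norm (snd v) * norm (V n)"
      using norm_snd_le[of "snd (V n)" "fst (V n)"] \<beta>0 by (intro mult_left_mono) auto
    finally have "norm (V n) * (\<gamma> * norm (V n)) \<le> norm (V n) * (\<beta>0 * norm (snd v))"
      by (simp add: power2_eq_square mult_ac)
    then have "\<gamma> * norm (V n) \<le> \<beta>0 * norm (snd v)"
      using \<beta>0 by (cases "norm (V n) = 0") (auto simp: mult_le_cancel_left)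
    then show ?thesis using \<gamma>(1) by (simp add: field_simps)
  qed
  then have "(\<lambda>n. fst (V n)) \<longlonglongrightarrow> fst v" using weak v by (intro rellich[OF V(1)])
  then show ?thesis using that V by blast
qed

end

section \<open>Passage to the limit\<close>

lemma (in bounded_open_set) AE_bound_l2_limit:
  fixes w :: "nat \<Rightarrow> real^'n \<Rightarrow> real"
  assumes w: "\<And>n. w n \<in> space_L2 \<Omega>" "\<And>n. AE x in \<mu>. \<bar>w n x\<bar> \<le> C" and w0: "w0 \<in> space_L2 \<Omega>"
    and lim: "(\<lambda>n. l2_on \<Omega> (w n)) \<longlonglongrightarrow> l2_on \<Omega> w0"
  shows "AE x in \<mu>. \<bar>w0 x\<bar> \<le> C"
proof -
  obtain r :: "nat \<Rightarrow> nat" where r: "AE x in \<mu>. (\<lambda>n. w (r n) x) \<longlonglongrightarrow> w0 x"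
    using l2_on_AE_subsequence[OF w(1) w0 lim] by blast
  have "AE x in \<mu>. \<forall>n. \<bar>w n x\<bar> \<le> C" using w(2) by (subst AE_all_countable) blast
  with r show ?thesis by eventually_elim (rule LIMSEQ_le_const2[OF tendsto_rabs], auto)
qed

lemma (in bounded_open_set) W012_measurable: "u \<in> W012 \<Omega> \<Longrightarrow> u \<in> borel_measurable \<mu>"
  using W12_L2[OF W012_W12] by (simp add: space_L2_def)

lemma (in bounded_open_set) inner_fst_jet:
  assumes "u \<in> W012 \<Omega>" "v \<in> W012 \<Omega>"
  shows "fst (jet u) \<bullet> fst (jet v) = (LINT x|\<mu>. u x * v x)" 
    "integrable \<mu> (\<lambda>x. u x * v x)"
  using inner_l2_on[OF domain_lebesgue W12_L2[OF W012_W12[OF assms(1)]] W12_L2[OF W012_W12[OF assms(2)]]]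
    integrable_inner_space_L2[OF domain_lebesgue W12_L2[OF W012_W12[OF assms(1)]] W12_L2[OF W012_W12[OF assms(2)]]]
  by (simp_all add: jet_def)

lemma weakly_converges_L1_subseq:
  fixes \<Omega> :: "'a::euclidean_space set"
  assumes "weakly_converges_L1 \<Omega> b b0" "strict_mono r"
  shows "weakly_converges_L1 \<Omega> (\<lambda>n. b (r n)) b0"
  unfolding weakly_converges_L1_def
proof (intro conjI ballI allI)
  fix h :: "'a \<Rightarrow> real" assume "h \<in> space_Linf \<Omega>"
  then have "(\<lambda>n. LINT x|lebesgue_on \<Omega>. b n x * h x) \<longlonglongrightarrow> (LINT x|lebesgue_on \<Omega>. b0 x * h x)"
    using assms(1) unfolding weakly_converges_L1_def by blast
  from LIMSEQ_subseq_LIMSEQ[OF this assms(2)]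
  show "(\<lambda>n. LINT x|lebesgue_on \<Omega>. b (r n) x * h x) \<longlonglongrightarrow> (LINT x|lebesgue_on \<Omega>. b0 x * h x)" by (simp add: o_def)
qed (use assms in \<open>auto simp: weakly_converges_L1_def\<close>)

context elliptic_G_sequence
begin

text \<open>With the first argument held fixed, the energy is the inner product with one fixed
  vector.\<close>

lemma energy_weak_limit:
  assumes "\<And>y. (\<lambda>n. s n \<bullet> y) \<longlonglongrightarrow> l \<bullet> y"
  shows "(\<lambda>n. energy M0 v (s n)) \<longlonglongrightarrow> energy M0 v l"
proof -
  have "energy M0 v t = t \<bullet> (0, matrix_l2 M0 (snd v))" for t
    by (simp add: energy_def inner_prod_def inner_commute)
  then show ?thesis using assms[of "(0, matrix_l2 M0 (snd v))"] by simp
qed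

text \<open>Existence by Lax-Milgram, with the unknown in the second argument of the energy, which
  makes this the adjoint problem. Coercivity gives a norm bound independent of \<open>n\<close>, and
  the zeroth order term gives the pointwise bound \<open>C\<close>.\<close>

lemma resolvent:
  assumes \<phi>: "\<phi> \<in> W012 \<Omega>" and \<phi>b: "AE x in \<mu>. \<bar>\<phi> x\<bar> \<le> C" and C: "C \<ge> 0" and k: "k > 0"
  obtains B where "\<And>n. \<exists>\<zeta>. \<zeta> \<in> W012 \<Omega> \<and> (AE x in \<mu>. \<bar>\<zeta> x\<bar> \<le> C) \<and> norm (jet \<zeta>) \<le> B \<and>
    (\<forall>t\<in>sobolev_jets. energy (M n) t (jet \<zeta>) = k * ((fst (jet \<phi>) - fst (jet \<zeta>)) \<bullet> fst t))"
proof -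
  obtain \<gamma> where \<gamma>: "\<gamma> > 0" "\<And>n s. s \<in> sobolev_jets \<Longrightarrow> \<gamma> * (norm s)\<^sup>2 \<le> energy (M n) s s"
    by (rule coercive_constant) blast
  have "\<exists>\<zeta>. \<zeta> \<in> W012 \<Omega> \<and> (AE x in \<mu>. \<bar>\<zeta> x\<bar> \<le> C) \<and> norm (jet \<zeta>) \<le> k * norm (jet \<phi>) / \<gamma> \<and>
    (\<forall>t\<in>sobolev_jets. energy (M n) t (jet \<zeta>) = k * ((fst (jet \<phi>) - fst (jet \<zeta>)) \<bullet> fst t))" for n
  proof -
    \<comment> \<open>The arguments of the energy are exchanged here to pass to the adjoint
      operator.\<close>
    define B where "B s t = energy (M n) t s + k * (fst s \<bullet> fst t)" for s t
    interpret E: bounded_bilinear "energy (M n)" by (rule bounded_bilinear_energy[OF M \<beta>])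
    have fst_le: "norm (fst s) \<le> norm s" for s :: "(real^'n, real) l2 \<times> (real^'n, real^'n) l2"
      using norm_fst_le[of "fst s" "snd s"] by simp
    have bB: "bounded_bilinear B"
    proof
      show "B (s + s') t = B s t + B s' t" for s s' t
        by (simp add: B_def E.add_right inner_add_left distrib_left)
      show "B s (t + t') = B s t + B s t'" for s t t'
        by (simp add: B_def E.add_left inner_add_right distrib_left)
      show "B (r *\<^sub>R s) t = r *\<^sub>R B s t" for r s t
        by (simp add: B_def E.scaleR_right algebra_simps)
      show "B s (r *\<^sub>R t) = r *\<^sub>R B s t" for r s t
        by (simp add: B_def E.scaleR_left algebra_simps)
      obtain K where K: "\<And>s t. norm (energy (M n) s t) \<le> norm s * norm t * K" using E.bounded by blast
      show "\<exists>K. \<forall>s t. norm (B s t) \<le> norm s * norm t * K"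
      proof (intro exI allI)
        fix s t :: "(real^'n, real) l2 \<times> (real^'n, real^'n) l2"
        have "\<bar>fst s \<bullet> fst t\<bar> \<le> norm s * norm t"
          by (rule order_trans[OF Cauchy_Schwarz_ineq2]) (intro mult_mono fst_le norm_ge_zero)
        then have "\<bar>k * (fst s \<bullet> fst t)\<bar> \<le> norm s * norm t * k" using k by (simp add: abs_mult mult.commute)
        then show "norm (B s t) \<le> norm s * norm t * (K + k)"
          using K[of t s] abs_triangle_ineq[of "energy (M n) t s" "k * (fst s \<bullet> fst t)"]
          unfolding B_def real_norm_def distrib_left mult.commute[of "norm t"] by linarith
      qed
    qed
    have "bounded_linear (\<lambda>t. k * (fst (jet \<phi>) \<bullet> fst t))"
      by (intro bounded_linear_const_mult bounded_linear_compose[OF bounded_linear_inner_right bounded_linear_fst])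
    then have F: "bounded_functional_on sobolev_jets (\<lambda>t. k * (fst (jet \<phi>) \<bullet> fst t))"
      by (rule bounded_linear_imp_bounded_functional_on)
    have co: "\<gamma> * (norm s)\<^sup>2 \<le> B s s" if "s \<in> sobolev_jets" for s
      using \<gamma>(2)[OF that, of n] k by (simp add: B_def add_increasing2)
    obtain z where z: "z \<in> sobolev_jets" "\<And>t. t \<in> sobolev_jets \<Longrightarrow> B z t = k * (fst (jet \<phi>) \<bullet> fst t)"
      using lax_milgram_on[OF subspace_sobolev_jets complete_sobolev_jets bB \<gamma>(1) co F] by blast
    obtain \<zeta> where \<zeta>: "\<zeta> \<in> W012 \<Omega>" "jet \<zeta> = z" by (rule sobolev_jets_surj[OF z(1)])
    have eq: "energy (M n) t (jet \<zeta>) = k * ((fst (jet \<phi>) - fst (jet \<zeta>)) \<bullet> fst t)" if "t \<in> sobolev_jets" for t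
      using z(2)[OF that] by (simp add: B_def \<zeta>(2) inner_diff_left right_diff_distrib)
    have "norm (jet \<zeta>) \<le> k * norm (jet \<phi>) / \<gamma>"
    proof -
      have "\<gamma> * (norm z)\<^sup>2 \<le> k * (fst (jet \<phi>) \<bullet> fst z)" using co[OF z(1)] z(2)[OF z(1)] by simp
      also have "\<dots> \<le> k * (norm (jet \<phi>) * norm z)"
        using k by (intro mult_left_mono order_trans[OF norm_cauchy_schwarz] mult_mono fst_le) auto
      finally have "norm z * (\<gamma> * norm z) \<le> norm z * (k * norm (jet \<phi>))" by (simp add: power2_eq_square mult_ac)
      then have "\<gamma> * norm z \<le> k * norm (jet \<phi>)"
        using k by (cases "norm z = 0") (auto simp: mult_le_cancel_left)
      then show ?thesis using \<gamma>(1) \<zeta>(2) by (simp add: field_simps)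
    qed
    moreover have "AE x in \<mu>. \<bar>\<zeta> x\<bar> \<le> C"
    \<comment> \<open>The equation is tested with the truncation of \<open>\<zeta>\<close> at level
      \<open>C\<close>. By \<open>truncated_sgn\<close> the integrand
      \<open>(\<phi> - \<zeta>)\<close> times this truncation is nonpositive.\<close>
    proof (rule AE_bounded_of_energy_truncated[OF M \<beta> M_ell \<alpha> \<zeta>(1) C], rule disjI2)
      let ?v = "\<lambda>x. truncated C (\<zeta> x)"
      have v: "?v \<in> W012 \<Omega>" by (rule truncated_W012(1)[OF \<zeta>(1) C])
      have "energy_form \<Omega> (M n) ?v \<zeta> = energy (M n) (jet ?v) (jet \<zeta>)"
        by (rule energy_jet[OF M \<beta> W012_W12[OF v] W012_W12[OF \<zeta>(1)], symmetric])
      also have "\<dots> = k * ((LINT x|\<mu>. \<phi> x * ?v x) - (LINT x|\<mu>. \<zeta> x * ?v x))"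
        by (simp add: eq[OF W012_jet[OF v]] inner_diff_left inner_fst_jet(1)[OF _ v] \<phi> \<zeta>(1))
      also have "(LINT x|\<mu>. \<phi> x * ?v x) - (LINT x|\<mu>. \<zeta> x * ?v x)
          = (LINT x|\<mu>. \<phi> x * ?v x - \<zeta> x * ?v x)"
        by (intro Bochner_Integration.integral_diff[symmetric] inner_fst_jet(2) \<phi> \<zeta>(1) v)
      also have "k * \<dots> \<le> 0"
      proof -
        have "AE x in \<mu>. 0 \<le> - (\<phi> x * ?v x - \<zeta> x * ?v x)"
          using \<phi>b
        proof eventually_elim
          case (elim x)
          then show ?case using truncated_sgn[OF C elim, of "\<zeta> x"] by (simp add: left_diff_distrib)
        qed
        then have "0 \<le> (LINT x|\<mu>. - (\<phi> x * ?v x - \<zeta> x * ?v x))" by (rule integral_nonneg_AE)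
        then show ?thesis using k unfolding integral_minus by (simp add: mult_nonneg_nonpos)
      qed
      finally show "energy_form \<Omega> (M n) ?v \<zeta> \<le> 0" .
    qed
    ultimately show ?thesis using \<zeta>(1) eq by blast
  qed
  then show ?thesis by (rule that)
qed

end

section \<open>Uniform bounds for the solutions\<close>

locale weakly_convergent_problems = elliptic_G_sequence \<Omega> M M0 \<alpha> \<beta> \<alpha>0 \<beta>0
  for \<Omega> :: "(real^'n::finite) set" and M M0 \<alpha> \<beta> \<alpha>0 \<beta>0 +
  fixes a f u :: "nat \<Rightarrow> real^'n \<Rightarrow> real" and a0 f0 :: "real^'n \<Rightarrow> real" and Q :: real
  assumes Q: "Q > 0" and f_le: "\<And>n. AE x in \<mu>. \<bar>f n x\<bar> \<le> Q * a n x"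
    and f_weak: "weakly_converges_L1 \<Omega> f f0" and a_weak: "weakly_converges_L1 \<Omega> a a0"
    and u: "\<And>n. solves_problem \<Omega> (M n) (a n) (f n) (u n)"
begin

text \<open>The sign of \<open>a n\<close> is implicit in the domination of \<open>f n\<close>,
  since an absolute value is nonnegative.\<close>

lemma a_nonneg: "AE x in \<mu>. 0 \<le> a n x"
  using f_le[of n]
proof eventually_elim
  case (elim x)
  then have "0 \<le> Q * a n x" using abs_ge_zero order_trans by blast
  then show ?case using Q by (simp add: zero_le_mult_iff)
qed

lemma a0_nonneg: "AE x in \<mu>. 0 \<le> a0 x"
  by (rule weakly_converges_L1_nonneg[OF a_weak a_nonneg])

lemma a_integrable: "integrable \<mu> (a n)" and a0_integrable: "integrable \<mu> a0"
  and f_integrable: "integrable \<mu> (f n)" and f0_integrable: "integrable \<mu> f0"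
  using a_weak f_weak by (auto simp: weakly_converges_L1_def space_L1_def)

text \<open>Weak convergence tested with the constant 1 bounds the integrals of \<open>a n\<close>,
  which are its L1 norms by nonnegativity; \<open>f n\<close> is dominated by
  \<open>Q * a n\<close>.\<close>

lemma L1_bound:
  obtains K where "\<And>n. (LINT x|\<mu>. \<bar>a n x\<bar>) \<le> K" "\<And>n. (LINT x|\<mu>. \<bar>f n x\<bar>) \<le> K"
proof -
  have "(\<lambda>_ :: real^'n. 1 :: real) \<in> space_Linf \<Omega>" by (auto simp: space_Linf_def)
  from bspec[OF conjunct2[OF conjunct2[OF a_weak[unfolded weakly_converges_L1_def]]] this]
  have "(\<lambda>n. LINT x|\<mu>. a n x * 1) \<longlonglongrightarrow> (LINT x|\<mu>. a0 x * 1)" .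
  then have "Bseq (\<lambda>n. LINT x|\<mu>. a n x)" by (simp add: convergentI convergent_imp_Bseq)
  then obtain K where K: "K > 0" "\<And>n. \<bar>LINT x|\<mu>. a n x\<bar> \<le> K" by (auto elim: BseqE)
  have ab: "(LINT x|\<mu>. \<bar>a n x\<bar>) \<le> K" for n
  proof -
    have "(LINT x|\<mu>. \<bar>a n x\<bar>) = (LINT x|\<mu>. a n x)"
      using a_nonneg[of n] a_integrable[of n] by (intro integral_cong_AE) (auto elim: AE_mp)
    then show ?thesis using K(2)[of n] by simp
  qed
  have fb: "(LINT x|\<mu>. \<bar>f n x\<bar>) \<le> Q * K" for n
  proof -
    have "(LINT x|\<mu>. \<bar>f n x\<bar>) \<le> (LINT x|\<mu>. Q * a n x)"
      using f_le[of n] f_integrable[of n] a_integrable[of n] by (intro integral_mono_AE) auto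
    also have "\<dots> \<le> Q * K" using K(2)[of n] Q by (simp add: mult_left_mono)
    finally show ?thesis .
  qed
  show ?thesis
  proof (rule that)
    show "(LINT x|\<mu>. \<bar>a n x\<bar>) \<le> max K (Q * K)" "(LINT x|\<mu>. \<bar>f n x\<bar>) \<le> max K (Q * K)" for n
      using ab[of n] fb[of n] by auto
  qed
qed

lemma u_W012: "u n \<in> W012 \<Omega>"
  using u[of n] by (simp add: solves_problem_def)

lemma u_L2: "u n \<in> space_L2 \<Omega>"
  by (rule W12_L2[OF W012_W12[OF u_W012]])

lemma u_equation:
  assumes \<phi>: "\<phi> \<in> W012 \<Omega>" "AE x in \<mu>. \<bar>\<phi> x\<bar> \<le> C"
  shows "energy_form \<Omega> (M n) (u n) \<phi> = (LINT x|\<mu>. f n x * \<phi> x) - (LINT x|\<mu>. a n x * (u n x * \<phi> x))"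
proof -
  have "\<phi> \<in> space_Linf \<Omega>" using \<phi> W012_measurable by (auto simp: space_Linf_def)
  then have "energy_form \<Omega> (M n) (u n) \<phi> + (LINT x|\<mu>. a n x * u n x * \<phi> x) = (LINT x|\<mu>. f n x * \<phi> x)"
    using u[of n] \<phi>(1) unfolding solves_problem_def by blast
  then show ?thesis by (simp add: mult.assoc)
qed

text \<open>Where \<open>a n\<close> is positive, the source is
  \<open>a n * (f n / a n - u n)\<close> with a quotient bounded by \<open>Q\<close>, so
  \<open>truncated_sgn\<close> gives the sign of its product with the truncation at level
  \<open>Q\<close>. Where \<open>a n\<close> vanishes, so does \<open>f n\<close>.\<close>

lemma u_le: "AE x in \<mu>. \<bar>u n x\<bar> \<le> Q"
proof (rule AE_bounded_of_energy_truncated[OF M \<beta> M_ell \<alpha> u_W012 less_imp_le[OF Q]], rule disjI1)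
  let ?v = "\<lambda>x. truncated Q (u n x)"
  have v: "?v \<in> W012 \<Omega>" using truncated_W012(1)[OF u_W012] Q by simp
  have vb: "AE x in \<mu>. \<bar>?v x\<bar> \<le> 1" by (simp add: abs_truncated_le)
  \<comment> \<open>This bound depends on \<open>n\<close> and serves only to make the integrals
    with \<open>a n\<close> and \<open>f n\<close> finite.\<close>
  obtain D where D: "AE x in \<mu>. \<bar>u n x\<bar> \<le> D"
    using u[of n] by (auto simp: solves_problem_def space_Linf_def)
  note [measurable] = W012_measurable[OF v] W012_measurable[OF u_W012]
  have uvb: "AE x in \<mu>. \<bar>u n x * ?v x\<bar> \<le> D"
    using D
  proof eventually_elim
    case (elim x)
    have "\<bar>u n x * ?v x\<bar> \<le> \<bar>u n x\<bar> * 1" unfolding abs_mult by (intro mult_left_mono abs_truncated_le) simp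
    then show ?case using elim by simp
  qed
  have "energy_form \<Omega> (M n) (u n) ?v = (LINT x|\<mu>. f n x * ?v x) - (LINT x|\<mu>. a n x * (u n x * ?v x))"
    by (rule u_equation[OF v vb])
  also have "\<dots> = (LINT x|\<mu>. f n x * ?v x - a n x * (u n x * ?v x))"
    by (intro Bochner_Integration.integral_diff[symmetric] integrable_mult_bounded[OF f_integrable _ vb]
        integrable_mult_bounded[OF a_integrable _ uvb]) measurable
  finally have eq: "energy_form \<Omega> (M n) (u n) ?v = (LINT x|\<mu>. f n x * ?v x - a n x * (u n x * ?v x))" .
  have "AE x in \<mu>. 0 \<le> - (f n x * ?v x - a n x * (u n x * ?v x))"
    using f_le[of n] a_nonneg[of n]
  proof eventually_elim
    case (elim x)
    show ?case
    proof (cases "a n x = 0")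
      case True
      then show ?thesis using elim by simp
    next
      case False
      then have pos: "a n x > 0" using elim by simp
      have "\<bar>f n x / a n x\<bar> \<le> Q" using elim(1) pos by (simp add: pos_divide_le_eq)
      then have "0 \<le> (u n x - f n x / a n x) * ?v x" using Q by (intro truncated_sgn) auto
      then have "0 \<le> a n x * ((u n x - f n x / a n x) * ?v x)" using pos by simp
      also have "\<dots> = - (f n x * ?v x - a n x * (u n x * ?v x))" using pos by (simp add: field_simps)
      finally show ?thesis .
    qed
  qed
  then have "0 \<le> (LINT x|\<mu>. - (f n x * ?v x - a n x * (u n x * ?v x)))" by (rule integral_nonneg_AE)
  then show "energy_form \<Omega> (M n) (u n) ?v \<le> 0" unfolding eq integral_minus by simp
qed

text \<open>The equation is tested with \<open>u n\<close>: the term with \<open>a n\<close> has a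
  favourable sign, and the right-hand side is at most \<open>Q\<close> times the L1 norm of
  \<open>f n\<close>.\<close>

lemma u_jets_bounded:
  obtains B where "\<And>n. norm (jet (u n)) \<le> B"
proof -
  obtain K where K: "\<And>n. (LINT x|\<mu>. \<bar>f n x\<bar>) \<le> K" by (rule L1_bound) blast
  obtain \<gamma> where \<gamma>: "\<gamma> > 0" "\<And>n s. s \<in> sobolev_jets \<Longrightarrow> \<gamma> * (norm s)\<^sup>2 \<le> energy (M n) s s"
    by (rule coercive_constant) blast
  have "norm (jet (u n)) \<le> sqrt (Q * K / \<gamma>)" for n
  proof -
    note [measurable] = W012_measurable[OF u_W012]
    have "\<gamma> * (norm (jet (u n)))\<^sup>2 \<le> energy_form \<Omega> (M n) (u n) (u n)"
      using \<gamma>(2)[OF W012_jet[OF u_W012], of n n] energy_jet[OF M \<beta> W012_W12[OF u_W012] W012_W12[OF u_W012]] by simp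
    also have "\<dots> = (LINT x|\<mu>. f n x * u n x) - (LINT x|\<mu>. a n x * (u n x * u n x))"
      by (rule u_equation[OF u_W012 u_le])
    also have "\<dots> \<le> (LINT x|\<mu>. f n x * u n x)"
    proof -
      have "0 \<le> (LINT x|\<mu>. a n x * (u n x * u n x))"
        using a_nonneg[of n] by (intro integral_nonneg_AE) (auto elim: AE_mp)
      then show ?thesis by simp
    qed
    also have "\<dots> \<le> (LINT x|\<mu>. Q * \<bar>f n x\<bar>)"
    proof (intro integral_mono_AE integrable_mult_bounded[OF f_integrable _ u_le])
      show "AE x in \<mu>. f n x * u n x \<le> Q * \<bar>f n x\<bar>"
        using u_le[of n]
      proof eventually_elim
        case (elim x)
        have "f n x * u n x \<le> \<bar>f n x\<bar> * \<bar>u n x\<bar>" by (metis abs_ge_self abs_mult)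
        also have "\<dots> \<le> \<bar>f n x\<bar> * Q" using elim by (intro mult_left_mono) auto
        finally show ?case by (simp add: mult.commute)
      qed
    qed (use f_integrable in auto)
    also have "\<dots> \<le> Q * K" using K[of n] Q by (simp add: mult_left_mono)
    finally have "(norm (jet (u n)))\<^sup>2 \<le> Q * K / \<gamma>" using \<gamma>(1) by (simp add: field_simps)
    then show ?thesis by (rule real_le_rsqrt)
  qed
  then show ?thesis by (rule that)
qed

text \<open>
  The resolvent \<open>\<zeta>\<close> of the limiting adjoint operator is a bounded test function that is the limit of
  test functions adapted to \<open>M n\<close>; this replaces corrector functions and compensated compactness.
\<close>

lemma limit_equation_resolvent:
  fixes r :: "nat \<Rightarrow> nat"
  assumes r: "strict_mono r" and u0: "u0 \<in> W012 \<Omega>" "AE x in \<mu>. \<bar>u0 x\<bar> \<le> Q"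
    and lim: "(\<lambda>n. l2_on \<Omega> (u (r n))) \<longlonglongrightarrow> l2_on \<Omega> u0"
    and \<phi>: "\<phi> \<in> W012 \<Omega>" "AE x in \<mu>. \<bar>\<phi> x\<bar> \<le> C" and C: "C \<ge> 0" and k: "k > 0"
  obtains \<zeta> where "\<zeta> \<in> W012 \<Omega>" "AE x in \<mu>. \<bar>\<zeta> x\<bar> \<le> C"
    "\<And>v. v \<in> sobolev_jets \<Longrightarrow> energy M0 v (jet \<zeta>) = k * ((fst (jet \<phi>) - fst (jet \<zeta>)) \<bullet> fst v)"
    "energy M0 (jet u0) (jet \<zeta>) = (LINT x|\<mu>. f0 x * \<zeta> x) - (LINT x|\<mu>. a0 x * (u0 x * \<zeta> x))"
proof -
  obtain B where "\<And>n. \<exists>\<zeta>. \<zeta> \<in> W012 \<Omega> \<and> (AE x in \<mu>. \<bar>\<zeta> x\<bar> \<le> C) \<and> norm (jet \<zeta>) \<le> B \<and>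
    (\<forall>t\<in>sobolev_jets. energy (M n) t (jet \<zeta>) = k * ((fst (jet \<phi>) - fst (jet \<zeta>)) \<bullet> fst t))"
    by (rule resolvent[OF \<phi> C k]) blast
  then obtain Z where Z: "\<And>n. Z n \<in> W012 \<Omega>" "\<And>n. AE x in \<mu>. \<bar>Z n x\<bar> \<le> C" "\<And>n. norm (jet (Z n)) \<le> B"
    "\<And>n t. t \<in> sobolev_jets \<Longrightarrow> energy (M n) t (jet (Z n)) = k * ((fst (jet \<phi>) - fst (jet (Z n))) \<bullet> fst t)"
    by metis
  obtain s l where s: "strict_mono s" "l \<in> sobolev_jets" "\<And>y. (\<lambda>n. jet (Z (r (s n))) \<bullet> y) \<longlonglongrightarrow> l \<bullet> y"
    "(\<lambda>n. fst (jet (Z (r (s n))))) \<longlonglongrightarrow> fst l"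
    by (rule weak_compactness_sobolev_jets[of "\<lambda>n. jet (Z (r n))" B]) (use Z W012_jet in auto)
  obtain \<zeta> where \<zeta>: "\<zeta> \<in> W012 \<Omega>" "jet \<zeta> = l" by (rule sobolev_jets_surj[OF s(2)])
  define q where "q n = r (s n)" for n
  have q: "strict_mono q" using strict_mono_o[OF r s(1)] by (simp add: q_def[abs_def] o_def)
  have limZ: "(\<lambda>n. l2_on \<Omega> (Z (q n))) \<longlonglongrightarrow> l2_on \<Omega> \<zeta>"
    using s(4) by (simp add: \<zeta>(2)[symmetric] jet_def q_def)
  have limu: "(\<lambda>n. l2_on \<Omega> (u (q n))) \<longlonglongrightarrow> l2_on \<Omega> u0"
    using LIMSEQ_subseq_LIMSEQ[OF lim s(1)] by (simp add: o_def q_def)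
  have weakZ: "(\<lambda>n. jet (Z (q n)) \<bullet> y) \<longlonglongrightarrow> jet \<zeta> \<bullet> y" for y using s(3) by (simp add: \<zeta>(2) q_def)
  have fstZ: "(\<lambda>n. fst (jet (Z (q n)))) \<longlonglongrightarrow> fst (jet \<zeta>)" using s(4) by (simp add: \<zeta>(2) q_def)
  have \<zeta>b: "AE x in \<mu>. \<bar>\<zeta> x\<bar> \<le> C"
    by (rule AE_bound_l2_limit[OF W12_L2[OF W012_W12[OF Z(1)]] Z(2) W12_L2[OF W012_W12[OF \<zeta>(1)]] limZ])
  \<comment> \<open>Both sides are limits of \<open>energy M0 v\<close> along the adjoint solutions:
    the left one by weak convergence, the right one after \<open>v\<close> is replaced by its
    recovery sequence and the adjoint equation is used.\<close>
  have eq1: "energy M0 v (jet \<zeta>) = k * ((fst (jet \<phi>) - fst (jet \<zeta>)) \<bullet> fst v)" if v: "v \<in> sobolev_jets" for v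
  proof (rule LIMSEQ_unique)
    show "(\<lambda>n. energy M0 v (jet (Z (q n)))) \<longlonglongrightarrow> energy M0 v (jet \<zeta>)" by (rule energy_weak_limit[OF weakZ])
    obtain V where V: "\<And>n. V n \<in> sobolev_jets" "\<And>n t. t \<in> sobolev_jets \<Longrightarrow> energy (M n) (V n) t = energy M0 v t"
      "(\<lambda>n. fst (V n)) \<longlonglongrightarrow> fst v" by (rule recovery_sequence[OF v]) blast
    have "energy M0 v (jet (Z (q n))) = k * ((fst (jet \<phi>) - fst (jet (Z (q n)))) \<bullet> fst (V (q n)))" for n
      using V(2)[OF W012_jet[OF Z(1)], of "q n" "q n"] Z(4)[OF V(1), of "q n" "q n"] by simp
    moreover have "(\<lambda>n. fst (V (q n))) \<longlonglongrightarrow> fst v" using LIMSEQ_subseq_LIMSEQ[OF V(3) q] by (simp add: o_def)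
    ultimately show "(\<lambda>n. energy M0 v (jet (Z (q n)))) \<longlonglongrightarrow> k * ((fst (jet \<phi>) - fst (jet \<zeta>)) \<bullet> fst v)"
      by (simp only:) (intro tendsto_mult_left tendsto_inner tendsto_diff tendsto_const fstZ)
  qed
  obtain K where K: "\<And>n. (LINT x|\<mu>. \<bar>a n x\<bar>) \<le> K" "\<And>n. (LINT x|\<mu>. \<bar>f n x\<bar>) \<le> K"
    by (rule L1_bound) blast
  \<comment> \<open>The energy of \<open>u (q n)\<close> against \<open>Z (q n)\<close> is evaluated
    twice, by the adjoint equation and by the equation for \<open>u (q n)\<close>, and the two
    limits are compared.\<close>
  have eq2: "energy M0 (jet u0) (jet \<zeta>) = (LINT x|\<mu>. f0 x * \<zeta> x) - (LINT x|\<mu>. a0 x * (u0 x * \<zeta> x))"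
  proof (rule LIMSEQ_unique)
    have "energy (M n) (jet (u n)) (jet (Z n)) = k * ((fst (jet \<phi>) - fst (jet (Z n))) \<bullet> fst (jet (u n)))" for n
      by (rule Z(4)[OF W012_jet[OF u_W012]])
    moreover have "(\<lambda>n. k * ((fst (jet \<phi>) - fst (jet (Z (q n)))) \<bullet> fst (jet (u (q n)))))
        \<longlonglongrightarrow> k * ((fst (jet \<phi>) - fst (jet \<zeta>)) \<bullet> fst (jet u0))"
      using limu by (intro tendsto_mult_left tendsto_inner tendsto_diff tendsto_const fstZ) (simp add: jet_def)
    ultimately show "(\<lambda>n. energy (M (q n)) (jet (u (q n))) (jet (Z (q n)))) \<longlonglongrightarrow> energy M0 (jet u0) (jet \<zeta>)"
      using eq1[OF W012_jet[OF u0(1)]] by simp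
    have "energy (M n) (jet (u n)) (jet (Z n)) = (LINT x|\<mu>. f n x * Z n x) - (LINT x|\<mu>. a n x * (u n x * Z n x))" for n
      using u_equation[OF Z(1,2)] energy_jet[OF M \<beta> W012_W12[OF u_W012] W012_W12[OF Z(1)]] by simp
    moreover have "(\<lambda>n. LINT x|\<mu>. f (q n) x * Z (q n) x) \<longlonglongrightarrow> (LINT x|\<mu>. f0 x * \<zeta> x)"
      by (rule weak_L1_product_limit[OF weakly_converges_L1_subseq[OF f_weak q] K(2) W012_measurable[OF Z(1)] Z(2)
          W012_measurable[OF \<zeta>(1)] \<zeta>b limZ])
    moreover have "(\<lambda>n. LINT x|\<mu>. a (q n) x * (u (q n) x * Z (q n) x)) \<longlonglongrightarrow> (LINT x|\<mu>. a0 x * (u0 x * \<zeta> x))"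
    proof -
      note p = l2_product_limit[OF W012_measurable[OF u_W012] u_le W012_measurable[OF u0(1)] u0(2)
          W012_measurable[OF Z(1)] Z(2) W012_measurable[OF \<zeta>(1)] \<zeta>b limu limZ less_imp_le[OF Q] C]
      show ?thesis
        by (intro weak_L1_product_limit[OF weakly_converges_L1_subseq[OF a_weak q] K(1) _ p(2) _ p(3) p(1)]
            borel_measurable_times W012_measurable u_W012 Z(1) u0(1) \<zeta>(1))
    qed
    ultimately show "(\<lambda>n. energy (M (q n)) (jet (u (q n))) (jet (Z (q n)))) \<longlonglongrightarrow>
        (LINT x|\<mu>. f0 x * \<zeta> x) - (LINT x|\<mu>. a0 x * (u0 x * \<zeta> x))"
      by (simp only:) (intro tendsto_diff)
  qed
  show ?thesis by (rule that[OF \<zeta>(1) \<zeta>b eq1 eq2])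
qed

text \<open>The equation is known for the limiting resolvents with parameter \<open>Suc k\<close>,
  and \<open>k\<close> tends to infinity. These resolvents stay bounded in the Sobolev norm and by
  \<open>C\<close> pointwise and tend to \<open>\<phi>\<close> in L2; this suffices, since the
  energy with fixed first argument is weakly continuous.\<close>

lemma limit_equation:
  fixes r :: "nat \<Rightarrow> nat"
  assumes r: "strict_mono r" and u0: "u0 \<in> W012 \<Omega>" "AE x in \<mu>. \<bar>u0 x\<bar> \<le> Q"
    and lim: "(\<lambda>n. l2_on \<Omega> (u (r n))) \<longlonglongrightarrow> l2_on \<Omega> u0"
  shows "solves_problem \<Omega> M0 a0 f0 u0"
  unfolding solves_problem_def
proof (intro conjI ballI)
  show "u0 \<in> W012 \<Omega> \<inter> space_Linf \<Omega>" using u0 W012_measurable by (auto simp: space_Linf_def)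
  fix \<phi> assume "\<phi> \<in> W012 \<Omega> \<inter> space_Linf \<Omega>"
  then obtain C' where \<phi>: "\<phi> \<in> W012 \<Omega>" and C': "AE x in \<mu>. \<bar>\<phi> x\<bar> \<le> C'" by (auto simp: space_Linf_def)
  define C where "C = \<bar>C'\<bar>"
  have C: "C \<ge> 0" "AE x in \<mu>. \<bar>\<phi> x\<bar> \<le> C" using C' by (auto simp: C_def elim!: AE_mp)
  define P where "P k \<zeta> \<longleftrightarrow> \<zeta> \<in> W012 \<Omega> \<and> (AE x in \<mu>. \<bar>\<zeta> x\<bar> \<le> C) \<and>
    (\<forall>v\<in>sobolev_jets. energy M0 v (jet \<zeta>) = real (Suc k) * ((fst (jet \<phi>) - fst (jet \<zeta>)) \<bullet> fst v)) \<and>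
    energy M0 (jet u0) (jet \<zeta>) = (LINT x|\<mu>. f0 x * \<zeta> x) - (LINT x|\<mu>. a0 x * (u0 x * \<zeta> x))" for k \<zeta>
  have "\<exists>\<zeta>. P k \<zeta>" for k
    unfolding P_def by (rule limit_equation_resolvent[OF r u0 lim \<phi> C(2,1), of "real (Suc k)"]) auto
  then obtain Z where "\<And>k. P k (Z k)" by metis
  then have Z: "\<And>k. Z k \<in> W012 \<Omega>" "\<And>k. AE x in \<mu>. \<bar>Z k x\<bar> \<le> C"
    "\<And>k v. v \<in> sobolev_jets \<Longrightarrow> energy M0 v (jet (Z k)) = real (Suc k) * ((fst (jet \<phi>) - fst (jet (Z k))) \<bullet> fst v)"
    "\<And>k. energy M0 (jet u0) (jet (Z k)) = (LINT x|\<mu>. f0 x * Z k x) - (LINT x|\<mu>. a0 x * (u0 x * Z k x))"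
    unfolding P_def by blast+
  define d where "d k = jet (Z k) - jet \<phi>" for k
  have d: "d k \<in> sobolev_jets" for k
    unfolding d_def by (intro subspace_diff[OF subspace_sobolev_jets] W012_jet Z \<phi>)
  obtain \<gamma> where \<gamma>: "\<gamma> > 0" "\<And>s. s \<in> sobolev_jets \<Longrightarrow> \<gamma> * (norm s)\<^sup>2 \<le> energy M0 s s"
    by (rule coercive_constant) blast
  interpret E: bounded_bilinear "energy M0" by (rule bounded_bilinear_energy[OF M0 \<beta>0])
  obtain B0 where B0: "B0 > 0" "\<And>s t. norm (energy M0 s t) \<le> norm s * norm t * B0" using E.pos_bounded by blast
  \<comment> \<open>\<open>R\<close> bounds \<open>norm (d k)\<close> for all \<open>k\<close>: it
    results from \<open>est\<close> by dropping the term with \<open>Suc k\<close> and dividing by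
    \<open>\<gamma> * norm (d k)\<close>.\<close>
  define R where "R = norm (jet \<phi>) * B0 / \<gamma>"
  \<comment> \<open>The resolvent equation is tested with the error \<open>d k\<close> itself, and
    the energy of \<open>d k\<close> against \<open>\<phi>\<close> is moved to the right-hand
    side.\<close>
  have est: "\<gamma> * (norm (d k))\<^sup>2 + real (Suc k) * (norm (fst (d k)))\<^sup>2 \<le> norm (d k) * (\<gamma> * R)" for k
  proof -
    have "fst (jet \<phi>) - fst (jet (Z k)) = - fst (d k)" by (simp add: d_def)
    then have "energy M0 (d k) (jet (Z k)) = real (Suc k) * (- fst (d k) \<bullet> fst (d k))"
      using Z(3)[OF d, of k k] by (simp only:)
    moreover have "energy M0 (d k) (d k) = energy M0 (d k) (jet (Z k)) - energy M0 (d k) (jet \<phi>)"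
      unfolding d_def E.diff_right ..
    ultimately have "energy M0 (d k) (d k) = - (real (Suc k) * (norm (fst (d k)))\<^sup>2) - energy M0 (d k) (jet \<phi>)"
      by (simp only: inner_minus_left power2_norm_eq_inner mult_minus_right)
    moreover have "- energy M0 (d k) (jet \<phi>) \<le> norm (d k) * norm (jet \<phi>) * B0" using B0(2)[of "d k" "jet \<phi>"] by simp
    ultimately have "\<gamma> * (norm (d k))\<^sup>2 + real (Suc k) * (norm (fst (d k)))\<^sup>2 \<le> norm (d k) * norm (jet \<phi>) * B0"
      using \<gamma>(2)[OF d, of k] by simp
    then show ?thesis using \<gamma>(1) by (simp add: R_def mult_ac)
  qed
  have dR: "norm (d k) \<le> R" for k
  proof -
    have "norm (d k) * (\<gamma> * norm (d k)) \<le> norm (d k) * (\<gamma> * R)"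
    proof -
      have "0 \<le> real (Suc k) * (norm (fst (d k)))\<^sup>2" by simp
      moreover have "\<gamma> * (norm (d k))\<^sup>2 = norm (d k) * (\<gamma> * norm (d k))" by (simp add: power2_eq_square)
      ultimately show ?thesis using est[of k] by linarith
    qed
    then show ?thesis using \<gamma>(1) B0(1) by (cases "norm (d k) = 0") (auto simp: R_def mult_le_cancel_left pos_le_divide_eq mult.commute)
  qed
  have R0: "R \<ge> 0" using dR[of 0] norm_ge_zero order_trans by blast
  have "(norm (fst (d k)))\<^sup>2 \<le> R * (\<gamma> * R) * (1 / real (Suc k))" for k
  proof -
    have "real (Suc k) * (norm (fst (d k)))\<^sup>2 \<le> norm (d k) * (\<gamma> * R)"
    proof -
      have "0 \<le> \<gamma> * (norm (d k))\<^sup>2" using \<gamma>(1) by simp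
      then show ?thesis using est[of k] by linarith
    qed
    also have "\<dots> \<le> R * (\<gamma> * R)" using dR[of k] R0 \<gamma>(1) by (intro mult_right_mono) auto
    finally show ?thesis by (simp add: field_simps)
  qed
  then have "(\<lambda>k. (norm (fst (d k)))\<^sup>2) \<longlonglongrightarrow> 0"
    by (intro Lim_null_comparison[OF always_eventually[OF allI], of "\<lambda>k. (norm (fst (d k)))\<^sup>2" "\<lambda>k. R * (\<gamma> * R) * (1 / real (Suc k))"]
        tendsto_mult_right_zero LIMSEQ_Suc[OF lim_1_over_n]) simp
  then have "(\<lambda>k. sqrt ((norm (fst (d k)))\<^sup>2)) \<longlonglongrightarrow> sqrt 0" by (rule tendsto_real_sqrt)
  then have "(\<lambda>k. fst (jet (Z k)) - fst (jet \<phi>)) \<longlonglongrightarrow> 0" by (simp add: tendsto_norm_zero_iff d_def)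
  then have fstZ: "(\<lambda>k. fst (jet (Z k))) \<longlonglongrightarrow> fst (jet \<phi>)" by (rule LIM_zero_cancel)
  have Zb: "norm (jet (Z k)) \<le> R + norm (jet \<phi>)" for k
    using dR[of k] norm_triangle_ineq[of "d k" "jet \<phi>"] by (simp add: d_def)
  obtain s l where s: "strict_mono s" "l \<in> sobolev_jets" "\<And>y. (\<lambda>n. jet (Z (s n)) \<bullet> y) \<longlonglongrightarrow> l \<bullet> y"
    "(\<lambda>n. fst (jet (Z (s n)))) \<longlonglongrightarrow> fst l"
    by (rule weak_compactness_sobolev_jets[of "\<lambda>n. jet (Z n)", OF W012_jet[OF Z(1)] Zb]) blast
  have fstZs: "(\<lambda>n. fst (jet (Z (s n)))) \<longlonglongrightarrow> fst (jet \<phi>)" using LIMSEQ_subseq_LIMSEQ[OF fstZ s(1)] by (simp add: o_def)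
  \<comment> \<open>The weak limit is known only through its L2 component, which determines the
    jet.\<close>
  have "l = jet \<phi>" using LIMSEQ_unique[OF s(4) fstZs] by (rule sobolev_jets_fst_eqD[OF s(2) W012_jet[OF \<phi>]])
  then have "(\<lambda>n. energy M0 (jet u0) (jet (Z (s n)))) \<longlonglongrightarrow> energy M0 (jet u0) (jet \<phi>)"
    using energy_weak_limit[OF s(3)] by simp
  moreover have "(\<lambda>n. energy M0 (jet u0) (jet (Z (s n)))) \<longlonglongrightarrow>
      (LINT x|\<mu>. f0 x * \<phi> x) - (LINT x|\<mu>. a0 x * (u0 x * \<phi> x))"
  proof -
    have limZ: "(\<lambda>n. l2_on \<Omega> (Z (s n))) \<longlonglongrightarrow> l2_on \<Omega> \<phi>" using fstZs by (simp add: jet_def)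
    note \<phi>L2 = W12_L2[OF W012_W12[OF \<phi>]]
    have "(\<lambda>n. LINT x|\<mu>. f0 x * Z (s n) x) \<longlonglongrightarrow> (LINT x|\<mu>. f0 x * \<phi> x)"
      by (rule L1_product_limit[OF f0_integrable W012_measurable[OF Z(1)] Z(2) \<phi>L2 limZ])
    moreover have "(\<lambda>n. LINT x|\<mu>. (a0 x * u0 x) * Z (s n) x) \<longlonglongrightarrow> (LINT x|\<mu>. (a0 x * u0 x) * \<phi> x)"
      by (rule L1_product_limit[OF integrable_mult_bounded[OF a0_integrable W012_measurable[OF u0(1)] u0(2)]
            W012_measurable[OF Z(1)] Z(2) \<phi>L2 limZ])
    ultimately show ?thesis unfolding Z(4) by (intro tendsto_diff) (simp_all add: mult.assoc)
  qed
  ultimately have "energy M0 (jet u0) (jet \<phi>) = (LINT x|\<mu>. f0 x * \<phi> x) - (LINT x|\<mu>. a0 x * (u0 x * \<phi> x))"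
    by (rule LIMSEQ_unique)
  then show "energy_form \<Omega> M0 u0 \<phi> + (LINT x|\<mu>. a0 x * u0 x * \<phi> x) = (LINT x|\<mu>. f0 x * \<phi> x)"
    using energy_jet[OF M0 \<beta>0 W012_W12[OF u0(1)] W012_W12[OF \<phi>]] by (simp add: mult.assoc)
qed

section \<open>Uniqueness and convergence of the whole sequence\<close>

text \<open>The difference of two solutions is an admissible test function. Since \<open>a0\<close>
  is nonnegative, its energy is at most 0, and coercivity makes it vanish.\<close>

lemma limit_problem_unique:
  assumes v: "solves_problem \<Omega> M0 a0 f0 v" and w: "solves_problem \<Omega> M0 a0 f0 w"
  shows "AE x in \<mu>. v x = w x"
proof -
  have vW: "v \<in> W012 \<Omega>" and wW: "w \<in> W012 \<Omega>" using v w by (auto simp: solves_problem_def)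
  obtain A where A: "AE x in \<mu>. \<bar>v x\<bar> \<le> A" using v by (auto simp: solves_problem_def space_Linf_def)
  obtain B where B: "AE x in \<mu>. \<bar>w x\<bar> \<le> B" using w by (auto simp: solves_problem_def space_Linf_def)
  define \<phi> where "\<phi> x = v x - w x" for x
  have \<phi>: "\<phi> \<in> W012 \<Omega>" and J: "jet \<phi> = jet v - jet w"
    using W012_diff[OF vW wW] W12_diff(2)[OF W012_W12[OF vW] W012_W12[OF wW]] by (simp_all add: \<phi>_def[abs_def])
  note [measurable] = W012_measurable[OF vW] W012_measurable[OF wW] W012_measurable[OF \<phi>]
  have \<phi>b: "AE x in \<mu>. \<bar>\<phi> x\<bar> \<le> A + B" using A B by eventually_elim (simp add: \<phi>_def)
  then have "\<phi> \<in> space_Linf \<Omega>" by (auto simp: space_Linf_def)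
  then have eqv: "energy_form \<Omega> M0 v \<phi> + (LINT x|\<mu>. a0 x * v x * \<phi> x) = (LINT x|\<mu>. f0 x * \<phi> x)"
    and eqw: "energy_form \<Omega> M0 w \<phi> + (LINT x|\<mu>. a0 x * w x * \<phi> x) = (LINT x|\<mu>. f0 x * \<phi> x)"
    using v w \<phi> by (auto simp: solves_problem_def)
  have i: "integrable \<mu> (\<lambda>x. a0 x * v x * \<phi> x)" "integrable \<mu> (\<lambda>x. a0 x * w x * \<phi> x)"
    using integrable_mult_bounded[OF integrable_mult_bounded[OF a0_integrable _ A] _ \<phi>b]
      integrable_mult_bounded[OF integrable_mult_bounded[OF a0_integrable _ B] _ \<phi>b] by simp_all
  have "(LINT x|\<mu>. a0 x * v x * \<phi> x) - (LINT x|\<mu>. a0 x * w x * \<phi> x)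
      = (LINT x|\<mu>. a0 x * v x * \<phi> x - a0 x * w x * \<phi> x)"
    using i by (rule Bochner_Integration.integral_diff[symmetric])
  also have "\<dots> = (LINT x|\<mu>. a0 x * (\<phi> x * \<phi> x))"
    by (intro Bochner_Integration.integral_cong) (auto simp: \<phi>_def algebra_simps)
  also have "\<dots> \<ge> 0" using a0_nonneg by (intro integral_nonneg_AE) (auto elim: AE_mp)
  finally have nn: "0 \<le> (LINT x|\<mu>. a0 x * v x * \<phi> x) - (LINT x|\<mu>. a0 x * w x * \<phi> x)" .
  interpret E: bounded_bilinear "energy M0" by (rule bounded_bilinear_energy[OF M0 \<beta>0])
  have "energy M0 (jet \<phi>) (jet \<phi>) = energy_form \<Omega> M0 v \<phi> - energy_form \<Omega> M0 w \<phi>"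
    using energy_jet[OF M0 \<beta>0 W012_W12[OF vW] W012_W12[OF \<phi>]] energy_jet[OF M0 \<beta>0 W012_W12[OF wW] W012_W12[OF \<phi>]]
    by (metis E.diff_left J)
  then have "energy M0 (jet \<phi>) (jet \<phi>) \<le> 0" using eqv eqw nn by linarith
  moreover obtain \<gamma> where "\<gamma> > 0" "\<gamma> * (norm (jet \<phi>))\<^sup>2 \<le> energy M0 (jet \<phi>) (jet \<phi>)"
    using coercive_constant W012_jet[OF \<phi>] by metis
  ultimately have "jet \<phi> = 0" by (smt (verit) mult_pos_pos norm_eq_zero zero_less_power2)
  then have "l2_on \<Omega> v = l2_on \<Omega> w" using J by (simp add: jet_def prod_eq_iff)
  then show ?thesis
    using l2_on_eq_iff[OF domain_lebesgue W12_L2[OF W012_W12[OF vW]] W12_L2[OF W012_W12[OF wW]]] by simp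
qed

lemma subsequence_limit:
  fixes r :: "nat \<Rightarrow> nat"
  assumes r: "strict_mono r"
  obtains s u0 where "strict_mono s" "solves_problem \<Omega> M0 a0 f0 u0" "AE x in \<mu>. \<bar>u0 x\<bar> \<le> Q"
    "\<And>y. (\<lambda>n. jet (u (r (s n))) \<bullet> y) \<longlonglongrightarrow> jet u0 \<bullet> y" "(\<lambda>n. l2_on \<Omega> (u (r (s n)))) \<longlonglongrightarrow> l2_on \<Omega> u0"
proof -
  obtain B where B: "\<And>n. norm (jet (u n)) \<le> B" by (rule u_jets_bounded) blast
  obtain s l where s: "strict_mono s" "l \<in> sobolev_jets" "\<And>y. (\<lambda>n. jet (u (r (s n))) \<bullet> y) \<longlonglongrightarrow> l \<bullet> y"
    "(\<lambda>n. fst (jet (u (r (s n))))) \<longlonglongrightarrow> fst l"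
    by (rule weak_compactness_sobolev_jets[of "\<lambda>n. jet (u (r n))", OF W012_jet[OF u_W012] B]) blast
  obtain u0 where u0: "u0 \<in> W012 \<Omega>" "jet u0 = l" by (rule sobolev_jets_surj[OF s(2)])
  have lim: "(\<lambda>n. l2_on \<Omega> (u (r (s n)))) \<longlonglongrightarrow> l2_on \<Omega> u0" using s(4) by (simp add: u0(2)[symmetric] jet_def)
  have b: "AE x in \<mu>. \<bar>u0 x\<bar> \<le> Q"
    by (rule AE_bound_l2_limit[OF u_L2 u_le W12_L2[OF W012_W12[OF u0(1)]] lim])
  have "strict_mono (\<lambda>n. r (s n))" using strict_mono_o[OF r s(1)] by (simp add: o_def)
  then have "solves_problem \<Omega> M0 a0 f0 u0" by (rule limit_equation[OF _ u0(1) b lim])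
  then show ?thesis using that s(1) b s(3)[folded u0(2)] lim by blast
qed

lemma homogenized_limit:
  "\<exists>u0. solves_problem \<Omega> M0 a0 f0 u0 \<and>
    (\<forall>v. solves_problem \<Omega> M0 a0 f0 v \<longrightarrow> (AE x in \<mu>. v x = u0 x)) \<and>
    weakly_converges_W012 \<Omega> u u0 \<and> weakly_star_converges_Linf \<Omega> u u0 \<and>
    (\<lambda>n. energy_form \<Omega> (M n) (u n) (u n)) \<longlonglongrightarrow> energy_form \<Omega> M0 u0 u0"
proof -
  \<comment> \<open>The identity subsequence fixes \<open>u0\<close>; the limits of all other
    subsequences are identified with it in \<open>sub\<close>.\<close>
  obtain s0 u0 where u0: "solves_problem \<Omega> M0 a0 f0 u0" "AE x in \<mu>. \<bar>u0 x\<bar> \<le> Q"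
    by (rule subsequence_limit[OF strict_mono_id]) blast
  have u0W: "u0 \<in> W012 \<Omega>" "u0 \<in> space_Linf \<Omega>" using u0(1) by (auto simp: solves_problem_def)
  note u0L2 = W12_L2[OF W012_W12[OF u0W(1)]]
  have sub: "\<exists>s. strict_mono s \<and> (\<forall>y. (\<lambda>n. jet (u (r (s n))) \<bullet> y) \<longlonglongrightarrow> jet u0 \<bullet> y) \<and>
      (\<lambda>n. l2_on \<Omega> (u (r (s n)))) \<longlonglongrightarrow> l2_on \<Omega> u0" if r: "strict_mono r" for r :: "nat \<Rightarrow> nat"
  proof -
    obtain s v where s: "strict_mono s" "solves_problem \<Omega> M0 a0 f0 v"
      "\<And>y. (\<lambda>n. jet (u (r (s n))) \<bullet> y) \<longlonglongrightarrow> jet v \<bullet> y" "(\<lambda>n. l2_on \<Omega> (u (r (s n)))) \<longlonglongrightarrow> l2_on \<Omega> v"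
      by (rule subsequence_limit[OF r]) blast
    have v: "v \<in> W012 \<Omega>" using s(2) by (auto simp: solves_problem_def)
    have "l2_on \<Omega> v = l2_on \<Omega> u0"
      using l2_on_eq_iff[OF domain_lebesgue W12_L2[OF W012_W12[OF v]] u0L2] limit_problem_unique[OF s(2) u0(1)] by simp
    moreover from this have "jet v = jet u0" by (rule jet_cong[OF W012_W12[OF v] W012_W12[OF u0W(1)]])
    ultimately show ?thesis using s by (intro exI[of _ s]) simp
  qed
  have weak: "(\<lambda>n. jet (u n) \<bullet> y) \<longlonglongrightarrow> jet u0 \<bullet> y" for y
    by (rule LIMSEQ_subsequence_principle) (use sub in blast)
  have lim: "(\<lambda>n. l2_on \<Omega> (u n)) \<longlonglongrightarrow> l2_on \<Omega> u0"
    by (rule LIMSEQ_subsequence_principle) (use sub in blast)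
  have "weakly_converges_W012 \<Omega> u u0" using weakly_converges_W012_iff[of u u0, OF u_W012 u0W(1)] weak by blast
  moreover have "weakly_star_converges_Linf \<Omega> u u0"
    unfolding weakly_star_converges_Linf_def
  proof (intro conjI allI ballI u0W(2))
    show "u n \<in> space_Linf \<Omega>" for n using u[of n] by (simp add: solves_problem_def)
    fix h assume "h \<in> space_L1 \<Omega>"
    then have "integrable \<mu> h" by (simp add: space_L1_def)
    \<comment> \<open>Against an integrable \<open>h\<close>, the uniform bound \<open>Q\<close> and
      strong convergence in L2 are enough.\<close>
    from L1_product_limit[OF this W012_measurable[OF u_W012] u_le u0L2 lim]
    show "(\<lambda>n. LINT x|\<mu>. u n x * h x) \<longlonglongrightarrow> (LINT x|\<mu>. u0 x * h x)"
      by (simp only: mult.commute)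
  qed
  moreover have "(\<lambda>n. energy_form \<Omega> (M n) (u n) (u n)) \<longlonglongrightarrow> energy_form \<Omega> M0 u0 u0"
  proof -
    obtain K where K: "\<And>n. (LINT x|\<mu>. \<bar>a n x\<bar>) \<le> K" "\<And>n. (LINT x|\<mu>. \<bar>f n x\<bar>) \<le> K"
      by (rule L1_bound) blast
    note m = W012_measurable[OF u_W012] and m0 = W012_measurable[OF u0W(1)]
    have "(\<lambda>n. LINT x|\<mu>. f n x * u n x) \<longlonglongrightarrow> (LINT x|\<mu>. f0 x * u0 x)"
      by (rule weak_L1_product_limit[OF f_weak K(2) m u_le m0 u0(2) lim])
    moreover have "(\<lambda>n. LINT x|\<mu>. a n x * (u n x * u n x)) \<longlonglongrightarrow> (LINT x|\<mu>. a0 x * (u0 x * u0 x))"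
    proof -
      \<comment> \<open>The square of \<open>u n\<close> is itself bounded and converges in L2, so
        it may be paired with the weakly convergent \<open>a n\<close>.\<close>
      note p = l2_product_limit[OF m u_le m0 u0(2) m u_le m0 u0(2) lim lim less_imp_le[OF Q] less_imp_le[OF Q]]
      show ?thesis
        by (intro weak_L1_product_limit[OF a_weak K(1) _ p(2) _ p(3) p(1)] borel_measurable_times m m0)
    qed
    moreover have "energy_form \<Omega> M0 u0 u0 = (LINT x|\<mu>. f0 x * u0 x) - (LINT x|\<mu>. a0 x * (u0 x * u0 x))"
    proof -
      have "energy_form \<Omega> M0 u0 u0 + (LINT x|\<mu>. a0 x * u0 x * u0 x) = (LINT x|\<mu>. f0 x * u0 x)"
        using u0(1) by (simp add: solves_problem_def)
      then show ?thesis by (simp add: mult.assoc)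
    qed
    ultimately show ?thesis
      unfolding u_equation[OF u_W012 u_le] by (simp only:) (intro tendsto_diff)
  qed
  ultimately show ?thesis using u0(1) limit_problem_unique by blast
qed

end

text \<open>As functions are representatives, the solution of the limit problem is expressed by
  existence together with uniqueness almost everywhere; the convergence statements concern the
  representative produced.\<close>

theorem theorem1p2:
  fixes \<Omega> :: "(real^'n::finite) set"
    and \<alpha> \<beta> Q :: real
    and M :: "nat \<Rightarrow> real^'n \<Rightarrow> real^'n^'n" and M0 :: "real^'n \<Rightarrow> real^'n^'n"
    and a f u :: "nat \<Rightarrow> real^'n \<Rightarrow> real" and a0 f0 :: "real^'n \<Rightarrow> real"
  assumes "bounded \<Omega>" and "open \<Omega>"
    and "\<alpha> > 0" and "\<beta> > 0"
    and "\<And>n. M n \<in> borel_measurable (lebesgue_on \<Omega>)"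
    and "\<And>n. AE x in lebesgue_on \<Omega>. \<forall>\<xi>. \<alpha> * (norm \<xi>)\<^sup>2 \<le> (M n x *v \<xi>) \<bullet> \<xi>"
    and "\<And>n. AE x in lebesgue_on \<Omega>. norm (M n x) \<le> \<beta>"
    and "G_converges \<Omega> M M0"
    and "\<And>n. a n \<in> space_L1 \<Omega>" and "\<And>n. f n \<in> space_L1 \<Omega>"
    and "Q > 0"
    and "\<And>n. AE x in lebesgue_on \<Omega>. \<bar>f n x\<bar> \<le> Q * a n x"
    and "weakly_converges_L1 \<Omega> f f0" and "weakly_converges_L1 \<Omega> a a0"
    and "\<And>n. solves_problem \<Omega> (M n) (a n) (f n) (u n)"
  shows "\<exists>u0. solves_problem \<Omega> M0 a0 f0 u0 \<and>
              (\<forall>v. solves_problem \<Omega> M0 a0 f0 v \<longrightarrow> (AE x in lebesgue_on \<Omega>. v x = u0 x)) \<and>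
              weakly_converges_W012 \<Omega> u u0 \<and>
              weakly_star_converges_Linf \<Omega> u u0 \<and>
              (\<lambda>n. energy_form \<Omega> (M n) (u n) (u n)) \<longlonglongrightarrow> energy_form \<Omega> M0 u0 u0"
proof -
  have "bounded_elliptic \<Omega> M0" using assms(8) by (simp add: G_converges_def)
  then obtain c C where M0: "M0 \<in> borel_measurable (lebesgue_on \<Omega>)" "AE x in lebesgue_on \<Omega>. norm (M0 x) \<le> C"
    and c: "c > 0" "AE x in lebesgue_on \<Omega>. \<forall>\<xi>. c * (norm \<xi>)\<^sup>2 \<le> (M0 x *v \<xi>) \<bullet> \<xi>"
    by (auto simp: bounded_elliptic_def space_Linf_def)
  \<comment> \<open>The essential bound \<open>C\<close> may be negative when
    \<open>\<Omega>\<close> is null, while the locale asks for a nonnegative constant.\<close>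
  have "AE x in lebesgue_on \<Omega>. norm (M0 x) \<le> \<bar>C\<bar>" using M0(2) by eventually_elim simp
  then interpret weakly_convergent_problems \<Omega> M M0 \<alpha> \<beta> c "\<bar>C\<bar>" a f u a0 f0 Q
    using assms M0(1) c by unfold_locales auto
  show ?thesis by (rule homogenized_limit)
qed

end
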